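(* Let $M$ be a regular analytic surface in $\mathbb R^3_1$. (1) Let ${\rm p}\in M$ be a spacelike umbilic point and suppose that the discriminant of the equation of the lines of principal curvature has an $A_{2k-1}^+$-singularity at ${\rm p}$, $k\ge1$. Then the multiplicity $m_u({\rm p})$ is $k$. (2) Let ${\rm p}\in M$ be a timelike umbilic point and suppose that the $LPL$ has a simple singularity at ${\rm p}$. Then the multiplicity of ${\rm p}$ is as follows: - if the singularity of the $LPL$ at ${\rm p}$ is $A^-_{2k-1}$, then $m_u({\rm p})=k$; - if it is $D_{2k+1}$ or $D^+_{2k}$, then $m_u({\rm p})=2$; - if it is $D^-_{2k}$, then $m_u({\rm p})=2$ or $m_u({\rm p})=k$; - if it is $E_7$, then $m_u({\rm p})=3$.
   Context: $\mathbb R^3_1$ is $\mathbb R^3$ with the pseudo-scalar product $\langle u,v\rangle=u_0v_0+u_1v_1-u_2v_2$; $\langle u\times v,w\rangle=\det(u,v,w)$. For a local parametrisation $\mathbf x(u,v)$ of $M$, put $E=\langle \mathbf x_u,\mathbf x_u\rangle$, $F=\langle \mathbf x_u,\mathbf x_v\rangle$, $G=\langle \mathbf x_v,\mathbf x_v\rangle$, $\bar l=\langle \mathbf x_u\times \mathbf x_v,\mathbf x_{uu}\rangle$, $\bar m=\langle \mathbf x_u\times \mathbf x_v,\mathbf x_{uv}\rangle$, $\bar n=\langle \mathbf x_u\times \mathbf x_v,\mathbf x_{vv}\rangle$, $\mathfrak a=F\bar n-G\bar m$, $\mathfrak b=E\bar n-G\bar l$, $\mathfrak c=E\bar m-F\bar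 l$. The lines of principal curvature are the solutions of $\mathfrak a\,dv^2+\mathfrak b\,du\,dv+\mathfrak c\,du^2=0$; its discriminant is the zero set of $\delta=\mathfrak b^2-4\mathfrak a\mathfrak c$, called the Lightlike Principal Locus ($LPL$) in the Lorentzian region. A point ${\rm p}=\mathbf x(q)$ is an umbilic point if $\mathfrak a(q)=\mathfrak b(q)=\mathfrak c(q)=0$; it is spacelike (resp. timelike) if the induced metric at ${\rm p}$ is Riemannian, $F^2-EG<0$ (resp. Lorentzian, $F^2-EG>0$). Multiplicity: with $\mathcal O_2$ the ring of germs (at $q$) of holomorphic functions in two variables and $m(h,k)=\dim_{\mathbb C}\mathcal O_2/\langle h,k\rangle$ (real analytic germs complexified), $m_u({\rm p})=m(\mathfrak b,\mathfrak c)$ if $E(q)\neq0$, $m(\mathfrak a,\mathfrak c)$ if $F(q)\ne 0$, $m(\mathfrak a,\mathfrak b)$ if $G(q)\neq 0$ (at least one of these holds). The discriminant (or $LPL$) has a given singularity type at ${\rm p}$ if the germ of $\delta$ at $q$ is, up to sign, $\mathcal R$-equivalent (equal after composition with a germ of a diffeomorphism) to the corresponding Arnold normal form. The simple singularities are: $A_k^{\pm}$: $\pm(x^2\pm y^{k+1})$, $k\ge1$ (so $A_{2k-1}^{+}$: $\pm(x^2+y^{2k})$, $A_{2k-1}^-$: $\pm(x^2-y^{2k})$); $D_k^\pm$: $x^2y\pm y^{k-1}$, $k\ge4$ (for odd index the sign is omitted); $E_6$: $x^3+y^4$; $E_7$: $x^3+xy^3$; $E_8$: $x^3+y^5$. 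*)

theory Defs
  imports
    "HOL-Analysis.Analysis"
    "HOL-Algebra.Embedded_Algebras"
    "HOL-Algebra.QuotRing"
begin

section \<open>Minkowski 3-space\<close>

text \<open>The coordinates \<open>(u\<^sub>0, u\<^sub>1, u\<^sub>2)\<close> are the components \<open>$1\<close>, \<open>$2\<close>, \<open>$3\<close>.\<close>

definition mink :: "real^3 \<Rightarrow> real^3 \<Rightarrow> real" where
  "mink u v = u$1 * v$1 + u$2 * v$2 - u$3 * v$3"

definition mink_cross :: "real^3 \<Rightarrow> real^3 \<Rightarrow> real^3" where
  "mink_cross u v =
     vector [u$2 * v$3 - u$3 * v$2, u$3 * v$1 - u$1 * v$3, - (u$1 * v$2 - u$2 * v$1)]"

lemma mink_cross_det: "mink (mink_cross u v) w = det (vector [u, v, w] :: real^3^3)"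
  by (simp add: mink_def mink_cross_def det_3 algebra_simps)

section \<open>Partial derivatives, smooth and analytic maps of two variables\<close>

definition pdu :: "(real \<times> real \<Rightarrow> 'a::real_normed_vector) \<Rightarrow> real \<times> real \<Rightarrow> 'a" where
  "pdu f = (\<lambda>(u, v). vector_derivative (\<lambda>s. f (s, v)) (at u))"

definition pdv :: "(real \<times> real \<Rightarrow> 'a::real_normed_vector) \<Rightarrow> real \<times> real \<Rightarrow> 'a" where
  "pdv f = (\<lambda>(u, v). vector_derivative (\<lambda>s. f (u, s)) (at v))"

text \<open>\<open>C\<^sup>n\<close> maps; only used on open sets.\<close>

fun Cn_on :: "nat \<Rightarrow> (real \<times> real) set \<Rightarrow> (real \<times> real \<Rightarrow> 'a::real_normed_vector) \<Rightarrow> bool" where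
  "Cn_on 0 S f = continuous_on S f"
| "Cn_on (Suc n) S f = (f differentiable_on S \<and> Cn_on n S (pdu f) \<and> Cn_on n S (pdv f))"

definition smooth2_on :: "(real \<times> real) set \<Rightarrow> (real \<times> real \<Rightarrow> 'a::real_normed_vector) \<Rightarrow> bool" where
  "smooth2_on S f = (\<forall>n. Cn_on n S f)"

text \<open>\<open>f\<close> is, on a neighbourhood of \<open>q\<close>, the sum of the power series in two variables centred
  at \<open>q\<close> with coefficients \<open>c i j\<close>. It is used over the reals and over the complex numbers.\<close>

definition has_power_series2 ::
    "(nat \<Rightarrow> nat \<Rightarrow> 'a::real_normed_field) \<Rightarrow> ('a \<times> 'a \<Rightarrow> 'a) \<Rightarrow> 'a \<times> 'a \<Rightarrow> bool" where
  "has_power_series2 c f q =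
     (\<forall>\<^sub>F h in nhds 0. ((\<lambda>(i, j). c i j * fst h ^ i * snd h ^ j) has_sum f (q + h)) UNIV)"

definition analytic2_at :: "('a::real_normed_field \<times> 'a \<Rightarrow> 'a) \<Rightarrow> 'a \<times> 'a \<Rightarrow> bool" where
  "analytic2_at f q = (\<exists>c. has_power_series2 c f q)"

definition cpoint :: "real \<times> real \<Rightarrow> complex \<times> complex" where
  "cpoint q = (complex_of_real (fst q), complex_of_real (snd q))"

text \<open>Complexification of a real analytic germ: the same power series, with complex arguments.
  Only the germ of the chosen function at \<open>cpoint q\<close> matters.\<close>

definition complexify :: "(real \<times> real \<Rightarrow> real) \<Rightarrow> real \<times> real \<Rightarrow> complex \<times> complex \<Rightarrow> complex" where
  "complexify f q =
     (SOME F. \<exists>c. has_power_series2 c f q \<and>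
                  has_power_series2 (\<lambda>i j. complex_of_real (c i j)) F (cpoint q))"

lemma complexify_power_series:
  assumes "analytic2_at (f :: real \<times> real \<Rightarrow> real) q"
  shows "\<exists>c. has_power_series2 c f q \<and>
           has_power_series2 (\<lambda>i j. complex_of_real (c i j)) (complexify f q) (cpoint q)"
proof -
  obtain c where c: "has_power_series2 c f q" using assms by (auto simp: analytic2_at_def)
  then obtain e where e: "e > 0"
    "\<And>h. dist h 0 < e \<Longrightarrow> ((\<lambda>(i, j). c i j * fst h ^ i * snd h ^ j) has_sum f (q + h)) UNIV"
    unfolding has_power_series2_def eventually_nhds_metric by auto
  define r where "r = e / 4"
  have r: "r > 0" using e by (simp add: r_def)
  have "dist ((r, r) :: real \<times> real) 0 < e"
    using e real_sqrt_sum_squares_triangle_ineq[of r 0 0 r]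
    by (simp add: dist_prod_def r_def)
  from e(2)[OF this] have "(\<lambda>(i, j). c i j * r ^ i * r ^ j) summable_on UNIV"
    by (auto simp: summable_on_def)
  then have sr: "(\<lambda>p. norm (case p of (i, j) \<Rightarrow> c i j * r ^ i * r ^ j)) summable_on UNIV"
    by (rule summable_on_iff_abs_summable_on_real[THEN iffD1])
  define F where "F w = infsum (\<lambda>(i, j). complex_of_real (c i j) * (fst (w - cpoint q)) ^ i * (snd (w - cpoint q)) ^ j) UNIV" for w
  have "((\<lambda>(i, j). complex_of_real (c i j) * fst h ^ i * snd h ^ j) has_sum F (cpoint q + h)) UNIV"
    if "dist h 0 < r" for h
  proof -
    have n: "norm (fst h) \<le> r" "norm (snd h) \<le> r"
      using that norm_fst_le[of "fst h" "snd h"] norm_snd_le[of "snd h" "fst h"] by simp_all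
    have "(\<lambda>p. norm (case p of (i, j) \<Rightarrow> complex_of_real (c i j) * fst h ^ i * snd h ^ j)) summable_on UNIV"
      by (rule Infinite_Sum.abs_summable_on_comparison_test[OF sr])
         (use n r in \<open>auto simp: norm_mult norm_power abs_mult intro!: mult_mono power_mono\<close>)
    then show ?thesis
      unfolding F_def by (simp add: summable_on_iff_abs_summable_on_complex[symmetric])
  qed
  then have "has_power_series2 (\<lambda>i j. complex_of_real (c i j)) F (cpoint q)"
    unfolding has_power_series2_def eventually_nhds_metric using r by blast
  with c show ?thesis unfolding complexify_def
    by (intro someI_ex[where P = "\<lambda>F. \<exists>c. has_power_series2 c f q \<and>
                  has_power_series2 (\<lambda>i j. complex_of_real (c i j)) F (cpoint q)"]) blast
qed

lemma analytic2_at_const: "analytic2_at (\<lambda>_. c :: complex) z"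
proof -
  define C :: "nat \<Rightarrow> nat \<Rightarrow> complex" where "C i j = (if i = 0 \<and> j = 0 then c else 0)" for i j
  have "((\<lambda>(i, j). C i j * fst h ^ i * snd h ^ j) has_sum c) UNIV" for h :: "complex \<times> complex"
  proof -
    have "((\<lambda>(i, j). C i j * fst h ^ i * snd h ^ j) has_sum c) {(0,0)}"
      using has_sum_finite[of "{(0::nat,0::nat)}" "\<lambda>(i, j). C i j * fst h ^ i * snd h ^ j"]
      by (simp add: C_def)
    also have "?this \<longleftrightarrow> ?thesis"
      by (rule has_sum_cong_neutral) (auto simp: C_def split: if_splits)
    finally show ?thesis .
  qed
  then show ?thesis unfolding analytic2_at_def has_power_series2_def
    by (intro exI[of _ C] always_eventually) auto
qed

lemma analytic2_at_add:
  fixes f g :: "complex \<times> complex \<Rightarrow> complex"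
  assumes "analytic2_at f z" "analytic2_at g z"
  shows "analytic2_at (\<lambda>w. f w + g w) z"
proof -
  obtain c d where
    c: "\<forall>\<^sub>F h in nhds 0. ((\<lambda>(i, j). c i j * fst h ^ i * snd h ^ j) has_sum f (z + h)) UNIV" and
    d: "\<forall>\<^sub>F h in nhds 0. ((\<lambda>(i, j). d i j * fst h ^ i * snd h ^ j) has_sum g (z + h)) UNIV"
    using assms unfolding analytic2_at_def has_power_series2_def by blast
  from c d have "\<forall>\<^sub>F h in nhds 0. ((\<lambda>(i, j). (c i j + d i j) * fst h ^ i * snd h ^ j) has_sum
      (f (z + h) + g (z + h))) UNIV"
  proof eventually_elim
    case (elim h)
    from has_sum_add[OF elim] show ?case by (simp add: case_prod_unfold algebra_simps)
  qed
  then show ?thesis unfolding analytic2_at_def has_power_series2_def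
    by (intro exI[of _ "\<lambda>i j. c i j + d i j"])
qed

lemma has_sum_product:
  fixes f :: "'a \<Rightarrow> complex" and g :: "'b \<Rightarrow> complex"
  assumes f: "(f has_sum a) A" and g: "(g has_sum b) B"
  shows "((\<lambda>(x, y). f x * g y) has_sum (a * b)) (A \<times> B)"
proof (rule has_sum_SigmaI)
  show "((\<lambda>y. case (x, y) of (x, y) \<Rightarrow> f x * g y) has_sum (f x * b)) B" for x
    using g by (simp add: has_sum_cmult_right)
  show "((\<lambda>x. f x * b) has_sum (a * b)) A"
    using f by (simp add: has_sum_cmult_left)
  have sf: "(\<lambda>x. norm (f x)) summable_on A" and sg: "(\<lambda>x. norm (g x)) summable_on B"
    using f g summable_on_iff_abs_summable_on_complex by (auto simp: summable_on_def)
  have "(\<lambda>p. norm (case p of (x, y) \<Rightarrow> f x * g y)) summable_on A \<times> B"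
    unfolding Infinite_Sum.abs_summable_on_Sigma_iff
    using sf sg by (auto simp: norm_mult infsum_cmult_right' abs_mult infsum_nonneg intro!: summable_on_cmult_right summable_on_cmult_left)
  then show "(\<lambda>(x, y). f x * g y) summable_on A \<times> B"
    by (simp add: summable_on_iff_abs_summable_on_complex)
qed

lemma analytic2_at_mult:
  fixes f g :: "complex \<times> complex \<Rightarrow> complex"
  assumes "analytic2_at f z" "analytic2_at g z"
  shows "analytic2_at (\<lambda>w. f w * g w) z"
proof -
  obtain c d where
    c: "\<forall>\<^sub>F h in nhds 0. ((\<lambda>(i, j). c i j * fst h ^ i * snd h ^ j) has_sum f (z + h)) UNIV" and
    d: "\<forall>\<^sub>F h in nhds 0. ((\<lambda>(i, j). d i j * fst h ^ i * snd h ^ j) has_sum g (z + h)) UNIV"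
    using assms unfolding analytic2_at_def has_power_series2_def by blast
  define e where "e n m = (\<Sum>(i, j)\<in>{..n} \<times> {..m}. c i j * d (n - i) (m - j))" for n m
  from c d have "\<forall>\<^sub>F h in nhds 0. ((\<lambda>(n, m). e n m * fst h ^ n * snd h ^ m) has_sum
      (f (z + h) * g (z + h))) UNIV"
  proof eventually_elim
    case (elim h)
    define S where "S = (SIGMA p:(UNIV::(nat\<times>nat) set). {..fst p} \<times> {..snd p})"
    define G where "G = (\<lambda>((n, m), (i, j)). (c i j * d (n - i) (m - j)) * fst h ^ n * snd h ^ m)"
    have "((\<lambda>(x, y). (case x of (i, j) \<Rightarrow> c i j * fst h ^ i * snd h ^ j) *
                 (case y of (i, j) \<Rightarrow> d i j * fst h ^ i * snd h ^ j)) has_sum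
              (f (z + h) * g (z + h))) (UNIV \<times> UNIV)"
      by (rule has_sum_product[OF elim])
    also have "?this \<longleftrightarrow> (G has_sum (f (z + h) * g (z + h))) S"
      by (rule has_sum_reindex_bij_witness[where
            j = "\<lambda>((i, j), (i', j')). ((i + i', j + j'), (i, j))" and
            i = "\<lambda>((n, m), (i, j)). ((i, j), (n - i, m - j))"])
         (auto simp: S_def G_def power_add algebra_simps)
    finally have *: "(G has_sum (f (z + h) * g (z + h))) S" .
    show ?case
    proof (rule has_sum_SigmaD[OF *[unfolded S_def]])
      fix p :: "nat \<times> nat"
      have "((\<lambda>y. G (p, y)) has_sum (sum (\<lambda>y. G (p, y)) ({..fst p} \<times> {..snd p}))) ({..fst p} \<times> {..snd p})"
        by (rule has_sum_finite) auto
      also have "sum (\<lambda>y. G (p, y)) ({..fst p} \<times> {..snd p}) = (case p of (n, m) \<Rightarrow> e n m * fst h ^ n * snd h ^ m)"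
        by (cases p) (simp add: e_def G_def sum_distrib_right case_prod_unfold)
      finally show "((\<lambda>y. G (p, y)) has_sum (case p of (n, m) \<Rightarrow> e n m * fst h ^ n * snd h ^ m))
           ({..fst p} \<times> {..snd p})" .
    qed
  qed
  then show ?thesis unfolding analytic2_at_def has_power_series2_def by (intro exI[of _ e])
qed

section \<open>Germs of holomorphic functions and local multiplicity\<close>

definition germ :: "complex \<times> complex \<Rightarrow> (complex \<times> complex \<Rightarrow> complex) \<Rightarrow>
    (complex \<times> complex \<Rightarrow> complex) set" where
  "germ z f = {g. analytic2_at g z \<and> (\<forall>\<^sub>F w in nhds z. g w = f w)}"

definition O2 :: "complex \<times> complex \<Rightarrow> (complex \<times> complex \<Rightarrow> complex) set ring" where
  "O2 z = \<lparr> carrier = germ z ` {f. analytic2_at f z},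
            mult = (\<lambda>A B. \<Union>f\<in>A. \<Union>g\<in>B. germ z (\<lambda>w. f w * g w)),
            one = germ z (\<lambda>_. 1),
            zero = germ z (\<lambda>_. 0),
            add = (\<lambda>A B. \<Union>f\<in>A. \<Union>g\<in>B. germ z (\<lambda>w. f w + g w)) \<rparr>"

lemma germ_self: "analytic2_at f z \<Longrightarrow> f \<in> germ z f"
  by (simp add: germ_def)

lemma germ_cong:
  assumes "\<forall>\<^sub>F w in nhds z. f w = g w"
  shows "germ z f = germ z g"
proof -
  have "(\<forall>\<^sub>F w in nhds z. h w = f w) \<longleftrightarrow> (\<forall>\<^sub>F w in nhds z. h w = g w)" for h
    by (rule eventually_cong[OF assms]) simp
  then show ?thesis by (simp add: germ_def)
qed

lemma O2_mult:
  assumes "analytic2_at f z" "analytic2_at g z"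
  shows "germ z f \<otimes>\<^bsub>O2 z\<^esub> germ z g = germ z (\<lambda>w. f w * g w)"
proof -
  have "germ z (\<lambda>w. f' w * g' w) = germ z (\<lambda>w. f w * g w)" if "f' \<in> germ z f" "g' \<in> germ z g" for f' g'
  proof (rule germ_cong)
    have "\<forall>\<^sub>F w in nhds z. f' w = f w" "\<forall>\<^sub>F w in nhds z. g' w = g w"
      using that by (simp_all add: germ_def)
    then show "\<forall>\<^sub>F w in nhds z. f' w * g' w = f w * g w"
      by eventually_elim simp
  qed
  then have "(\<Union>f'\<in>germ z f. \<Union>g'\<in>germ z g. germ z (\<lambda>w. f' w * g' w)) = germ z (\<lambda>w. f w * g w)"
    using germ_self[OF assms(1)] germ_self[OF assms(2)] by blast
  then show ?thesis by (simp add: O2_def)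
qed

lemma O2_add:
  assumes "analytic2_at f z" "analytic2_at g z"
  shows "germ z f \<oplus>\<^bsub>O2 z\<^esub> germ z g = germ z (\<lambda>w. f w + g w)"
proof -
  have "germ z (\<lambda>w. f' w + g' w) = germ z (\<lambda>w. f w + g w)" if "f' \<in> germ z f" "g' \<in> germ z g" for f' g'
  proof (rule germ_cong)
    have "\<forall>\<^sub>F w in nhds z. f' w = f w" "\<forall>\<^sub>F w in nhds z. g' w = g w"
      using that by (simp_all add: germ_def)
    then show "\<forall>\<^sub>F w in nhds z. f' w + g' w = f w + g w"
      by eventually_elim simp
  qed
  then have "(\<Union>f'\<in>germ z f. \<Union>g'\<in>germ z g. germ z (\<lambda>w. f' w + g' w)) = germ z (\<lambda>w. f w + g w)"
    using germ_self[OF assms(1)] germ_self[OF assms(2)] by blast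
  then show ?thesis by (simp add: O2_def)
qed

lemma O2_carrier: "carrier (O2 z) = germ z ` {f. analytic2_at f z}" 
  and O2_one: "\<one>\<^bsub>O2 z\<^esub> = germ z (\<lambda>_. 1)" and O2_zero: "\<zero>\<^bsub>O2 z\<^esub> = germ z (\<lambda>_. 0)"
  by (simp_all add: O2_def)

lemma cring_O2: "cring (O2 z)"
proof -
  have cl: "germ z f \<in> carrier (O2 z)" if "analytic2_at f z" for f
    using that by (simp add: O2_carrier)
  have ex: "\<exists>f. analytic2_at f z \<and> x = germ z f" if "x \<in> carrier (O2 z)" for x
    using that by (auto simp: O2_carrier)
  note [simp] = analytic2_at_const analytic2_at_add analytic2_at_mult O2_add O2_mult O2_zero O2_one
  show ?thesis
  proof (rule cringI)
    show "abelian_group (O2 z)"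
    proof (rule abelian_groupI)
      fix x y w assume x: "x \<in> carrier (O2 z)" and y: "y \<in> carrier (O2 z)" and w: "w \<in> carrier (O2 z)"
      from x y w ex obtain f g h where
        "analytic2_at f z" "x = germ z f" "analytic2_at g z" "y = germ z g" "analytic2_at h z" "w = germ z h"
        by metis
      then show "x \<oplus>\<^bsub>O2 z\<^esub> y \<oplus>\<^bsub>O2 z\<^esub> w = x \<oplus>\<^bsub>O2 z\<^esub> (y \<oplus>\<^bsub>O2 z\<^esub> w)"
        by (simp add: add.assoc)
    next
      fix x y assume x: "x \<in> carrier (O2 z)" and y: "y \<in> carrier (O2 z)"
      from x y ex obtain f g where f: "analytic2_at f z" "x = germ z f" "analytic2_at g z" "y = germ z g"
        by metis
      then show "x \<oplus>\<^bsub>O2 z\<^esub> y \<in> carrier (O2 z)" by (simp add: cl)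
      from f show "x \<oplus>\<^bsub>O2 z\<^esub> y = y \<oplus>\<^bsub>O2 z\<^esub> x" by (simp add: add.commute)
    next
      show "\<zero>\<^bsub>O2 z\<^esub> \<in> carrier (O2 z)" by (simp add: cl)
    next
      fix x assume x: "x \<in> carrier (O2 z)"
      from x ex obtain f where f: "analytic2_at f z" "x = germ z f" by metis
      then show "\<zero>\<^bsub>O2 z\<^esub> \<oplus>\<^bsub>O2 z\<^esub> x = x" by simp
      have "analytic2_at (\<lambda>w. (-1) * f w) z" by (intro analytic2_at_mult analytic2_at_const f)
      with f have "germ z (\<lambda>w. (-1) * f w) \<oplus>\<^bsub>O2 z\<^esub> x = germ z (\<lambda>w. (-1) * f w + f w)"
        by (simp only: O2_add)
      then show "\<exists>y\<in>carrier (O2 z). y \<oplus>\<^bsub>O2 z\<^esub> x = \<zero>\<^bsub>O2 z\<^esub>"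
        using cl[OF \<open>analytic2_at (\<lambda>w. (-1) * f w) z\<close>] by (intro bexI) auto
    qed
    show "Group.comm_monoid (O2 z)"
    proof (rule comm_monoidI)
      fix x y w assume x: "x \<in> carrier (O2 z)" and y: "y \<in> carrier (O2 z)" and w: "w \<in> carrier (O2 z)"
      from x y w ex obtain f g h where
        "analytic2_at f z" "x = germ z f" "analytic2_at g z" "y = germ z g" "analytic2_at h z" "w = germ z h"
        by metis
      then show "x \<otimes>\<^bsub>O2 z\<^esub> y \<otimes>\<^bsub>O2 z\<^esub> w = x \<otimes>\<^bsub>O2 z\<^esub> (y \<otimes>\<^bsub>O2 z\<^esub> w)"
        by (simp add: mult.assoc)
    next
      fix x y assume x: "x \<in> carrier (O2 z)" and y: "y \<in> carrier (O2 z)"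
      from x y ex obtain f g where f: "analytic2_at f z" "x = germ z f" "analytic2_at g z" "y = germ z g"
        by metis
      then show "x \<otimes>\<^bsub>O2 z\<^esub> y \<in> carrier (O2 z)" by (simp add: cl)
      from f show "x \<otimes>\<^bsub>O2 z\<^esub> y = y \<otimes>\<^bsub>O2 z\<^esub> x" by (simp add: mult.commute)
    next
      show "\<one>\<^bsub>O2 z\<^esub> \<in> carrier (O2 z)" by (simp add: cl)
    next
      fix x assume x: "x \<in> carrier (O2 z)"
      from x ex obtain f where f: "analytic2_at f z" "x = germ z f" by metis
      then show "\<one>\<^bsub>O2 z\<^esub> \<otimes>\<^bsub>O2 z\<^esub> x = x" by simp
    qed
    fix x y w assume x: "x \<in> carrier (O2 z)" and y: "y \<in> carrier (O2 z)" and w: "w \<in> carrier (O2 z)"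
    from x y w ex obtain f g h where
      "analytic2_at f z" "x = germ z f" "analytic2_at g z" "y = germ z g" "analytic2_at h z" "w = germ z h"
      by metis
    then show "(x \<oplus>\<^bsub>O2 z\<^esub> y) \<otimes>\<^bsub>O2 z\<^esub> w = x \<otimes>\<^bsub>O2 z\<^esub> w \<oplus>\<^bsub>O2 z\<^esub> y \<otimes>\<^bsub>O2 z\<^esub> w"
      by (simp add: distrib_right)
  qed
qed

text \<open>\<open>has_mult h k q n\<close>: the quotient of the ring of germs by the ideal generated by the
  complexifications of \<open>h\<close> and \<open>k\<close> has dimension \<open>n\<close> over the field of (classes of) constants.\<close>

definition germ_ideal :: "(real \<times> real \<Rightarrow> real) \<Rightarrow> (real \<times> real \<Rightarrow> real) \<Rightarrow> real \<times> real \<Rightarrow>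
    (complex \<times> complex \<Rightarrow> complex) set set" where
  "germ_ideal h k q =
     genideal (O2 (cpoint q))
       {germ (cpoint q) (complexify h q), germ (cpoint q) (complexify k q)}"

definition has_mult :: "(real \<times> real \<Rightarrow> real) \<Rightarrow> (real \<times> real \<Rightarrow> real) \<Rightarrow> real \<times> real \<Rightarrow> nat \<Rightarrow> bool" where
  "has_mult h k q n =
     (let R = O2 (cpoint q); I = germ_ideal h k q; Q = R Quot I;
          C = range (\<lambda>c. I +>\<^bsub>R\<^esub> germ (cpoint q) (\<lambda>_. c))
      in ring.dimension Q n C (carrier Q))"

section \<open>Regular analytic surfaces\<close>

definition local_parametrisation ::
    "(real^3) set \<Rightarrow> (real \<times> real) set \<Rightarrow> (real \<times> real \<Rightarrow> real^3) \<Rightarrow> bool" where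
  "local_parametrisation M U X \<longleftrightarrow>
     open U \<and>
     (\<forall>q\<in>U. \<forall>i. analytic2_at (\<lambda>w. X w $ i) q) \<and>
     (\<forall>q\<in>U. \<forall>s t. s *\<^sub>R pdu X q + t *\<^sub>R pdv X q = 0 \<longrightarrow> s = 0 \<and> t = 0) \<and>
     openin (top_of_set M) (X ` U) \<and>
     (\<exists>Y. homeomorphism U (X ` U) X Y)"

definition regular_analytic_surface :: "(real^3) set \<Rightarrow> bool" where
  "regular_analytic_surface M \<longleftrightarrow>
     (\<forall>p\<in>M. \<exists>U X. local_parametrisation M U X \<and> p \<in> X ` U)"

section \<open>Fundamental forms and lines of principal curvature\<close>

type_synonym param = "real \<times> real \<Rightarrow> real^3"

definition coeff_E :: "param \<Rightarrow> real \<times> real \<Rightarrow> real" where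
  "coeff_E X q = mink (pdu X q) (pdu X q)"
definition coeff_F :: "param \<Rightarrow> real \<times> real \<Rightarrow> real" where
  "coeff_F X q = mink (pdu X q) (pdv X q)"
definition coeff_G :: "param \<Rightarrow> real \<times> real \<Rightarrow> real" where
  "coeff_G X q = mink (pdv X q) (pdv X q)"

definition coeff_l :: "param \<Rightarrow> real \<times> real \<Rightarrow> real" where
  "coeff_l X q = mink (mink_cross (pdu X q) (pdv X q)) (pdu (pdu X) q)"
definition coeff_m :: "param \<Rightarrow> real \<times> real \<Rightarrow> real" where
  "coeff_m X q = mink (mink_cross (pdu X q) (pdv X q)) (pdv (pdu X) q)"
definition coeff_n :: "param \<Rightarrow> real \<times> real \<Rightarrow> real" where
  "coeff_n X q = mink (mink_cross (pdu X q) (pdv X q)) (pdv (pdv X) q)"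

definition lpc_a :: "param \<Rightarrow> real \<times> real \<Rightarrow> real" where
  "lpc_a X q = coeff_F X q * coeff_n X q - coeff_G X q * coeff_m X q"
definition lpc_b :: "param \<Rightarrow> real \<times> real \<Rightarrow> real" where
  "lpc_b X q = coeff_E X q * coeff_n X q - coeff_G X q * coeff_l X q"
definition lpc_c :: "param \<Rightarrow> real \<times> real \<Rightarrow> real" where
  "lpc_c X q = coeff_E X q * coeff_m X q - coeff_F X q * coeff_l X q"

definition lpc_delta :: "param \<Rightarrow> real \<times> real \<Rightarrow> real" where
  "lpc_delta X q = (lpc_b X q)\<^sup>2 - 4 * lpc_a X q * lpc_c X q"

definition umbilic :: "param \<Rightarrow> real \<times> real \<Rightarrow> bool" where
  "umbilic X q \<longleftrightarrow> lpc_a X q = 0 \<and> lpc_b X q = 0 \<and> lpc_c X q = 0"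

definition spacelike_at :: "param \<Rightarrow> real \<times> real \<Rightarrow> bool" where
  "spacelike_at X q \<longleftrightarrow> (coeff_F X q)\<^sup>2 - coeff_E X q * coeff_G X q < 0"

definition timelike_at :: "param \<Rightarrow> real \<times> real \<Rightarrow> bool" where
  "timelike_at X q \<longleftrightarrow> (coeff_F X q)\<^sup>2 - coeff_E X q * coeff_G X q > 0"

text \<open>The defining cases of the multiplicity of an umbilic point overlap; the predicate asks that
  every applicable case yields the value \<open>n\<close>, and that at least one case applies.\<close>

definition umbilic_mult :: "param \<Rightarrow> real \<times> real \<Rightarrow> nat \<Rightarrow> bool" where
  "umbilic_mult X q n \<longleftrightarrow>
     (coeff_E X q \<noteq> 0 \<or> coeff_F X q \<noteq> 0 \<or> coeff_G X q \<noteq> 0) \<and>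
     (coeff_E X q \<noteq> 0 \<longrightarrow> has_mult (lpc_b X) (lpc_c X) q n) \<and>
     (coeff_F X q \<noteq> 0 \<longrightarrow> has_mult (lpc_a X) (lpc_c X) q n) \<and>
     (coeff_G X q \<noteq> 0 \<longrightarrow> has_mult (lpc_a X) (lpc_b X) q n)"

section \<open>Simple singularities up to smooth right-equivalence\<close>

text \<open>\<open>f\<close> at \<open>q\<close> and \<open>g\<close> at the origin.\<close>

definition R_equiv :: "(real \<times> real \<Rightarrow> real) \<Rightarrow> real \<times> real \<Rightarrow> (real \<times> real \<Rightarrow> real) \<Rightarrow> bool" where
  "R_equiv f q g \<longleftrightarrow>
     (\<exists>V W \<phi> \<psi>. open V \<and> 0 \<in> V \<and> open W \<and> \<phi> 0 = q \<and>
        homeomorphism V W \<phi> \<psi> \<and> smooth2_on V \<phi> \<and> smooth2_on W \<psi> \<and>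
        (\<forall>\<^sub>F w in nhds 0. f (\<phi> w) = g w))"

definition has_singularity :: "(real \<times> real \<Rightarrow> real) \<Rightarrow> real \<times> real \<Rightarrow> (real \<times> real \<Rightarrow> real) \<Rightarrow> bool" where
  "has_singularity f q g \<longleftrightarrow> R_equiv f q g \<or> R_equiv (\<lambda>w. - f w) q g"

text \<open>The sign \<open>s\<close> is \<open>1\<close> or \<open>-1\<close>. For \<open>A\<^sub>k\<close> with even \<open>k\<close> and \<open>D\<^sub>k\<close> with odd \<open>k\<close> the two signs
  give the same singularity up to the sign of the germ.\<close>

definition sing_A :: "real \<Rightarrow> nat \<Rightarrow> real \<times> real \<Rightarrow> real" where
  "sing_A s k = (\<lambda>(x, y). x\<^sup>2 + s * y ^ (k + 1))"
definition sing_D :: "real \<Rightarrow> nat \<Rightarrow> real \<times> real \<Rightarrow> real" where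
  "sing_D s k = (\<lambda>(x, y). x\<^sup>2 * y + s * y ^ (k - 1))"
definition sing_E6 :: "real \<times> real \<Rightarrow> real" where
  "sing_E6 = (\<lambda>(x, y). x ^ 3 + y ^ 4)"
definition sing_E7 :: "real \<times> real \<Rightarrow> real" where
  "sing_E7 = (\<lambda>(x, y). x ^ 3 + x * y ^ 3)"
definition sing_E8 :: "real \<times> real \<Rightarrow> real" where
  "sing_E8 = (\<lambda>(x, y). x ^ 3 + y ^ 5)"

definition simple_singularity :: "(real \<times> real \<Rightarrow> real) \<Rightarrow> real \<times> real \<Rightarrow> bool" where
  "simple_singularity f q \<longleftrightarrow>
     (\<exists>s\<in>{1, -1}. (\<exists>k\<ge>1. has_singularity f q (sing_A s k)) \<or>
                  (\<exists>k\<ge>4. has_singularity f q (sing_D s k))) \<or>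
     has_singularity f q sing_E6 \<or> has_singularity f q sing_E7 \<or> has_singularity f q sing_E8"

end

theory Submission
  imports Defs
begin

text \<open>
  The three coefficients satisfy \<open>E a - F b + G c = 0\<close>. As one of \<open>E\<close>, \<open>F\<close>, \<open>G\<close> is a unit at the umbilic
  point, two of \<open>a\<close>, \<open>b\<close>, \<open>c\<close> already generate the ideal \<open>(a, b, c)\<close>, so all the pairs used in the
  definition of \<open>m\<^sub>u\<close> generate the same ideal, and \<open>\<delta> = b\<^sup>2 - 4 a c\<close> becomes a binary quadratic form in two of
  the three. Its discriminant is \<open>F\<^sup>2 - E G\<close> times the square of a unit, hence itself the square of a unit over the
  complex numbers, and the form splits: \<open>\<delta> = f g\<close> with \<open>(f, g) = (a, b, c)\<close>
  (\<open>principal_discriminant_factors\<close>). Therefore \<open>m\<^sub>u\<close> is the intersection multiplicity of the two curves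
  \<open>f = 0\<close> and \<open>g = 0\<close>. At a timelike point \<open>F\<^sup>2 - E G\<close> has a real square root and \<open>f\<close>, \<open>g\<close> have real
  coefficients.

  The singularity type of \<open>\<delta>\<close> controls this number because the normal forms have few factorisations in
  \<open>\<complex>[[x, y]]\<close>. In each of them at least one factor has a non-zero linear part, so it is a graph up to a unit, and
  the multiplicity is the order of contact of the other factor with this graph:
  \<^item> \<open>x\<^sup>2 \<plusminus> y\<^bsup>2k\<^esup>\<close> is a product of two graphs \<open>x = \<plusminus> p(y)\<close> with \<open>p\<close> of order \<open>k\<close>, giving \<open>k\<close> (\<open>isect_num_A\<close>);
  \<^item> in \<open>y (x\<^sup>2 \<plusminus> y\<^sup>m)\<close> one factor contains \<open>y\<close>; either the other one is \<open>x\<^sup>2 \<plusminus> y\<^sup>m\<close>, giving 2, or the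
    bracket splits as well, giving \<open>m/2 + 1\<close>. The latter is impossible for odd \<open>m\<close>, and for the plus sign it is
    impossible with real factors (\<open>isect_num_D\<close>);
  \<^item> in \<open>x (x\<^sup>2 + y\<^sup>3)\<close> the bracket is irreducible, giving 3 (\<open>isect_num_E7\<close>).

  The equivalence of \<open>\<delta>\<close> with a normal form is only smooth, so it transforms Taylor series and not convergent
  series. This is harmless since the order of contact, the largest \<open>n\<close> with \<open>g \<in> (f) + \<mm>\<^sup>n\<close>, can be read off from
  error estimates \<open>O(|h|\<^sup>n)\<close>, which any smooth change of coordinates respects (\<open>isect_num_transport\<close>). Weierstrass
  division in the ring of convergent series then converts contact of order \<open>n\<close> back into the dimension \<open>n\<close> of
  \<open>\<O>\<^sub>2 / (f, g)\<close> (\<open>isect_num_quotient_basis\<close>, \<open>has_mult_from_basis\<close>).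
\<close>

section \<open>Double power series\<close>

text \<open>The ring \<open>\<complex>[[x, y]]\<close> is represented as \<open>\<complex>[[y]][[x]]\<close>, which makes it an integral domain by type class
  instances; the outer index of a coefficient is the exponent of \<open>x\<close>.\<close>

type_synonym ps2 = "complex fps fps"

abbreviation cf :: "'a fps fps \<Rightarrow> nat \<Rightarrow> nat \<Rightarrow> 'a" where
  "cf P i j \<equiv> fps_nth (fps_nth P i) j"

definition mk2 :: "(nat \<Rightarrow> nat \<Rightarrow> complex) \<Rightarrow> ps2" where
  "mk2 c = Abs_fps (\<lambda>i. Abs_fps (c i))"

definition cst :: "complex \<Rightarrow> ps2" where "cst c = fps_const (fps_const c)"
definition yser :: "complex fps \<Rightarrow> ps2" where "yser r = fps_const r"
abbreviation X2 :: ps2 where "X2 \<equiv> fps_X"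
definition Y2 :: ps2 where "Y2 = yser fps_X"

lemma cf_mk2 [simp]: "cf (mk2 c) i j = c i j"
  by (simp add: mk2_def)

lemma ps2_eqI: "(\<And>i j. cf P i j = cf Q i j) \<Longrightarrow> P = Q"
  by (intro fps_ext) auto

lemma cf_cst: "cf (cst c) i j = (if i = 0 \<and> j = 0 then c else 0)"
  by (simp add: cst_def)

lemma cf_yser: "cf (yser r) i j = (if i = 0 then fps_nth r j else 0)"
  by (simp add: yser_def)

lemma cf_X2: "cf X2 i j = (if i = 1 \<and> j = 0 then 1 else 0)"
  by (simp add: fps_X_def fps_one_def)

lemma cf_Y2: "cf Y2 i j = (if i = 0 \<and> j = 1 then 1 else 0)"
  by (simp add: Y2_def cf_yser fps_X_def)

lemma cf_X2_mult: "cf (X2 * P) i j = (if i = 0 then 0 else cf P (i - 1) j)"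
  by simp

lemma cf_Y2_mult: "cf (Y2 * P) i j = (if j = 0 then 0 else cf P i (j - 1))"
  by (simp add: Y2_def yser_def)

lemma cf_cst_mult: "cf (cst c * P) i j = c * cf P i j"
  by (simp add: cst_def)

lemma cf_mult: "cf (P * Q) i j = (\<Sum>k\<le>i. \<Sum>l\<le>j. cf P k l * cf Q (i - k) (j - l))"
  for P Q :: ps2
  by (simp add: fps_mult_nth fps_sum_nth atMost_atLeast0)

lemma cf_mult_00: "cf (P * Q) 0 0 = cf P 0 0 * cf Q 0 0" for P Q :: ps2
  by simp

lemma yser_simps: "yser (r + s) = yser r + yser s" "yser (r - s) = yser r - yser s"
  "yser (r * s) = yser r * yser s" "yser (r ^ n) = yser r ^ n" "yser 0 = 0" "yser (fps_const c) = cst c"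
  "yser 1 = 1" "yser (- r) = - yser r"
  by (simp_all add: yser_def cst_def fps_const_power)

lemma cst_simps: "cst (a + b) = cst a + cst b" "cst (a - b) = cst a - cst b" "cst (a * b) = cst a * cst b"
  "cst 0 = 0" "cst 1 = 1" "cst (- a) = - cst a"
  by (simp_all add: cst_def)

lemma numeral_cst: "numeral k = cst (numeral k)"
  by (simp add: cst_def numeral_fps_const)

section \<open>Convergent series\<close>

text \<open>The weight of \<open>x\<^sup>i y\<^sup>j\<close> is \<open>i + 2 j\<close>. It is chosen so that a series \<open>f\<close> without
  constant term and with non-zero \<open>x\<close>-coefficient has a multiple of \<open>x\<close> as its part of lowest
  weight, even if \<open>f\<close> also has a linear term in \<open>y\<close>.\<close>

definition wts :: "nat \<Rightarrow> (nat \<times> nat) set" where "wts m = {(i, j). i + 2 * j \<le> m}"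

lemma finite_wt [simp]: "finite (wts m)"
  by (rule finite_subset[of _ "{..m} \<times> {..m}"]) (auto simp: wts_def)

definition wnorm :: "real \<Rightarrow> nat \<Rightarrow> ps2 \<Rightarrow> real" where
  "wnorm r m P = (\<Sum>(i, j)\<in>wts m. norm (cf P i j) * r ^ (i + 2 * j))"

text \<open>Convergence is boundedness of the truncated weighted norms. Only finite sums occur, so that a
  recursively defined series is shown to converge by induction on the truncation.\<close>

definition conv :: "ps2 \<Rightarrow> bool" where
  "conv P \<longleftrightarrow> (\<exists>r>0. \<exists>C. \<forall>m. wnorm r m P \<le> C)"

lemma wnorm_nonneg: "r \<ge> 0 \<Longrightarrow> wnorm r m P \<ge> 0"
  by (auto simp: wnorm_def intro!: sum_nonneg)

text \<open>If \<open>P\<close> has no terms of weight below \<open>d\<close>, then the part of \<open>P Q\<close> of weight at most \<open>m + d\<close> sees only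
  the part of \<open>Q\<close> of weight at most \<open>m\<close>. This shift is what makes the recursions below contracting.\<close>

lemma wnorm_mult:
  assumes "r \<ge> 0" and d: "\<And>i j. i + 2 * j < d \<Longrightarrow> cf P i j = 0"
  shows "wnorm r (m + d) (P * Q) \<le> wnorm r (m + d) P * wnorm r m Q"
proof -
  define a where "a = (\<lambda>(i, j). norm (cf P i j) * r ^ (i + 2 * j))"
  define b where "b = (\<lambda>(i, j). norm (cf Q i j) * r ^ (i + 2 * j))"
  define S where "S = (SIGMA p:wts (m + d). {..fst p} \<times> {..snd p})"
  define S' where "S' = {x\<in>S. fst (snd x) + 2 * snd (snd x) \<ge> d}"
  define g where "g = (\<lambda>((i::nat, j::nat), (k, l)). (((k::nat), (l::nat)), (i - k, j - l)))"
  have ab: "a p \<ge> 0" "b p \<ge> 0" for p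
    using assms(1) by (auto simp: a_def b_def split: prod.splits)
  have finS: "finite S" by (simp add: S_def)
  have "wnorm r (m + d) (P * Q) \<le> (\<Sum>p\<in>wts (m + d). \<Sum>q\<in>{..fst p} \<times> {..snd p}. (\<lambda>(q, q'). a q * b q') (g (p, q)))"
    unfolding wnorm_def
  proof (rule sum_mono, clarsimp)
    fix i j
    have "norm (cf (P * Q) i j) * r ^ (i + 2 * j) \<le>
        (\<Sum>k\<le>i. \<Sum>l\<le>j. norm (cf P k l * cf Q (i - k) (j - l))) * r ^ (i + 2 * j)"
      unfolding cf_mult
      by (intro mult_right_mono order.trans[OF norm_sum] sum_mono norm_sum) (use assms(1) in auto)
    also have "\<dots> = (\<Sum>k\<le>i. \<Sum>l\<le>j. a (k, l) * b (i - k, j - l))"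
      unfolding sum_distrib_right
    proof (intro sum.cong refl)
      fix k l assume "k \<in> {..i}" "l \<in> {..j}"
      then have "i + 2 * j = (k + 2 * l) + ((i - k) + 2 * (j - l))" by auto
      then have "r ^ (i + 2 * j) = r ^ (k + 2 * l) * r ^ ((i - k) + 2 * (j - l))"
        by (simp only: power_add)
      then show "norm (cf P k l * cf Q (i - k) (j - l)) * r ^ (i + 2 * j) = a (k, l) * b (i - k, j - l)"
        by (simp add: a_def b_def norm_mult)
    qed
    also have "\<dots> = (\<Sum>q\<in>{..i} \<times> {..j}. (\<lambda>(q, q'). a q * b q') (g ((i, j), q)))"
      by (simp add: sum.cartesian_product g_def case_prod_unfold)
    finally show "norm (cf (P * Q) i j) * r ^ (i + 2 * j) \<le>
       (\<Sum>q\<in>{..i} \<times> {..j}. case g ((i, j), q) of (q, q') \<Rightarrow> a q * b q')" .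
  qed
  also have "\<dots> = (\<Sum>x\<in>S. (\<lambda>(q, q'). a q * b q') (g x))"
    unfolding S_def by (subst sum.Sigma) (auto simp: case_prod_unfold)
  also have "\<dots> = (\<Sum>x\<in>S'. (\<lambda>(q, q'). a q * b q') (g x))"
  proof (rule sum.mono_neutral_right, safe)
    fix i j k l assume "((i, j), (k, l)) \<in> S" "((i, j), (k, l)) \<notin> S'"
    then have "k + 2 * l < d" by (auto simp: S'_def)
    then show "(case g ((i, j), (k, l)) of (q, q') \<Rightarrow> a q * b q') = 0"
      using d by (simp add: g_def a_def)
  qed (auto simp: S'_def finS)
  also have "\<dots> = (\<Sum>(q, q')\<in>g ` S'. a q * b q')"
    by (rule sum.reindex_cong[symmetric, where l = g])
       (auto simp: inj_on_def g_def S'_def S_def case_prod_unfold)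
  also have "\<dots> \<le> (\<Sum>(q, q')\<in>wts (m + d) \<times> wts m. a q * b q')"
  proof (rule sum_mono2)
    show "g ` S' \<subseteq> wts (m + d) \<times> wts m"
      by (auto simp: S'_def S_def g_def wts_def)
  qed (use ab in \<open>auto split: prod.splits\<close>)
  also have "\<dots> = wnorm r (m + d) P * wnorm r m Q"
    by (simp add: wnorm_def a_def b_def sum_product sum.cartesian_product case_prod_unfold)
  finally show ?thesis .
qed

lemma wnorm_add: "r \<ge> 0 \<Longrightarrow> wnorm r m (P + Q) \<le> wnorm r m P + wnorm r m Q"
  unfolding wnorm_def sum.distrib[symmetric]
  by (rule sum_mono) (auto simp: distrib_right[symmetric] norm_triangle_ineq intro!: mult_right_mono)

lemma wnorm_diff: "r \<ge> 0 \<Longrightarrow> wnorm r m (P - Q) \<le> wnorm r m P + wnorm r m Q"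
  unfolding wnorm_def sum.distrib[symmetric]
  by (rule sum_mono) (auto simp: distrib_right[symmetric] norm_triangle_ineq4 intro!: mult_right_mono)

lemma wnorm_scale:
  assumes "0 \<le> t" "t \<le> 1" "r \<ge> 0" and d: "\<And>i j. i + 2 * j < d \<Longrightarrow> cf P i j = 0"
  shows "wnorm (t * r) m P \<le> t ^ d * wnorm r m P"
  unfolding wnorm_def sum_distrib_left
proof (rule sum_mono, clarify)
  fix i j
  show "norm (cf P i j) * (t * r) ^ (i + 2 * j) \<le> t ^ d * (norm (cf P i j) * r ^ (i + 2 * j))"
  proof (cases "i + 2 * j < d")
    case False
    then have "t ^ (i + 2 * j) \<le> t ^ d" using assms by (intro power_decreasing) auto
    then have "t ^ (i + 2 * j) * (norm (cf P i j) * r ^ (i + 2 * j)) \<le> t ^ d * (norm (cf P i j) * r ^ (i + 2 * j))"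
      by (intro mult_right_mono) (use assms in auto)
    then show ?thesis by (simp add: power_mult_distrib mult_ac)
  qed (simp add: d)
qed

lemma wnorm_mono_radius: "0 \<le> r \<Longrightarrow> r \<le> s \<Longrightarrow> wnorm r m P \<le> wnorm s m P"
  unfolding wnorm_def by (intro sum_mono) (auto intro!: mult_left_mono power_mono)

lemma convE:
  assumes "conv P"
  obtains r C where "r > 0" "C > 0" "\<And>s m. 0 < s \<Longrightarrow> s \<le> r \<Longrightarrow> wnorm s m P \<le> C"
proof -
  obtain r C where rC: "r > 0" "\<forall>m. wnorm r m P \<le> C" using assms by (auto simp: conv_def)
  have "wnorm s m P \<le> max C 1" if "0 < s" "s \<le> r" for s m
    using wnorm_mono_radius[of s r m P] rC(2)[rule_format, of m] that by auto
  then show ?thesis using rC(1) by (intro that[of r "max C 1"]) auto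
qed

text \<open>Geometric bounds on the coefficients are an equivalent description of convergence that treats both
  variables alike; swapping, shifting and differentiating are immediate in it.\<close>

lemma conv_coeffE:
  assumes "conv P"
  obtains \<rho> C where "\<rho> > 0" "\<rho> \<le> 1" "C > 0" "\<And>i j. norm (cf P i j) * \<rho> ^ (i + j) \<le> C"
proof -
  obtain r C where rC: "r > 0" "C > 0" "\<And>s m. 0 < s \<Longrightarrow> s \<le> r \<Longrightarrow> wnorm s m P \<le> C"
    using convE[OF assms] by blast
  define s where "s = min r 1"
  have s: "0 < s" "s \<le> r" "s \<le> 1" using rC(1) by (auto simp: s_def)
  have "norm (cf P i j) * (s\<^sup>2) ^ (i + j) \<le> C" for i j
  proof -
    have "(s\<^sup>2) ^ (i + j) = s ^ (2 * i + 2 * j)" by (simp add: power_mult[symmetric] distrib_left)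
    also have "\<dots> \<le> s ^ (i + 2 * j)" by (rule power_decreasing) (use s in auto)
    finally have "norm (cf P i j) * (s\<^sup>2) ^ (i + j) \<le> norm (cf P i j) * s ^ (i + 2 * j)"
      by (rule mult_left_mono) auto
    also have "\<dots> \<le> wnorm s (i + 2 * j) P"
    proof -
      have "(\<Sum>p\<in>{(i, j)}. case p of (i, j) \<Rightarrow> norm (cf P i j) * s ^ (i + 2 * j)) \<le> wnorm s (i + 2 * j) P"
        unfolding wnorm_def by (rule sum_mono2[OF finite_wt]) (use s in \<open>auto simp: wts_def\<close>)
      then show ?thesis by simp
    qed
    also have "\<dots> \<le> C" using rC(3) s by blast
    finally show ?thesis .
  qed
  then show ?thesis using s rC(2) that[of "s\<^sup>2" C] by (simp add: power_le_one)
qed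

lemma conv_coeffI:
  assumes "\<rho> > 0" "\<And>i j. norm (cf P i j) * \<rho> ^ (i + j) \<le> C"
  shows "conv P"
proof -
  define r where "r = min \<rho> 1 / 2"
  have r: "0 < r" "2 * r \<le> \<rho>" "2 * r \<le> 1" using assms(1) by (auto simp: r_def)
  have C: "C \<ge> 0" using assms(2)[of 0 0] norm_ge_zero[of "cf P 0 0"] by (simp del: norm_ge_zero)
  have geo: "(\<Sum>i\<le>m. (1/2 :: real) ^ i) \<le> 2" for m
    by (simp add: sum_gp atMost_atLeast0)
  have "wnorm r m P \<le> 4 * C" for m
  proof -
    have term_le: "norm (cf P i j) * r ^ (i + 2 * j) \<le> C * ((1/2) ^ i * (1/2) ^ j)" for i j
    proof -
      have "r ^ (i + 2 * j) \<le> r ^ (i + j)" by (rule power_decreasing) (use r in auto)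
      also have "\<dots> = (2 * r) ^ (i + j) * (1/2) ^ (i + j)"
        unfolding power_mult_distrib[symmetric] by simp
      also have "\<dots> \<le> \<rho> ^ (i + j) * (1/2) ^ (i + j)"
        using r by (intro mult_right_mono power_mono) auto
      finally have "norm (cf P i j) * r ^ (i + 2 * j) \<le> norm (cf P i j) * (\<rho> ^ (i + j) * (1/2) ^ (i + j))"
        by (rule mult_left_mono) auto
      also have "\<dots> = (norm (cf P i j) * \<rho> ^ (i + j)) * ((1/2) ^ i * (1/2) ^ j)" by (simp add: power_add)
      also have "\<dots> \<le> C * ((1/2) ^ i * (1/2) ^ j)" by (intro mult_right_mono assms) auto
      finally show ?thesis .
    qed
    have "wnorm r m P \<le> (\<Sum>(i, j)\<in>wts m. C * ((1/2) ^ i * (1/2) ^ j))"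
      unfolding wnorm_def by (rule sum_mono) (use term_le in auto)
    also have "\<dots> \<le> (\<Sum>(i, j)\<in>{..m} \<times> {..m}. C * ((1/2) ^ i * (1/2) ^ j))"
      by (rule sum_mono2) (auto simp: wts_def C)
    also have "\<dots> = C * ((\<Sum>i\<le>m. (1/2) ^ i) * (\<Sum>j\<le>m. (1/2) ^ j))"
      by (simp add: sum_product sum.cartesian_product sum_distrib_left[of C] case_prod_unfold)
    also have "\<dots> \<le> C * (2 * 2)"
      by (intro mult_left_mono mult_mono geo) (auto simp: C intro!: sum_nonneg)
    finally show ?thesis by simp
  qed
  then show ?thesis using r(1) by (auto simp: conv_def)
qed

lemma conv_bounded: "(\<And>i j. norm (cf P i j) \<le> C) \<Longrightarrow> conv P"
  by (rule conv_coeffI[of 1 _ C]) auto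

lemma conv_cst [simp, intro]: "conv (cst c)"
  by (rule conv_bounded[of _ "norm c"]) (auto simp: cf_cst)
lemma conv_X2 [simp, intro]: "conv X2"
  by (rule conv_bounded[of _ 1]) (auto simp: cf_X2)
lemma conv_Y2 [simp, intro]: "conv Y2"
  by (rule conv_bounded[of _ 1]) (auto simp: cf_Y2)
lemma conv_0 [simp, intro]: "conv 0" using conv_cst[of 0] by (simp add: cst_simps)
lemma conv_1 [simp, intro]: "conv 1" using conv_cst[of 1] by (simp add: cst_simps)

lemma conv_combine:
  assumes "conv P" "conv Q"
    and le: "\<And>r A B m. r > 0 \<Longrightarrow> A > 0 \<Longrightarrow> B > 0 \<Longrightarrow> (\<And>m. wnorm r m P \<le> A) \<Longrightarrow> (\<And>m. wnorm r m Q \<le> B) \<Longrightarrow>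
      wnorm r m S \<le> C A B"
  shows "conv S"
proof -
  obtain r A where 1: "r > 0" "A > 0" "\<And>s m. 0 < s \<Longrightarrow> s \<le> r \<Longrightarrow> wnorm s m P \<le> A"
    using convE[OF assms(1)] by blast
  obtain r' B where 2: "r' > 0" "B > 0" "\<And>s m. 0 < s \<Longrightarrow> s \<le> r' \<Longrightarrow> wnorm s m Q \<le> B"
    using convE[OF assms(2)] by blast
  have "min r r' > 0" "\<forall>m. wnorm (min r r') m S \<le> C A B"
    using 1 2 by (auto intro!: le)
  then show ?thesis unfolding conv_def by blast
qed

lemma conv_add [simp, intro]:
  assumes "conv P" "conv Q" shows "conv (P + Q)"
proof (rule conv_combine[OF assms, of _ "(+)"])
  fix r A B :: real and m
  assume "r > 0" "\<And>m. wnorm r m P \<le> A" "\<And>m. wnorm r m Q \<le> B"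
  then show "wnorm r m (P + Q) \<le> A + B"
    using wnorm_add[of r m P Q] by (smt (verit, best))
qed

lemma conv_mult [simp, intro]:
  assumes "conv P" "conv Q" shows "conv (P * Q)"
proof (rule conv_combine[OF assms, of _ "(*)"])
  fix r A B :: real and m
  assume *: "r > 0" "A > 0" "B > 0" "\<And>m. wnorm r m P \<le> A" "\<And>m. wnorm r m Q \<le> B"
  have "wnorm r m (P * Q) \<le> wnorm r m P * wnorm r m Q"
    using wnorm_mult[of r 0 P m Q] * by simp
  also have "\<dots> \<le> A * B" using * by (intro mult_mono wnorm_nonneg) auto
  finally show "wnorm r m (P * Q) \<le> A * B" .
qed

lemma conv_uminus [simp, intro]: "conv P \<Longrightarrow> conv (- P)"
  using conv_mult[OF conv_cst[of "-1"], of P] by (simp add: cst_simps)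
lemma conv_diff [simp, intro]: "conv P \<Longrightarrow> conv Q \<Longrightarrow> conv (P - Q)"
  using conv_add[of P "- Q"] by simp
lemma conv_power [simp, intro]: "conv P \<Longrightarrow> conv (P ^ n)"
  by (induction n) auto
lemma conv_numeral [simp, intro]: "conv (numeral k)"
  by (simp add: numeral_cst)

lemma conv_sum [simp, intro]: "(\<And>x. x \<in> S \<Longrightarrow> conv (f x)) \<Longrightarrow> conv (sum f S)"
  by (induction S rule: infinite_finite_induct) auto

section \<open>Weierstrass division\<close>

text \<open>The quotient of \<open>h\<close> by \<open>f\<close>: comparing the coefficients of \<open>x\<^bsup>i+1\<^esup> y\<^sup>j\<close> in \<open>h = Q f + r(y)\<close> determines the
  coefficient \<open>(i, j)\<close> of \<open>Q\<close> from those of smaller weight.\<close>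

function wquot :: "ps2 \<Rightarrow> ps2 \<Rightarrow> nat \<Rightarrow> nat \<Rightarrow> complex" where
  "wquot f h i j = (cf h (i + 1) j -
     (\<Sum>k\<le>i + 1. \<Sum>l\<le>j. if k + 2 * l \<ge> 2 then cf f k l * wquot f h (i + 1 - k) (j - l) else 0)) / cf f 1 0"
  by pat_completeness auto
termination
  by (relation "Wellfounded.measure (\<lambda>(f, h, i, j). i + 2 * j)") auto

declare wquot.simps [simp del]

text \<open>Division by a series of order one in \<open>x\<close>, formal and convergent at once. Writing \<open>f = \<alpha> x + f'\<close>
  with \<open>f'\<close> of weight at least 2, the quotient solves \<open>\<alpha> x Q = h - f' Q - r\<close>; on a small polydisc of radius \<open>s\<close> the norm
  of \<open>f'\<close> is \<open>O(s\<^sup>2)\<close> whereas dividing by \<open>\<alpha> x\<close> costs only a factor \<open>1/s\<close>.\<close>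

lemma weierstrass_division:
  assumes f0: "cf f 0 0 = 0" and f1: "cf f 1 0 \<noteq> 0"
  obtains Q r where "h = Q * f + yser r" "conv f \<Longrightarrow> conv h \<Longrightarrow> conv Q"
proof -
  define Q where "Q = mk2 (wquot f h)"
  define \<alpha> where "\<alpha> = cf f 1 0"
  define f' where "f' = f - cst \<alpha> * X2"
  have f': "cf f' i j = 0" if "i + 2 * j < 2" for i j
  proof -
    have "j = 0" "i = 0 \<or> i = 1" using that by auto
    then show ?thesis using f0 by (auto simp: f'_def \<alpha>_def cst_def fps_X_def)
  qed
  have f'_eq: "cf f' i j = cf f i j" if "i + 2 * j \<ge> 2" for i j
    using that by (auto simp: f'_def cst_def fps_X_def fps_one_def)
  have rec: "\<alpha> * cf Q i j = cf h (i + 1) j - cf (f' * Q) (i + 1) j" for i j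
  proof -
    have "(\<Sum>k\<le>i + 1. \<Sum>l\<le>j. if k + 2 * l \<ge> 2 then cf f k l * wquot f h (i + 1 - k) (j - l) else 0)
      = cf (f' * Q) (i + 1) j"
      unfolding cf_mult by (intro sum.cong refl) (auto simp: f' f'_eq Q_def)
    then show ?thesis using f1 by (simp add: Q_def wquot.simps[of f h i j] \<alpha>_def)
  qed
  define R where "R = h - Q * f"
  have fdec: "f = f' + cst \<alpha> * X2" by (simp add: f'_def)
  have "cf R (Suc i) j = 0" for i j
  proof -
    have "R = h - f' * Q - X2 * (cst \<alpha> * Q)" by (simp add: R_def fdec algebra_simps)
    then show ?thesis using rec[of i j] by (simp add: cf_cst_mult)
  qed
  then have "R = yser (fps_nth R 0)"
    by (intro ps2_eqI) (metis cf_yser not0_implies_Suc)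
  then have "R + Q * f = yser (fps_nth R 0) + Q * f" by (rule arg_cong)
  then have eq: "h = Q * f + yser (fps_nth R 0)" unfolding R_def by (simp add: add.commute)
  moreover have "conv Q" if cv: "conv f" "conv h"
  proof -
    have "conv f'" using cv by (simp add: f'_def)
    then obtain r A where A: "r > 0" "A > 0" "\<And>s m. 0 < s \<Longrightarrow> s \<le> r \<Longrightarrow> wnorm s m f' \<le> A"
      using convE by blast
    obtain r' B where B: "r' > 0" "B > 0" "\<And>s m. 0 < s \<Longrightarrow> s \<le> r' \<Longrightarrow> wnorm s m h \<le> B"
      using convE[OF cv(2)] by blast
    define \<rho> where "\<rho> = min r r'"
    \<comment> \<open>This shrinking factor makes \<open>f'\<close> contribute at most half of the norm of \<open>\<alpha> x Q\<close>.\<close>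
    define t where "t = min 1 (norm \<alpha> * \<rho> / (2 * A))"
    have \<rho>: "\<rho> > 0" "\<rho> \<le> r" "\<rho> \<le> r'" using A B by (auto simp: \<rho>_def)
    have al: "norm \<alpha> > 0" using f1 by (simp add: \<alpha>_def)
    have t: "0 < t" "t \<le> 1" "t \<le> norm \<alpha> * \<rho> / (2 * A)" using \<rho> A al by (auto simp: t_def)
    define s where "s = t * \<rho>"
    have s: "s > 0" "s \<le> \<rho>" using t \<rho> by (auto simp: s_def mult_le_cancel_right1 mult_le_one)
    have bound: "wnorm s m Q \<le> 2 * B / (norm \<alpha> * s)" for m
    proof -
      have "norm \<alpha> * s * wnorm s m Q =
          (\<Sum>(i, j)\<in>wts m. norm (cf (h - f' * Q) (Suc i) j) * s ^ (Suc i + 2 * j))"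
        unfolding wnorm_def sum_distrib_left
      proof (intro sum.cong refl, clarify)
        fix i j
        have "norm \<alpha> * norm (cf Q i j) = norm (cf (h - f' * Q) (Suc i) j)"
          using rec[of i j] by (metis norm_mult fps_sub_nth Suc_eq_plus1)
        then show "norm \<alpha> * s * (norm (cf Q i j) * s ^ (i + 2 * j)) =
            norm (cf (h - f' * Q) (Suc i) j) * s ^ (Suc i + 2 * j)"
          by (simp add: algebra_simps)
      qed
      also have "\<dots> = (\<Sum>(i, j)\<in>(\<lambda>(i, j). (Suc i, j)) ` wts m. norm (cf (h - f' * Q) i j) * s ^ (i + 2 * j))"
        by (subst sum.reindex) (auto simp: inj_on_def case_prod_unfold)
      also have "\<dots> \<le> wnorm s (m + 1) (h - f' * Q)"
        unfolding wnorm_def by (rule sum_mono2[OF finite_wt]) (use s in \<open>auto simp: wts_def\<close>)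
      also have "\<dots> \<le> wnorm s (m + 1) h + wnorm s (m + 1) (f' * Q)"
        using s by (intro wnorm_diff) auto
      also have "wnorm s (m + 1) (f' * Q) \<le> wnorm s (m + 1) f' * wnorm s m Q"
        by (rule wnorm_mult) (use s f' in auto)
      also have "wnorm s (m + 1) f' \<le> t\<^sup>2 * wnorm \<rho> (m + 1) f'"
        unfolding s_def by (rule wnorm_scale) (use t \<rho> f' in auto)
      also have "t\<^sup>2 * wnorm \<rho> (m + 1) f' \<le> t\<^sup>2 * A"
        using A(3) \<rho> by (intro mult_left_mono) auto
      also have "t\<^sup>2 * A = t * (t * A)" by (simp add: power2_eq_square)
      also have "\<dots> \<le> t * (norm \<alpha> * \<rho> / 2)"
        using t A(2) by (intro mult_left_mono) (auto simp: field_simps)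
      also have "\<dots> = norm \<alpha> * s / 2" by (simp add: s_def)
      also have "wnorm s (m + 1) h \<le> B" using B(3) s \<rho> by auto
      finally have "norm \<alpha> * s * wnorm s m Q \<le> B + norm \<alpha> * s / 2 * wnorm s m Q"
        using wnorm_nonneg[of s m Q] s by (simp add: mult_right_mono)
      then have "norm \<alpha> * s * wnorm s m Q \<le> 2 * B" by (simp add: field_simps)
      then show ?thesis using al s by (simp add: pos_le_divide_eq mult.commute)
    qed
    show ?thesis unfolding conv_def using s(1) bound by blast
  qed
  ultimately show ?thesis using that by blast
qed

text \<open>Dividing \<open>x\<close> by \<open>x F\<close> leaves no remainder and the quotient is the inverse of \<open>F\<close>, so
  units of the convergent ring need no estimates of their own.\<close>

lemma unit_inverse:
  assumes "cf F 0 0 \<noteq> 0"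
  obtains G where "F * G = 1" "conv F \<Longrightarrow> conv G"
proof -
  have f: "cf (X2 * F) 0 0 = 0" "cf (X2 * F) 1 0 \<noteq> 0" using assms by auto
  obtain Q r where Q: "X2 = Q * (X2 * F) + yser r" "conv (X2 * F) \<Longrightarrow> conv X2 \<Longrightarrow> conv Q"
    using weierstrass_division[OF f] by metis
  have eq: "X2 * (1 - Q * F) = yser r" using Q(1) by (simp add: algebra_simps)
  have "fps_nth r j = 0" for j
  proof -
    have "fps_nth r j = cf (yser r) 0 j" by (simp add: cf_yser)
    also have "\<dots> = 0" by (simp flip: eq)
    finally show ?thesis .
  qed
  then have "r = 0" by (simp add: fps_eq_iff)
  then have "X2 * (1 - Q * F) = 0" using eq by (simp add: yser_simps)
  then have "F * Q = 1" by (simp add: mult.commute)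
  then show ?thesis using Q(2) that by blast
qed

lemma unit_cf: "F * G = (1::ps2) \<Longrightarrow> cf F 0 0 * cf G 0 0 = 1"
  using cf_mult_00[of F G] by simp

section \<open>Square roots\<close>

text \<open>The coefficients of the solution \<open>T\<close> of \<open>2 T + T\<^sup>2 = e\<close> without constant term; the excluded index pairs
  are those where one factor of a product in \<open>T\<^sup>2\<close> is the vanishing constant term.\<close>

function sqc :: "ps2 \<Rightarrow> nat \<Rightarrow> nat \<Rightarrow> complex" where
  "sqc e i j = (if i = 0 \<and> j = 0 then 0 else (cf e i j -
     (\<Sum>k\<le>i. \<Sum>l\<le>j. if (k = 0 \<and> l = 0) \<or> (k = i \<and> l = j) then 0
         else sqc e k l * sqc e (i - k) (j - l))) / 2)"
  by pat_completeness auto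
termination
  by (relation "Wellfounded.measure (\<lambda>(e, i, j). i + j)") auto

declare sqc.simps [simp del]

text \<open>Once the norm of \<open>e\<close> is at most 1, the bound \<open>|T| \<le> 1\<close> propagates from one truncation to the next,
  because the part of \<open>T\<^sup>2\<close> of weight at most \<open>m + 1\<close> is bounded by \<open>|T|\<^bsub>m+1\<^esub> |T|\<^sub>m\<close>.\<close>

lemma sqrt_one_plus:
  assumes "conv e" "cf e 0 0 = 0"
  obtains T where "conv T" "2 * T + T * T = e" "cf T 0 0 = 0"
proof -
  define T where "T = mk2 (sqc e)"
  have T0: "cf T 0 0 = 0" unfolding T_def cf_mk2 by (subst sqc.simps) simp
  have T: "2 * cf T i j = cf (e - T * T) i j" for i j
  proof (cases "i = 0 \<and> j = 0")
    case False
    have "(\<Sum>k\<le>i. \<Sum>l\<le>j. if (k = 0 \<and> l = 0) \<or> (k = i \<and> l = j) then 0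
         else sqc e k l * sqc e (i - k) (j - l)) = cf (T * T) i j"
      unfolding cf_mult using T0 by (intro sum.cong refl) (auto simp: T_def)
    moreover have "cf T i j = (cf e i j - (\<Sum>k\<le>i. \<Sum>l\<le>j. if (k = 0 \<and> l = 0) \<or> (k = i \<and> l = j) then 0
         else sqc e k l * sqc e (i - k) (j - l))) / 2"
      unfolding T_def cf_mk2 by (subst sqc.simps) (use False in \<open>simp only: if_False\<close>)
    ultimately show ?thesis by (simp add: mult.commute)
  qed (use T0 assms in auto)
  have eq: "2 * T + T * T = e"
  proof (rule ps2_eqI)
    fix i j
    have "cf (2 * T + T * T) i j = 2 * cf T i j + cf (T * T) i j"
      unfolding numeral_cst fps_add_nth cf_cst_mult ..
    also have "\<dots> = cf e i j" unfolding T fps_sub_nth by (rule diff_add_cancel)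
    finally show "cf (2 * T + T * T) i j = cf e i j" .
  qed
  obtain r A where A: "r > 0" "A > 0" "\<And>s m. 0 < s \<Longrightarrow> s \<le> r \<Longrightarrow> wnorm s m e \<le> A"
    using convE[OF assms(1)] by blast
  define t where "t = min 1 (1 / A)"
  have t: "0 < t" "t \<le> 1" "t \<le> 1 / A" using A(1,2) by (auto simp: t_def)
  then have tA: "t * A \<le> 1" using A(2) by (simp add: pos_le_divide_eq)
  define s where "s = t * r"
  have s: "s > 0" using t(1) A(1) by (simp add: s_def)
  have e: "wnorm s m e \<le> 1" for m
  proof -
    have "wnorm s m e \<le> t ^ 1 * wnorm r m e"
      unfolding s_def by (rule wnorm_scale) (use t(1,2) A(1) assms(2) in auto)
    also have "\<dots> \<le> t * A" using t(1) A(1) A(3)[of r m] by (simp add: mult_left_mono)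
    finally show ?thesis using tA by simp
  qed
  have "wnorm s m T \<le> 1" for m
  proof (induction m)
    case 0
    have "wts 0 = {(0, 0)}" by (auto simp: wts_def)
    then show ?case by (simp add: wnorm_def T0)
  next
    case (Suc m)
    have "2 * wnorm s (Suc m) T = wnorm s (Suc m) (e - T * T)"
      unfolding wnorm_def sum_distrib_left
    proof (intro sum.cong refl, clarify)
      fix i j
      have "2 * norm (cf T i j) = norm (cf (e - T * T) i j)"
        unfolding T[symmetric] norm_mult norm_numeral ..
      then show "2 * (norm (cf T i j) * s ^ (i + 2 * j)) = norm (cf (e - T * T) i j) * s ^ (i + 2 * j)"
        by simp
    qed
    also have "\<dots> \<le> wnorm s (Suc m) e + wnorm s (Suc m) (T * T)"
      using s by (intro wnorm_diff) auto
    finally have 1: "2 * wnorm s (Suc m) T \<le> wnorm s (Suc m) e + wnorm s (Suc m) (T * T)" .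
    have "wnorm s (m + 1) (T * T) \<le> wnorm s (m + 1) T * wnorm s m T"
      by (rule wnorm_mult) (use s T0 in auto)
    also have "\<dots> \<le> wnorm s (m + 1) T * 1"
      using Suc s by (intro mult_left_mono wnorm_nonneg) auto
    finally show ?case using 1 e[of "Suc m"] by simp
  qed
  then have "conv T" using s by (auto simp: conv_def)
  then show ?thesis using eq T0 that by blast
qed

lemma unit_sqrt:
  assumes "conv D" "cf D 0 0 = d\<^sup>2" "d \<noteq> 0"
  obtains s where "conv s" "s\<^sup>2 = D" "cf s 0 0 = d"
proof -
  define c where "c = 1 / d\<^sup>2"
  have c: "d * d * c = 1" using assms(3) by (simp add: c_def power2_eq_square)
  define e where "e = cst c * D - 1"
  have "conv e" unfolding e_def using assms(1) by blast
  moreover have "cf e 0 0 = 0"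
    unfolding e_def fps_sub_nth cf_cst_mult assms(2) using c by (simp add: power2_eq_square mult_ac)
  ultimately obtain T where T: "conv T" "2 * T + T * T = e" "cf T 0 0 = 0"
    using sqrt_one_plus by blast
  define s where "s = cst d * (1 + T)"
  have "s\<^sup>2 = cst (d * d) * (1 + e)"
    unfolding s_def T(2)[symmetric] power2_eq_square cst_simps(3)
    by (simp only: algebra_simps mult_2 mult_2_right mult_1_left mult_1_right)
  also have "1 + e = cst c * D" unfolding e_def by simp
  also have "cst (d * d) * (cst c * D) = cst (d * d * c) * D" unfolding cst_simps(3) by (simp only: mult_ac)
  also have "\<dots> = D" unfolding c cst_simps by simp
  finally have "s\<^sup>2 = D" .
  moreover have "conv s" unfolding s_def using T(1) by blast
  moreover have "cf s 0 0 = d" unfolding s_def cf_cst_mult fps_add_nth T(3) by simp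
  ultimately show ?thesis using that by blast
qed

section \<open>Swapping the variables, conjugating the coefficients\<close>

definition swap2 :: "ps2 \<Rightarrow> ps2" where "swap2 P = mk2 (\<lambda>i j. cf P j i)"
text \<open>Real coefficients are expressed as the fixed-point equation \<open>conj2 P = P\<close>, which is preserved by the ring
  operations through rewriting.\<close>

definition conj2 :: "ps2 \<Rightarrow> ps2" where "conj2 P = mk2 (\<lambda>i j. cnj (cf P i j))"

lemma swap2_simps [simp]: "swap2 (swap2 P) = P" "swap2 (P + Q) = swap2 P + swap2 Q" "swap2 (P - Q) = swap2 P - swap2 Q"
    "swap2 (P * Q) = swap2 P * swap2 Q" "swap2 X2 = Y2" "swap2 Y2 = X2" "swap2 (cst c) = cst c" "cf (swap2 P) i j = cf P j i"
    "swap2 0 = 0"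
proof -
  show "swap2 (P * Q) = swap2 P * swap2 Q"
  proof (rule ps2_eqI)
    fix i j
    have "cf (swap2 (P * Q)) i j = (\<Sum>k\<le>j. \<Sum>l\<le>i. cf P k l * cf Q (j - k) (i - l))"
      unfolding swap2_def cf_mk2 by (rule cf_mult)
    also have "\<dots> = cf (swap2 P * swap2 Q) i j"
      unfolding cf_mult swap2_def cf_mk2 by (rule sum.swap)
    finally show "cf (swap2 (P * Q)) i j = cf (swap2 P * swap2 Q) i j" .
  qed
  show "swap2 X2 = Y2"
    by (rule ps2_eqI) (simp only: swap2_def cf_mk2 cf_X2 cf_Y2 conj_commute)
  show "swap2 Y2 = X2"
    by (rule ps2_eqI) (simp only: swap2_def cf_mk2 cf_X2 cf_Y2 conj_commute)
  show "swap2 (cst c) = cst c"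
    by (rule ps2_eqI) (simp only: swap2_def cf_mk2 cf_cst conj_commute)
  show "swap2 (swap2 P) = P" by (rule ps2_eqI) (simp add: swap2_def)
  show "swap2 (P + Q) = swap2 P + swap2 Q" by (rule ps2_eqI) (simp add: swap2_def)
  show "swap2 (P - Q) = swap2 P - swap2 Q" by (rule ps2_eqI) (simp add: swap2_def)
  show "swap2 0 = 0" by (rule ps2_eqI) (simp add: swap2_def)
qed (simp add: swap2_def)

lemma conv_sw [simp]: "conv (swap2 P) \<longleftrightarrow> conv P"
proof -
  have "conv (swap2 P)" if "conv P" for P
  proof -
    obtain \<rho> C where *: "\<rho> > 0" "\<And>i j. norm (cf P i j) * \<rho> ^ (i + j) \<le> C"
      using conv_coeffE[OF \<open>conv P\<close>] by metis
    have "norm (cf (swap2 P) i j) * \<rho> ^ (i + j) \<le> C" for i j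
      using *(2)[of j i] unfolding swap2_simps by (subst add.commute)
    then show ?thesis using *(1) conv_coeffI by blast
  qed
  from this[of P] this[of "swap2 P"] show ?thesis unfolding swap2_simps by blast
qed

lemma swap2_power [simp]: "swap2 (P ^ n) = swap2 P ^ n"
  by (induction n) (use swap2_simps(7)[of 1] in \<open>auto simp: cst_simps\<close>)

lemma swap2_sum [simp]: "swap2 (sum f S) = (\<Sum>x\<in>S. swap2 (f x))"
  by (induction S rule: infinite_finite_induct) auto

lemma conj2_simps [simp]: "conj2 (P + Q) = conj2 P + conj2 Q" "conj2 (P - Q) = conj2 P - conj2 Q" "conj2 (- P) = - conj2 P"
    "conj2 (P * Q) = conj2 P * conj2 Q" "conj2 (cst c) = cst (cnj c)" "cf (conj2 P) i j = cnj (cf P i j)"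
    "conj2 X2 = X2" "conj2 Y2 = Y2"
proof -
  show "conj2 (P * Q) = conj2 P * conj2 Q"
    by (rule ps2_eqI) (simp only: cf_mult conj2_def cf_mk2 cnj_sum complex_cnj_mult)
  show "conj2 (cst c) = cst (cnj c)"
    by (rule ps2_eqI) (simp only: conj2_def cf_mk2 cf_cst if_distrib[of cnj] complex_cnj_zero)
  show "conj2 X2 = X2"
    by (rule ps2_eqI) (simp only: conj2_def cf_mk2 cf_X2 if_distrib[of cnj] complex_cnj_zero complex_cnj_one)
  show "conj2 Y2 = Y2"
    by (rule ps2_eqI) (simp only: conj2_def cf_mk2 cf_Y2 if_distrib[of cnj] complex_cnj_zero complex_cnj_one)
  show "conj2 (P + Q) = conj2 P + conj2 Q" by (rule ps2_eqI) (simp add: conj2_def)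
  show "conj2 (P - Q) = conj2 P - conj2 Q" by (rule ps2_eqI) (simp add: conj2_def)
  show "conj2 (- P) = - conj2 P" by (rule ps2_eqI) (simp add: conj2_def)
qed (simp add: conj2_def)

lemma conj2_numeral [simp]: "conj2 (numeral k) = numeral k" "conj2 1 = 1" "conj2 0 = 0"
  using conj2_simps(5)[of "numeral k"] conj2_simps(5)[of 1] conj2_simps(5)[of 0]
  by (simp_all add: numeral_cst cst_simps)

lemma conj2_power [simp]: "conj2 (P ^ n) = conj2 P ^ n"
  by (induction n) auto

lemma conj2_inverse: "F * G = 1 \<Longrightarrow> conj2 F = F \<Longrightarrow> conj2 G = G"
proof -
  assume 1: "F * G = 1" "conj2 F = F"
  have "F * conj2 G = conj2 (F * G)" using 1(2) by simp
  then have "F * conj2 G = 1" using 1(1) by simp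

  have "conj2 G = (G * F) * conj2 G" using 1(1) by (simp add: mult.commute)
  also have "\<dots> = G * (F * conj2 G)" by (rule mult.assoc)
  also have "\<dots> = G" unfolding \<open>F * conj2 G = 1\<close> by simp
  finally show "conj2 G = G" .
qed

text \<open>The conjugate of a square root of a real series is a square root too, hence equal to it up to sign;
  a real non-zero constant term decides the sign.\<close>

lemma conj2_sqrt:
  assumes "conj2 D = D" "s\<^sup>2 = D" "Im (cf s 0 0) = 0" "cf s 0 0 \<noteq> 0"
  shows "conj2 s = s"
proof -
  have "(conj2 s - s) * (conj2 s + s) = (conj2 s)\<^sup>2 - s\<^sup>2"
    by (simp only: power2_eq_square algebra_simps)
  also have "\<dots> = 0" using assms(1,2) conj2_power[of s 2] right_minus_eq by metis
  finally have "conj2 s - s = 0 \<or> conj2 s + s = 0" unfolding mult_eq_0_iff .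
  moreover have "conj2 s + s \<noteq> 0"
  proof
    assume "conj2 s + s = 0"
    then have "cf (conj2 s + s) 0 0 = 0" by (simp only: fps_zero_nth)
    then have "Re (cnj (cf s 0 0) + cf s 0 0) = 0" by simp
    then show False using assms(3,4) complex_eq_iff[of "cf s 0 0" 0] by (simp del: complex_eq_iff)
  qed
  ultimately show ?thesis unfolding right_minus_eq by blast
qed

section \<open>Intersection numbers of formal curves\<close>

text \<open>Membership in the power \<open>\<mm>\<^sup>n\<close> of the maximal ideal.\<close>

definition ord_ge :: "nat \<Rightarrow> ps2 \<Rightarrow> bool" where
  "ord_ge n P \<longleftrightarrow> (\<forall>i j. i + j < n \<longrightarrow> cf P i j = 0)"

text \<open>\<open>g \<in> (f) + \<mm>\<^sup>n\<close>: the curve \<open>g = 0\<close> has contact of order at least \<open>n\<close> with the curve \<open>f = 0\<close>.\<close>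

definition contact :: "ps2 \<Rightarrow> ps2 \<Rightarrow> nat \<Rightarrow> bool" where
  "contact f g n \<longleftrightarrow> (\<exists>A. ord_ge n (g - A * f))"

text \<open>The intersection number of \<open>f\<close> and \<open>g\<close>, for a curve \<open>f = 0\<close> that is smooth at the origin. In this form it is
  visibly independent of the choice of coordinates.\<close>

definition isect_num :: "ps2 \<Rightarrow> ps2 \<Rightarrow> nat \<Rightarrow> bool" where
  "isect_num f g n \<longleftrightarrow> cf f 0 0 = 0 \<and> \<not> ord_ge 2 f \<and> contact f g n \<and> \<not> contact f g (Suc n)"

lemma ord_ge_add: "ord_ge n P \<Longrightarrow> ord_ge n Q \<Longrightarrow> ord_ge n (P + Q)"
  and ord_ge_diff: "ord_ge n P \<Longrightarrow> ord_ge n Q \<Longrightarrow> ord_ge n (P - Q)"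
  by (simp_all add: ord_ge_def)

lemma ord_ge_0 [simp]: "ord_ge 0 P" "ord_ge n 0"
  by (simp_all add: ord_ge_def)

lemma ord_ge_mono: "ord_ge n P \<Longrightarrow> m \<le> n \<Longrightarrow> ord_ge m P"
  by (auto simp: ord_ge_def)

lemma ord_ge_mult:
  assumes "ord_ge n P" "ord_ge m Q" shows "ord_ge (n + m) (P * Q)"
  unfolding ord_ge_def cf_mult
proof (intro allI impI sum.neutral ballI)
  fix i j k l assume ij: "i + j < n + m" "k \<in> {..i}" "l \<in> {..j}"
  then have "k + l < n \<or> (i - k) + (j - l) < m" by auto
  then show "cf P k l * cf Q (i - k) (j - l) = 0" using assms by (auto simp: ord_ge_def)
qed

lemma ord_ge_mult_left: "ord_ge n P \<Longrightarrow> ord_ge n (A * P)"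
  using ord_ge_mult[of 0 A n P] by simp

lemma ord_ge_power: "ord_ge 1 P \<Longrightarrow> ord_ge n (P ^ n)"
proof (induction n)
  case (Suc n) then show ?case using ord_ge_mult[of 1 P n "P ^ n"] by simp
qed simp

lemma ord_ge_X2 [simp]: "ord_ge 1 X2" "ord_ge (Suc 0) X2" and ord_ge_Y2 [simp]: "ord_ge 1 Y2" "ord_ge (Suc 0) Y2"
  by (simp_all add: ord_ge_def cf_Y2)

lemma ord_ge_yser: "ord_ge n (yser s) \<longleftrightarrow> (\<forall>j<n. fps_nth s j = 0)"
  by (auto simp: ord_ge_def cf_yser)

lemma Y2_power: "Y2 ^ n = yser (fps_X ^ n)"
  by (simp add: Y2_def yser_simps)

text \<open>Substituting \<open>x = p(y)\<close> maps \<open>\<mm>\<^sup>n\<close> into \<open>(y\<^sup>n)\<close>. The proof avoids the substitution of an infinite series: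
  comparing coefficients of \<open>x\<^sup>i\<close> expresses \<open>W\<^sub>i\<close> through \<open>p W\<^bsub>i+1\<^esub>\<close>, and a descending induction gives the order of
  \<open>W\<^sub>i\<close> in \<open>y\<close>, starting from \<open>i \<ge> n\<close> where nothing is claimed.\<close>

lemma vanishing_on_graph:
  assumes p: "fps_nth p 0 = 0" and M: "ord_ge n (W * (X2 - yser p) - yser s)"
  shows "\<forall>j<n. fps_nth s j = 0"
proof -
  define M where "M = W * (X2 - yser p) - yser s"
  have M0: "fps_nth M 0 = - (fps_nth W 0 * p) - s"
    by (simp add: M_def yser_def right_diff_distrib)
  have M1: "fps_nth M (Suc i) = fps_nth W i - fps_nth W (Suc i) * p" for i
    by (simp add: M_def yser_def right_diff_distrib)
  have ord: "cf M i j = 0" if "i + j < n" for i j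
    using assms(2) that by (simp add: M_def ord_ge_def)
  have pW: "fps_nth (fps_nth W i * p) j = 0" if "\<And>l. l < j \<Longrightarrow> cf W i l = 0" for i j
    unfolding fps_mult_nth
  proof (intro sum.neutral ballI)
    fix l assume "l \<in> {0..j}"
    then show "cf W i l * fps_nth p (j - l) = 0" using that p by (cases "l = j") auto
  qed
  have W: "\<forall>i j. n \<le> i + k \<longrightarrow> i + j + 1 < n \<longrightarrow> cf W i j = 0" for k
  proof (induction k)
    case (Suc k)
    show ?case
    proof (intro allI impI)
      fix i j assume ij: "n \<le> i + Suc k" "i + j + 1 < n"
      have "fps_nth (fps_nth W (Suc i) * p) j = 0"
        using Suc.IH ij by (intro pW) auto
      moreover have "cf M (Suc i) j = 0" using ij by (intro ord) auto
      ultimately show "cf W i j = 0" by (simp add: M1)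
    qed
  qed auto
  show ?thesis
  proof (intro allI impI)
    fix j assume j: "j < n"
    have "fps_nth (fps_nth W 0 * p) j = 0" using W[of n] j by (intro pW) auto
    moreover have "cf M 0 j = 0" using j by (intro ord) auto
    ultimately show "fps_nth s j = 0" by (simp add: M0)
  qed
qed

text \<open>The formal implicit function theorem, read off from dividing \<open>x\<close> by \<open>f\<close>: the remainder is the graph.\<close>

lemma regular_curve_is_graph:
  assumes "cf f 0 0 = 0" "cf f 1 0 \<noteq> 0"
  obtains Q G p where "Q * G = 1" "fps_nth p 0 = 0" "f = G * (X2 - yser p)"
proof -
  obtain Q p where Q: "X2 = Q * f + yser p" using weierstrass_division[OF assms] by metis
  have "cf X2 0 0 = cf (Q * f + yser p) 0 0" using Q by metis
  then have p: "fps_nth p 0 = 0" using assms by (simp add: cf_yser)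
  have "cf X2 1 0 = cf (Q * f + yser p) 1 0" using Q by metis
  then have "cf Q 0 0 \<noteq> 0" using assms by (auto simp: cf_yser)
  then obtain G where G: "Q * G = 1" using unit_inverse by metis
  have "f = (Q * G) * f" using G by simp
  also have "\<dots> = G * (Q * f)" by (simp only: mult_ac)
  also have "Q * f = X2 - yser p" by (subst Q) simp
  finally show ?thesis using that G p by blast
qed

lemma vanishing_on_regular_curve:
  assumes "cf f 0 0 = 0" "cf f 1 0 \<noteq> 0" "ord_ge n (W * f - yser s)"
  shows "\<forall>j<n. fps_nth s j = 0"
proof -
  obtain Q G p where *: "Q * G = 1" "fps_nth p 0 = 0" "f = G * (X2 - yser p)"
    using regular_curve_is_graph assms(1,2) by blast
  show ?thesis using vanishing_on_graph[OF *(2), of n "W * G" s] assms(3) *(3) by (simp add: mult.assoc)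
qed

text \<open>A power series in \<open>y\<close> in the ideal of a graph is divisible by all powers of \<open>y\<close>.\<close>

lemma vanishing_on_graph_eq:
  assumes p: "fps_nth p 0 = 0" and eq: "W * (X2 - yser p) = yser s"
  shows "s = 0" "W = 0"
proof -
  have "fps_nth s j = 0" for j
    using vanishing_on_graph[OF p, of "Suc j" W s] eq by simp
  then show "s = 0" by (simp add: fps_eq_iff)
  then have "W = 0 \<or> X2 - yser p = 0" using eq by (simp add: yser_simps)
  moreover have "cf (X2 - yser p) 1 0 = 1" by (simp add: cf_yser)
  then have "X2 - yser p \<noteq> 0" by auto
  ultimately show "W = 0" by blast
qed

text \<open>Two non-units with product \<open>x\<^sup>2 - r(y)\<close> both have a non-zero coefficient at \<open>x\<close>. So \<open>A\<close> is a
  graph \<open>x = p(y)\<close> up to a unit, \<open>x\<^sup>2 - r(y)\<close> vanishes on it, and \<open>r = p\<^sup>2\<close>.\<close>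

lemma factors_of_quadratic:
  assumes eq: "A * B = X2\<^sup>2 - yser r" and A0: "cf A 0 0 = 0" and B0: "cf B 0 0 = 0"
  obtains Q G p where "Q * G = 1" "fps_nth p 0 = 0" "r = p\<^sup>2"
    "A = G * (X2 - yser p)" "B = Q * (X2 + yser p)"
proof -
  have "cf (A * B) 2 0 = cf A 1 0 * cf B 1 0"
    using A0 B0 by (simp add: numeral_2_eq_2 fps_mult_nth)
  moreover have "cf (X2\<^sup>2 - yser r) 2 0 = 1" by (simp add: cf_yser power2_eq_square numeral_2_eq_2)
  ultimately have "cf A 1 0 \<noteq> 0" using eq by auto
  then obtain Q G p where *: "Q * G = 1" "fps_nth p 0 = 0" "A = G * (X2 - yser p)"
    using regular_curve_is_graph A0 by blast
  have "Q * (A * B) = (Q * G) * ((X2 - yser p) * B)" unfolding *(3) by (simp only: mult_ac)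
  then have 1: "Q * (X2\<^sup>2 - yser r) = (X2 - yser p) * B" unfolding *(1) eq by simp
  have 2: "X2\<^sup>2 - yser r = (X2 - yser p) * (X2 + yser p) + yser (p\<^sup>2 - r)"
    by (simp add: yser_simps algebra_simps power2_eq_square)
  define W where "W = B - Q * (X2 + yser p)"
  have "(X2 - yser p) * W = Q * yser (p\<^sup>2 - r)"
    unfolding W_def right_diff_distrib 1[symmetric] 2 by (simp add: algebra_simps)
  then have "G * ((X2 - yser p) * W) = (Q * G) * yser (p\<^sup>2 - r)" by (simp only: mult_ac)
  then have "(G * W) * (X2 - yser p) = yser (p\<^sup>2 - r)" unfolding *(1) by (simp add: mult_ac)
  from vanishing_on_graph_eq[OF *(2) this] have "p\<^sup>2 - r = 0" "G * W = 0" .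
  moreover have "G \<noteq> 0" using *(1) by auto
  ultimately have "r = p\<^sup>2" "B = Q * (X2 + yser p)" by (simp_all add: W_def)
  then show ?thesis using that * by blast
qed

text \<open>Modulo the first curve \<open>x\<close> is \<open>p\<close>, so the second equation restricts to \<open>2 p\<close> up to a unit.\<close>

lemma isect_num_opposite_graphs:
  assumes "Q * G = 1" "fps_nth p 0 = 0" "p \<noteq> 0"
  shows "isect_num (G * (X2 - yser p)) (Q * (X2 + yser p)) (subdegree p)" (is "isect_num ?A ?B ?k")
proof -
  have G0: "cf G 0 0 \<noteq> 0" using unit_cf[OF assms(1)] by auto
  have "cf ?A 1 0 = cf G 0 0" using assms(2) by (simp add: right_diff_distrib cf_yser yser_def)
  then have "\<not> ord_ge 2 ?A" using G0 unfolding ord_ge_def by (metis add.right_neutral one_less_numeral_iff semiring_norm(76))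
  moreover have "contact ?A ?B ?k"
  proof -
    have "?B - (Q * Q) * ?A = Q * (X2 + yser p) - (Q * G) * (Q * (X2 - yser p))" by (simp only: mult_ac)
    also have "\<dots> = (2 * Q) * yser p" unfolding assms(1) by (simp add: algebra_simps)
    finally have eq: "?B - (Q * Q) * ?A = (2 * Q) * yser p" .
    have "ord_ge ?k ((2 * Q) * yser p)"
      by (rule ord_ge_mult_left, unfold ord_ge_yser) (intro allI impI nth_less_subdegree_zero)
    then show ?thesis unfolding contact_def using eq by (intro exI[of _ "Q * Q"]) (simp only:)
  qed
  moreover have "\<not> contact ?A ?B (Suc ?k)"
  proof
    assume "contact ?A ?B (Suc ?k)"
    then obtain T where "ord_ge (Suc ?k) (?B - T * ?A)" by (auto simp: contact_def)
    then have "ord_ge (Suc ?k) (G * (?B - T * ?A))" by (rule ord_ge_mult_left)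
    also have "G * (?B - T * ?A) = (Q * G) * (X2 + yser p) - (G * G * T) * (X2 - yser p)"
      by (simp only: right_diff_distrib mult_ac)
    also have "\<dots> = (1 - G * G * T) * (X2 - yser p) - yser (- (2 * p))"
      unfolding assms(1) by (simp add: algebra_simps yser_simps yser_def fps_const_add)
    finally have "\<forall>j<Suc ?k. fps_nth (- (2 * p)) j = 0" using vanishing_on_graph[OF assms(2)] by blast
    then have "fps_nth (- (2 * p)) ?k = 0" by blast
    then show False using assms(3) by (simp add: fps_numeral_simps numeral_fps_const)
  qed
  ultimately show ?thesis using assms(2) by (simp add: isect_num_def cf_yser)
qed

text \<open>Comparing lowest terms: a monomial \<open>c y\<^sup>m\<close> is a square only for even \<open>m\<close>, and its root starts with a
  square root of \<open>c\<close>.\<close>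

lemma square_root_of_monomial:
  assumes "(p :: complex fps)\<^sup>2 = fps_const c * fps_X ^ m" "c \<noteq> 0"
  shows "p \<noteq> 0" "2 * subdegree p = m" "(fps_nth p (subdegree p))\<^sup>2 = c"
proof -
  show p: "p \<noteq> 0" using assms by auto
  have "subdegree (p\<^sup>2) = m" using assms by simp
  then show sd: "2 * subdegree p = m" using p by (simp add: power2_eq_square)
  have "fps_nth (p * p) (subdegree p + subdegree p) = c"
    using assms sd by (simp add: power2_eq_square)
  then show "(fps_nth p (subdegree p))\<^sup>2 = c" by (simp add: power2_eq_square)
qed

lemma isect_num_A:
  assumes "A * B = X2\<^sup>2 + cst c * Y2 ^ (2 * k)" "c \<noteq> 0" "cf A 0 0 = 0" "cf B 0 0 = 0"
  shows "isect_num A B k"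
proof -
  have "A * B = X2\<^sup>2 - yser (fps_const (- c) * fps_X ^ (2 * k))"
    using assms(1) by (simp add: yser_simps cst_simps Y2_power)
  from factors_of_quadratic[OF this assms(3,4)] obtain Q G p where *:
    "Q * G = 1" "fps_nth p 0 = 0" "fps_const (- c) * fps_X ^ (2 * k) = p\<^sup>2"
    "A = G * (X2 - yser p)" "B = Q * (X2 + yser p)" by metis
  have "p \<noteq> 0" "subdegree p = k" using square_root_of_monomial[OF *(3)[symmetric]] assms(2) by auto
  then show ?thesis using isect_num_opposite_graphs[OF *(1,2)] *(4,5) by simp
qed

lemma X2_dvd_product:
  assumes "A * B = X2 * C"
  obtains A' where "A = X2 * A'" "A' * B = C" | B' where "B = X2 * B'" "A * B' = C"
proof -
  have dec: "P = X2 * fps_shift 1 P" if "fps_nth P 0 = 0" for P :: ps2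
    by (rule fps_ext) (use that in auto)
  have "fps_nth A 0 * fps_nth B 0 = fps_nth (A * B) 0" by simp
  also have "\<dots> = 0" unfolding assms by simp
  finally consider "fps_nth A 0 = 0" | "fps_nth B 0 = 0" by auto
  then show ?thesis
  proof cases
    case 1
    then have 2: "A = X2 * fps_shift 1 A" by (rule dec)
    then have "X2 * (fps_shift 1 A * B) = X2 * C" using assms by (metis mult.assoc)
    then have "fps_shift 1 A * B = C" by simp
    then show ?thesis using that(1) 2 by blast
  next
    case 1: 2
    then have 2: "B = X2 * fps_shift 1 B" by (rule dec)
    then have "X2 * (A * fps_shift 1 B) = X2 * C" using assms by (metis mult.left_commute)
    then have "A * fps_shift 1 B = C" by simp
    then show ?thesis using that(2) 2 by blast
  qed
qed

lemma Y2_dvd_product: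
  assumes "A * B = Y2 * C"
  obtains A' where "A = Y2 * A'" "A' * B = C" | B' where "B = Y2 * B'" "A * B' = C"
proof -
  have "swap2 A * swap2 B = X2 * swap2 C" using arg_cong[OF assms, of swap2] by simp
  from X2_dvd_product[OF this] show ?thesis
  proof cases
    case (1 A')
    have "A = Y2 * swap2 A'" using arg_cong[OF 1(1), of swap2] by simp
    moreover have "swap2 A' * B = C" using arg_cong[OF 1(2), of swap2] by simp
    ultimately show ?thesis by (rule that(1))
  next
    case (2 B')
    have "B = Y2 * swap2 B'" using arg_cong[OF 2(1), of swap2] by simp
    moreover have "A * swap2 B' = C" using arg_cong[OF 2(2), of swap2] by simp
    ultimately show ?thesis by (rule that(2))
  qed
qed

text \<open>The factor \<open>A\<close> contains \<open>y\<close>; let \<open>A'\<close> be what remains of it. If \<open>A'\<close> is a unit, then \<open>A\<close> is the line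
  \<open>y = 0\<close> and \<open>B\<close> restricts to \<open>x\<^sup>2\<close> on it. Otherwise \<open>A'\<close> and \<open>B\<close> are the graphs of \<open>p\<close> and \<open>-p\<close>, and on the
  curve \<open>B\<close> the function \<open>A\<close> restricts to \<open>-2 y p\<close> up to a unit. In this case \<open>p\<^sup>2 = -c y\<^sup>m\<close>, which for \<open>c = 1\<close>
  gives \<open>p\<close> an imaginary leading coefficient, while the leading coefficients of a real \<open>A'\<close> force it to be real.\<close>

lemma isect_num_D_aux:
  assumes A: "A = Y2 * A'" and A'B: "A' * B = X2\<^sup>2 + cst c * Y2 ^ m" "m \<ge> 2" "c \<noteq> 0"
    and B0: "cf B 0 0 = 0"
  shows "isect_num A B 2 \<or> (even m \<and> isect_num B A (m div 2 + 1) \<and> \<not> (c = 1 \<and> conj2 A = A))"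
proof (cases "cf A' 0 0 = 0")
  case False
  obtain H where H: "A' * H = 1" using unit_inverse[OF False] by metis
  have H0: "cf H 0 0 \<noteq> 0" using unit_cf[OF H] by auto
  have "B = H * (A' * B)" using H by (simp add: mult.assoc[symmetric] mult.commute[of H])
  then have B: "B = H * (X2\<^sup>2 + cst c * Y2 ^ m)" unfolding A'B(1) .
  have "cf A 0 1 = cf A' 0 0" unfolding A cf_Y2_mult by simp
  then have "\<not> ord_ge 2 A" using False unfolding ord_ge_def
    by (metis add_0 one_less_numeral_iff semiring_norm(76))
  moreover have "contact A B 2"
  proof -
    have "ord_ge 2 B" unfolding B
      by (intro ord_ge_mult_left ord_ge_add ord_ge_power ord_ge_mono[OF ord_ge_power[of Y2 m]] A'B(2)) simp_all
    then show ?thesis unfolding contact_def by (intro exI[of _ 0]) simp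
  qed
  moreover have "\<not> contact A B (Suc 2)"
  proof
    assume "contact A B (Suc 2)"
    then obtain T where "ord_ge (Suc 2) (B - T * A)" by (auto simp: contact_def)
    then have "cf (B - T * A) 2 0 = 0" by (auto simp: ord_ge_def)
    moreover have "B - T * A = X2 * (X2 * H) + Y2 * (H * cst c * Y2 ^ (m - 1) - T * A')"
    proof -
      have "Y2 ^ m = Y2 * Y2 ^ (m - 1)" using A'B(2) by (simp flip: power_Suc)
      then show ?thesis unfolding B A by (simp only: power2_eq_square algebra_simps)
    qed
    then have "cf (B - T * A) 2 0 = cf H 0 0"
      unfolding \<open>B - T * A = _\<close> fps_add_nth cf_Y2_mult cf_X2_mult by simp
    ultimately show False using H0 by simp
  qed
  ultimately have "isect_num A B 2" using A by (simp add: isect_num_def cf_Y2)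
  then show ?thesis by blast
next
  case True
  have "A' * B = X2\<^sup>2 - yser (fps_const (- c) * fps_X ^ m)"
    using A'B(1) by (simp add: yser_simps cst_simps Y2_power)
  from factors_of_quadratic[OF this True B0] obtain Q G p where *:
    "Q * G = 1" "fps_nth p 0 = 0" "fps_const (- c) * fps_X ^ m = p\<^sup>2"
    "A' = G * (X2 - yser p)" "B = Q * (X2 + yser p)" by metis
  note root = square_root_of_monomial[OF *(3)[symmetric]]
  define k where "k = subdegree p"
  have p: "p \<noteq> 0" and k: "2 * k = m" and pk: "(fps_nth p k)\<^sup>2 = - c"
    using root A'B(3) by (auto simp: k_def)
  have Q0: "cf Q 0 0 \<noteq> 0" and G0: "cf G 0 0 \<noteq> 0" using unit_cf[OF *(1)] by auto
  have "cf B 1 0 = cf Q 0 0" using *(2,5) by (simp add: distrib_left cf_yser yser_def)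
  then have "\<not> ord_ge 2 B" using Q0 unfolding ord_ge_def by (metis add.right_neutral one_less_numeral_iff semiring_norm(76))
  moreover have "contact B A (k + 1)"
  proof -
    have "A - (Y2 * G * G) * B = Y2 * G * (X2 - yser p) - (Q * G) * (Y2 * G * (X2 + yser p))"
      unfolding A *(4,5) by (simp only: mult_ac)
    also have "\<dots> = (- (2 * G)) * yser (fps_X * p)"
      unfolding *(1) by (simp add: algebra_simps yser_simps Y2_def)
    finally have eq: "A - (Y2 * G * G) * B = (- (2 * G)) * yser (fps_X * p)" .
    have "fps_nth (fps_X * p) j = 0" if "j < k + 1" for j
    proof (cases j)
      case (Suc l)
      then have "fps_nth p l = 0" using that by (intro nth_less_subdegree_zero) (simp add: k_def)
      then show ?thesis using Suc by simp
    qed simp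
    then have "ord_ge (k + 1) ((- (2 * G)) * yser (fps_X * p))"
      by (intro ord_ge_mult_left) (unfold ord_ge_yser, blast)
    then show ?thesis unfolding contact_def using eq by (intro exI[of _ "Y2 * G * G"]) (simp only:)
  qed
  moreover have "\<not> contact B A (Suc (k + 1))"
  proof
    assume "contact B A (Suc (k + 1))"
    then obtain T where "ord_ge (Suc (k + 1)) (A - T * B)" by (auto simp: contact_def)
    then have "ord_ge (Suc (k + 1)) (Q * (A - T * B))" by (rule ord_ge_mult_left)
    also have "Q * (A - T * B) = (Q * G) * (Y2 * (X2 - yser p)) - (Q * T * Q) * (X2 + yser p)"
      unfolding A *(4,5) by (simp only: right_diff_distrib mult_ac)
    also have "\<dots> = (Y2 - Q * T * Q) * (X2 - yser (- p)) - yser (fps_X * p + fps_X * p)"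
      unfolding *(1) yser_simps Y2_def[symmetric] by (simp add: algebra_simps)
    finally have "ord_ge (Suc (k + 1)) ((Y2 - Q * T * Q) * (X2 - yser (- p)) - yser (fps_X * p + fps_X * p))" .
    moreover have "fps_nth (- p) 0 = 0" using *(2) by simp
    ultimately have "\<forall>j<Suc (k + 1). fps_nth (fps_X * p + fps_X * p) j = 0"
      using vanishing_on_graph by blast
    then have "fps_nth (fps_X * p + fps_X * p) (k + 1) = 0" by blast
    then show False using p by (simp add: k_def)
  qed
  ultimately have "isect_num B A (m div 2 + 1)" using k *(2,5) by (auto simp: isect_num_def cf_yser)
  moreover have "\<not> (c = 1 \<and> conj2 A = A)"
  proof
    assume c: "c = 1 \<and> conj2 A = A"
    have "Y2 \<noteq> 0" using cf_Y2[of 0 1] by auto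
    moreover have "Y2 * conj2 A' = Y2 * A'" using c A by (metis conj2_simps(4,8))
    ultimately have "conj2 A' = A'" by simp
    then have real: "cnj (cf A' i j) = cf A' i j" for i j by (metis conj2_simps(6))
    have a1: "cf A' 1 0 = cf G 0 0" using *(2,4) by (simp add: right_diff_distrib yser_def)
    have "cf A' 0 k = - fps_nth (fps_nth G 0 * p) k" using *(4) by (simp add: right_diff_distrib yser_def)
    also have "fps_nth (fps_nth G 0 * p) k = (\<Sum>i\<in>{0}. cf G 0 i * fps_nth p (k - i))"
      unfolding fps_mult_nth by (rule sum.mono_neutral_right) (auto simp: k_def intro!: nth_less_subdegree_zero)
    finally have a2: "cf A' 0 k = - (cf G 0 0 * fps_nth p k)" by simp
    then have "fps_nth p k = - cf A' 0 k / cf A' 1 0" using a1 G0 by (simp add: field_simps)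
    then have "cnj (fps_nth p k) = fps_nth p k" using real by simp
    then have "Im (fps_nth p k) = 0" by (simp add: complex_eq_iff)
    then have "Re ((fps_nth p k)\<^sup>2) \<ge> 0" by (simp add: power2_eq_square)
    then show False using pk c by simp
  qed
  ultimately show ?thesis using k by auto
qed

lemma isect_num_D:
  assumes "A * B = Y2 * (X2\<^sup>2 + cst c * Y2 ^ m)" "m \<ge> 2" "c \<noteq> 0" "cf A 0 0 = 0" "cf B 0 0 = 0"
  shows "isect_num A B 2 \<or> isect_num B A 2 \<or>
    (even m \<and> (isect_num A B (m div 2 + 1) \<or> isect_num B A (m div 2 + 1)) \<and> \<not> (c = 1 \<and> conj2 A = A \<and> conj2 B = B))"
  using Y2_dvd_product[OF assms(1)]
proof cases
  case (1 A')
  show ?thesis using isect_num_D_aux[OF 1 assms(2,3,5)] by blast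
next
  case (2 B')
  show ?thesis using isect_num_D_aux[OF 2(1) _ assms(2,3,4)] 2(2) by (metis mult.commute)
qed

text \<open>The cofactor of \<open>x\<close> in \<open>A\<close> is a unit because \<open>x\<^sup>2 + y\<^sup>3\<close> has no factorisation: \<open>-y\<^sup>3\<close> is not a
  square. So \<open>A\<close> is the line \<open>x = 0\<close>, on which \<open>B\<close> restricts to \<open>y\<^sup>3\<close>.\<close>

lemma isect_num_E7_aux:
  assumes A: "A = X2 * A'" and A'B: "A' * B = X2\<^sup>2 + Y2 ^ 3" and B0: "cf B 0 0 = 0"
  shows "isect_num A B 3"
proof -
  have A'0: "cf A' 0 0 \<noteq> 0"
  proof
    assume 0: "cf A' 0 0 = 0"
    have "A' * B = X2\<^sup>2 - yser (fps_const (- 1) * fps_X ^ 3)"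
      using A'B(1) by (simp add: yser_simps cst_simps Y2_power)
    from factors_of_quadratic[OF this 0 B0] obtain Q G p where *:
      "Q * G = 1" "fps_nth p 0 = 0" "fps_const (- 1) * fps_X ^ 3 = p\<^sup>2"
      "A' = G * (X2 - yser p)" "B = Q * (X2 + yser p)" by metis
    have "2 * subdegree p = 3" using square_root_of_monomial(2)[OF *(3)[symmetric]] by simp
    then show False by presburger
  qed
  obtain H where H: "A' * H = 1" using unit_inverse[OF A'0] by metis
  have H0: "cf H 0 0 \<noteq> 0" using unit_cf[OF H] by auto
  have "B = H * (A' * B)" using H by (simp add: mult.assoc[symmetric] mult.commute[of H])
  then have B: "B = H * (X2\<^sup>2 + Y2 ^ 3)" unfolding A'B(1) .
  have "cf A 1 0 = cf A' 0 0" unfolding A cf_X2_mult by simp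
  then have "\<not> ord_ge 2 A" using A'0 unfolding ord_ge_def
    by (metis add.right_neutral one_less_numeral_iff semiring_norm(76))
  moreover have "contact A B 3"
  proof -
    have "B - (X2 * H * H) * A = H * (X2\<^sup>2 + Y2 ^ 3) - (A' * H) * (H * (X2 * X2))"
      unfolding B A by (simp only: mult_ac)
    also have "\<dots> = H * Y2 ^ 3" unfolding H by (simp add: algebra_simps power2_eq_square)
    finally have eq: "B - (X2 * H * H) * A = H * Y2 ^ 3" .
    have "ord_ge 3 (H * Y2 ^ 3)" by (intro ord_ge_mult_left ord_ge_power ord_ge_Y2)
    then show ?thesis unfolding contact_def using eq by (intro exI[of _ "X2 * H * H"]) (simp only:)
  qed
  moreover have "\<not> contact A B (Suc 3)"
  proof
    assume "contact A B (Suc 3)"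
    then obtain T where "ord_ge (Suc 3) (B - T * A)" by (auto simp: contact_def)
    then have "cf (B - T * A) 0 3 = 0" by (auto simp: ord_ge_def)
    moreover have "B - T * A = Y2 * (Y2 * (Y2 * H)) + X2 * (H * X2 - T * A')"
      unfolding B A by (simp only: power2_eq_square power3_eq_cube algebra_simps)
    then have "cf (B - T * A) 0 3 = cf H 0 0"
      unfolding \<open>B - T * A = _\<close> fps_add_nth cf_Y2_mult cf_X2_mult by simp
    ultimately show False using H0 by simp
  qed
  ultimately show ?thesis using A by (simp add: isect_num_def)
qed

lemma isect_num_E7:
  assumes "A * B = X2 * (X2\<^sup>2 + Y2 ^ 3)" "cf A 0 0 = 0" "cf B 0 0 = 0"
  shows "isect_num A B 3 \<or> isect_num B A 3"
  using X2_dvd_product[OF assms(1)]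
proof cases
  case (1 A')
  show ?thesis using isect_num_E7_aux[OF 1 assms(3)] by blast
next
  case (2 B')
  show ?thesis using isect_num_E7_aux[OF 2(1) _ assms(2)] 2(2) by (metis mult.commute)
qed

section \<open>A monomial basis of the quotient of convergent series\<close>

text \<open>The powers \<open>1, \<eta>, ..., \<eta>\<^bsup>n-1\<^esup>\<close> form a basis of the convergent series modulo \<open>(f, g)\<close>. Independence
  holds even modulo the formal ideal.\<close>

definition quotient_basis :: "ps2 \<Rightarrow> ps2 \<Rightarrow> nat \<Rightarrow> ps2 \<Rightarrow> bool" where
  "quotient_basis f g n \<eta> \<longleftrightarrow> conv \<eta> \<and>
     (\<forall>h. conv h \<longrightarrow> (\<exists>A B c. conv A \<and> conv B \<and> h = A * f + B * g + (\<Sum>i<n. cst (c i) * \<eta> ^ i))) \<and>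
     (\<forall>A B c. (\<Sum>i<n. cst (c i) * \<eta> ^ i) = A * f + B * g \<longrightarrow> (\<forall>i<n. c i = 0))"

lemma conv_yser_shift:
  assumes "conv (yser r)" shows "conv (yser (fps_shift n r))"
proof -
  obtain \<rho> C where *: "\<rho> > 0" "\<And>i j. norm (cf (yser r) i j) * \<rho> ^ (i + j) \<le> C"
    using conv_coeffE[OF assms] by metis
  have "norm (cf (yser (fps_shift n r)) i j) * \<rho> ^ (i + j) \<le> C / \<rho> ^ n" for i j
  proof (cases "i = 0")
    case True
    have "norm (fps_nth r (j + n)) * \<rho> ^ j * \<rho> ^ n \<le> C"
      using *(2)[of 0 "j + n"] by (simp add: cf_yser power_add mult_ac)
    then show ?thesis using *(1) True by (simp add: cf_yser pos_le_divide_eq)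
  next
    case False
    have "C \<ge> 0" using *(2)[of 1 0] by (simp add: cf_yser)
    then show ?thesis using *(1) False by (simp add: cf_yser)
  qed
  then show ?thesis using *(1) conv_coeffI by blast
qed

lemma yser_split:
  "yser r = yser (fps_shift n r) * Y2 ^ n + (\<Sum>i<n. cst (fps_nth r i) * Y2 ^ i)"
proof (rule ps2_eqI)
  fix i j
  have "cf (\<Sum>k<n. cst (fps_nth r k) * Y2 ^ k) i j = (\<Sum>k<n. if i = 0 \<and> j = k then fps_nth r k else 0)"
    unfolding fps_sum_nth Y2_power cf_cst_mult cf_yser by (intro sum.cong refl) simp
  also have "\<dots> = (if i = 0 \<and> j < n then fps_nth r j else 0)"
    by (cases "i = 0") (simp_all add: sum.delta)
  finally show "cf (yser r) i j = cf (yser (fps_shift n r) * Y2 ^ n + (\<Sum>i<n. cst (fps_nth r i) * Y2 ^ i)) i j"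
    by (simp add: Y2_power yser_simps(3)[symmetric] cf_yser fps_X_power_mult_right_nth)
qed

lemma poly_Y2: "(\<Sum>i<n. cst (c i) * Y2 ^ i) = yser (\<Sum>i<n. fps_const (c i) * fps_X ^ i)"
  by (induction n) (simp_all add: yser_simps Y2_power)

text \<open>Dividing \<open>g\<close> by \<open>f\<close> leaves \<open>r(y) = u y\<^sup>n\<close> with a unit \<open>u\<close>, so \<open>(f, g) = (f, y\<^sup>n)\<close> in the
  convergent ring. The remainder of any \<open>h\<close> on division by \<open>f\<close> is therefore determined modulo \<open>y\<^sup>n\<close>.\<close>

lemma quotient_basis_regular:
  assumes "isect_num f g n" "conv f" "conv g" "cf f 1 0 \<noteq> 0"
  shows "quotient_basis f g n Y2"
proof -
  have f: "cf f 0 0 = 0" "contact f g n" "\<not> contact f g (Suc n)" using assms(1) by (auto simp: isect_num_def)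
  obtain A0 r where g: "g = A0 * f + yser r" and cA0: "conv A0"
    using weierstrass_division[OF f(1) assms(4)] assms(2,3) by metis
  have "yser r = g - A0 * f" using g by simp
  then have cr: "conv (yser r)" using cA0 assms by auto
  obtain T where T: "ord_ge n (g - T * f)" using f(2) by (auto simp: contact_def)
  have "ord_ge n ((T - A0) * f - yser r)"
    using ord_ge_diff[OF ord_ge_0(2) T] by (simp add: g algebra_simps)
  from vanishing_on_regular_curve[OF f(1) assms(4) this] have r0: "\<forall>j<n. fps_nth r j = 0" .
  have rn: "fps_nth r n \<noteq> 0"
  proof
    assume "fps_nth r n = 0"
    then have "ord_ge (Suc n) (g - A0 * f)" using r0 by (simp add: g ord_ge_yser less_Suc_eq)
    then show False using f(3) by (auto simp: contact_def)
  qed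
  define u where "u = yser (fps_shift n r)"
  have u: "yser r = u * Y2 ^ n" using yser_split[of r n] r0 by (simp add: u_def cst_simps)
  have cu: "conv u" unfolding u_def by (rule conv_yser_shift[OF cr])
  have "cf u 0 0 \<noteq> 0" using rn by (simp add: u_def cf_yser)
  then obtain v where v: "u * v = 1" "conv v" using unit_inverse cu by metis
  have Yn: "Y2 ^ n = v * g - v * A0 * f"
  proof -
    have "v * g - v * A0 * f = v * (u * Y2 ^ n)" by (simp add: g u algebra_simps)
    also have "\<dots> = (u * v) * Y2 ^ n" by (simp only: mult_ac)
    finally show ?thesis by (simp add: v)
  qed
  show ?thesis unfolding quotient_basis_def
  proof (intro conjI allI impI)
    fix h assume h: "conv h"
    obtain Q s where Q: "h = Q * f + yser s" and cQ: "conv Q"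
      using weierstrass_division[OF f(1) assms(4)] assms(2) h by metis
    have "yser s = h - Q * f" using Q by simp
    then have "conv (yser s)" using cQ h assms by auto
    then have cs: "conv (yser (fps_shift n s))" by (rule conv_yser_shift)
    define S where "S = yser (fps_shift n s)"
    have "h = (Q - S * v * A0) * f + (S * v) * g + (\<Sum>i<n. cst (fps_nth s i) * Y2 ^ i)"
      unfolding Q yser_split[of s n] S_def[symmetric] Yn by (simp add: algebra_simps)
    moreover have "conv (Q - S * v * A0)" "conv (S * v)" using cQ cs v cA0 by (auto simp: S_def)
    ultimately show "\<exists>A B c. conv A \<and> conv B \<and> h = A * f + B * g + (\<Sum>i<n. cst (c i) * Y2 ^ i)"
      by (intro exI[of _ "Q - S * v * A0"] exI[of _ "S * v"] exI[of _ "fps_nth s"]) simp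
  next
    fix A B c i assume eq: "(\<Sum>i<n. cst (c i) * Y2 ^ i) = A * f + B * g" and i: "i < n"
    define s where "s = (\<Sum>i<n. fps_const (c i) * fps_X ^ i)"
    have "yser s = (A + B * A0) * f + B * yser r" using eq poly_Y2[of c n] by (simp add: s_def g algebra_simps)
    then have "(A + B * A0) * f - yser s = 0 - B * yser r" by simp
    then have "ord_ge n ((A + B * A0) * f - yser s)"
      using ord_ge_diff[OF ord_ge_0(2) ord_ge_mult_left[of n "yser r" B]] r0 by (simp add: ord_ge_yser)
    from vanishing_on_regular_curve[OF f(1) assms(4) this] have "fps_nth s i = 0" using i by blast
    moreover have "fps_nth s i = c i"
      using i by (simp add: s_def fps_sum_nth sum.delta if_distrib cong: if_cong)
    ultimately show "c i = 0" by simp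
  qed auto
qed

lemma ord_ge_sw [simp]: "ord_ge n (swap2 P) \<longleftrightarrow> ord_ge n P"
  by (auto simp: ord_ge_def add.commute)

lemma contact_sw: "contact f g n \<Longrightarrow> contact (swap2 f) (swap2 g) n"
proof -
  assume "contact f g n"
  then obtain A where "ord_ge n (g - A * f)" by (auto simp: contact_def)
  then have "ord_ge n (swap2 (g - A * f))" by (simp only: ord_ge_sw)
  then show ?thesis by (auto simp: contact_def)
qed

lemma isect_num_sw: "isect_num f g n \<Longrightarrow> isect_num (swap2 f) (swap2 g) n"
  using contact_sw[of "swap2 f" "swap2 g"] contact_sw[of f g n] by (auto simp: isect_num_def)

lemma quotient_basis_sw:
  assumes "quotient_basis (swap2 f) (swap2 g) n \<eta>"
  shows "quotient_basis f g n (swap2 \<eta>)"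
  unfolding quotient_basis_def
proof (intro conjI allI impI)
  show "conv (swap2 \<eta>)" using assms by (simp add: quotient_basis_def)
next
  fix h assume "conv h"
  then obtain A B c where *: "conv A" "conv B"
    "swap2 h = A * swap2 f + B * swap2 g + (\<Sum>i<n. cst (c i) * \<eta> ^ i)"
    using assms conv_sw unfolding quotient_basis_def by metis
  have "h = swap2 A * f + swap2 B * g + (\<Sum>i<n. cst (c i) * swap2 \<eta> ^ i)"
    using arg_cong[OF *(3), of swap2] by simp
  then show "\<exists>A B c. conv A \<and> conv B \<and> h = A * f + B * g + (\<Sum>i<n. cst (c i) * swap2 \<eta> ^ i)"
    using * by (intro exI[of _ "swap2 A"] exI[of _ "swap2 B"] exI[of _ c]) simp
next
  fix A B c i assume eq: "(\<Sum>i<n. cst (c i) * swap2 \<eta> ^ i) = A * f + B * g" and i: "i < n"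
  have "(\<Sum>i<n. cst (c i) * \<eta> ^ i) = swap2 A * swap2 f + swap2 B * swap2 g"
    using arg_cong[OF eq, of swap2] by simp
  then show "c i = 0" using assms i unfolding quotient_basis_def by blast
qed

text \<open>A smooth curve is regular in \<open>x\<close> or in \<open>y\<close>; swapping the variables reduces the second case to the
  first one.\<close>

theorem isect_num_quotient_basis:
  assumes "isect_num f g n" "conv f" "conv g"
  obtains \<eta> where "quotient_basis f g n \<eta>"
proof (cases "cf f 1 0 = 0")
  case False
  then show ?thesis using quotient_basis_regular assms that by blast
next
  case True
  have "cf (swap2 f) 1 0 \<noteq> 0"
  proof
    assume 0: "cf (swap2 f) 1 0 = 0"
    have "ord_ge 2 f" unfolding ord_ge_def
    proof (intro allI impI)
      fix i j :: nat assume "i + j < 2"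
      then consider "i = 0" "j = 0" | "i = 1" "j = 0" | "i = 0" "j = 1" by linarith
      then show "cf f i j = 0" by cases (use True 0 assms(1) in \<open>auto simp: isect_num_def\<close>)
    qed
    then show False using assms(1) by (simp add: isect_num_def)
  qed
  then show ?thesis using quotient_basis_regular[OF isect_num_sw[OF assms(1)]] quotient_basis_sw assms(2,3) that
    by (metis conv_sw)
qed

section \<open>Jets of functions of two real variables\<close>

text \<open>The Landau condition \<open>e(h) = O(|h|\<^sup>N)\<close> as \<open>h\<close> tends to 0, including \<open>h = 0\<close> itself: for \<open>N > 0\<close>
  it forces \<open>e\<close> to vanish there.\<close>

definition bigO :: "nat \<Rightarrow> (real \<times> real \<Rightarrow> 'a::real_normed_vector) \<Rightarrow> bool" where
  "bigO N e \<longleftrightarrow> (\<exists>C. \<forall>\<^sub>F h in nhds 0. norm (e h) \<le> C * norm h ^ N)"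

lemma bigO_E:
  assumes "bigO N e"
  obtains C where "C > 0" "\<forall>\<^sub>F h in nhds 0. norm (e h) \<le> C * norm h ^ N"
proof -
  obtain C where C: "\<forall>\<^sub>F h in nhds 0. norm (e h) \<le> C * norm h ^ N"
    using assms by (auto simp: bigO_def)
  have "\<forall>\<^sub>F h in nhds 0. norm (e h) \<le> max C 1 * norm h ^ N"
    using C by eventually_elim (meson max.cobounded1 mult_right_mono norm_ge_zero order_trans zero_le_power)
  then show ?thesis using that[of "max C 1"] by auto
qed

lemma bigO_add:
  assumes "bigO N e" "bigO N e'" shows "bigO N (\<lambda>h. e h + e' h)"
proof -
  obtain C where C: "\<forall>\<^sub>F h in nhds 0. norm (e h) \<le> C * norm h ^ N" using assms(1) by (auto simp: bigO_def)
  obtain D where D: "\<forall>\<^sub>F h in nhds 0. norm (e' h) \<le> D * norm h ^ N" using assms(2) by (auto simp: bigO_def)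
  have "\<forall>\<^sub>F h in nhds 0. norm (e h + e' h) \<le> (C + D) * norm h ^ N"
    using C D
  proof eventually_elim
    case (elim h)
    then show ?case using norm_triangle_ineq[of "e h" "e' h"] by (simp add: distrib_right)
  qed
  then show ?thesis by (auto simp: bigO_def)
qed

lemma bigO_mult:
  fixes e e' :: "real \<times> real \<Rightarrow> complex"
  assumes "bigO N e" "bigO M e'" shows "bigO (N + M) (\<lambda>h. e h * e' h)"
proof -
  obtain C where C: "C > 0" "\<forall>\<^sub>F h in nhds 0. norm (e h) \<le> C * norm h ^ N" using bigO_E assms(1) by blast
  obtain D where D: "D > 0" "\<forall>\<^sub>F h in nhds 0. norm (e' h) \<le> D * norm h ^ M" using bigO_E assms(2) by blast
  have "\<forall>\<^sub>F h in nhds 0. norm (e h * e' h) \<le> (C * D) * norm h ^ (N + M)"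
    using C(2) D(2)
  proof eventually_elim
    case (elim h)
    have "norm (e h * e' h) \<le> (C * norm h ^ N) * (D * norm h ^ M)"
      unfolding norm_mult by (intro mult_mono elim) (use C(1) in auto)
    then show ?case by (simp add: power_add mult_ac)
  qed
  then show ?thesis by (auto simp: bigO_def)
qed

lemma bigO_mono:
  assumes "bigO N e" "M \<le> N" shows "bigO M e"
proof -
  obtain C where C: "C > 0" "\<forall>\<^sub>F h in nhds 0. norm (e h) \<le> C * norm h ^ N" using bigO_E assms(1) by blast
  have "\<forall>\<^sub>F h::real \<times> real in nhds 0. norm h < 1"
    unfolding eventually_nhds_metric by (intro exI[of _ 1]) auto
  with C(2) have "\<forall>\<^sub>F h in nhds 0. norm (e h) \<le> C * norm h ^ M"
  proof eventually_elim
    case (elim h)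
    have "norm h ^ N \<le> norm h ^ M" using elim assms(2) by (intro power_decreasing) auto
    then show ?case using elim(1) C(1) by (meson mult_left_mono less_imp_le order_trans)
  qed
  then show ?thesis by (auto simp: bigO_def)
qed

lemma bigO_cong:
  assumes "\<forall>\<^sub>F h in nhds 0. e h = e' h" "bigO N e" shows "bigO N e'"
proof -
  obtain C where C: "\<forall>\<^sub>F h in nhds 0. norm (e h) \<le> C * norm h ^ N" using assms(2) by (auto simp: bigO_def)
  from C assms(1) have "\<forall>\<^sub>F h in nhds 0. norm (e' h) \<le> C * norm h ^ N" by eventually_elim simp
  then show ?thesis by (auto simp: bigO_def)
qed

lemma bigO_0: "bigO N (\<lambda>h. 0)"
  by (auto simp: bigO_def intro!: exI[of _ 0])

lemma bigO_const: "bigO 0 (\<lambda>h. c)"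
  by (auto simp: bigO_def intro!: exI[of _ "norm c"])

lemma bigO_cmult: "bigO N e \<Longrightarrow> bigO N (\<lambda>h. c * e h)" for e :: "real \<times> real \<Rightarrow> complex"
  using bigO_mult[OF bigO_const[of c], of N e] by simp

lemma bigO_diff: "bigO N e \<Longrightarrow> bigO N e' \<Longrightarrow> bigO N (\<lambda>h. e h - e' h)" for e :: "real \<times> real \<Rightarrow> complex"
  using bigO_add[of N e "\<lambda>h. (-1) * e' h"] bigO_cmult[of N e' "-1"] by simp

lemma bigO_sum: "(\<And>x. x \<in> S \<Longrightarrow> bigO N (e x)) \<Longrightarrow> bigO N (\<lambda>h. \<Sum>x\<in>S. e x h)"
  by (induction S rule: infinite_finite_induct) (auto intro: bigO_0 bigO_add)

lemma bigO_at_0: "bigO (Suc N) e \<Longrightarrow> e 0 = 0"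
  unfolding bigO_def by (auto dest: eventually_nhds_x_imp_x)

definition mono2 :: "nat \<times> nat \<Rightarrow> real \<times> real \<Rightarrow> complex" where
  "mono2 p h = complex_of_real (fst h) ^ fst p * complex_of_real (snd h) ^ snd p"

lemma bigO_mon: "bigO (fst p + snd p) (mono2 p)"
proof -
  have "norm (mono2 p h) \<le> 1 * norm h ^ (fst p + snd p)" for h
  proof -
    have "norm (mono2 p h) = \<bar>fst h\<bar> ^ fst p * \<bar>snd h\<bar> ^ snd p"
      by (simp add: mono2_def norm_mult norm_power)
    also have "\<dots> \<le> norm h ^ fst p * norm h ^ snd p"
      using norm_fst_le[of "fst h" "snd h"] norm_snd_le[of "snd h" "fst h"]
      by (intro mult_mono power_mono) auto
    finally show ?thesis by (simp add: power_add)
  qed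
  then show ?thesis unfolding bigO_def by (intro exI[of _ 1] always_eventually allI)
qed

lemma bigO_mon_ge: "fst p + snd p \<ge> N \<Longrightarrow> bigO N (\<lambda>h. c * mono2 p h)"
  using bigO_mono[OF bigO_mon] bigO_cmult by blast

lemma mono2_add: "mono2 (fst a + fst b, snd a + snd b) h = mono2 a h * mono2 b h"
  by (simp add: mono2_def power_add mult_ac)

definition degs :: "nat \<Rightarrow> (nat \<times> nat) set" where "degs N = {p. fst p + snd p < N}"

lemma finite_tri [simp]: "finite (degs N)"
  by (rule finite_subset[of _ "{..N} \<times> {..N}"]) (auto simp: degs_def)

definition tpoly :: "nat \<Rightarrow> ps2 \<Rightarrow> real \<times> real \<Rightarrow> complex" where
  "tpoly N P h = (\<Sum>p\<in>degs N. cf P (fst p) (snd p) * mono2 p h)"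

text \<open>The \<open>N\<close>-jet is defined by the quality of approximation and not by derivatives. Products and
  compositions of functions then need no formulas for higher derivatives.\<close>

definition jet :: "nat \<Rightarrow> (real \<times> real \<Rightarrow> complex) \<Rightarrow> real \<times> real \<Rightarrow> ps2 \<Rightarrow> bool" where
  "jet N f q P \<longleftrightarrow> bigO N (\<lambda>h. f (q + h) - tpoly N P h)"

lemma tpoly_add: "tpoly N (P + Q) h = tpoly N P h + tpoly N Q h"
  by (simp add: tpoly_def sum.distrib distrib_right)
lemma tpoly_diff: "tpoly N (P - Q) h = tpoly N P h - tpoly N Q h"
  by (simp add: tpoly_def sum_subtractf left_diff_distrib)

lemma tpoly_ord_ge: "ord_ge N P \<Longrightarrow> tpoly N P h = 0"
  by (auto simp: tpoly_def ord_ge_def degs_def intro!: sum.neutral)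

lemma bigO_tp_diff: "M \<le> N \<Longrightarrow> bigO M (\<lambda>h. tpoly N P h - tpoly M P h)"
proof -
  assume "M \<le> N"
  then have "degs M \<subseteq> degs N" by (auto simp: degs_def)
  then have "tpoly N P h - tpoly M P h = (\<Sum>p\<in>degs N - degs M. cf P (fst p) (snd p) * mono2 p h)" for h
    unfolding tpoly_def by (subst sum_diff) auto
  then show ?thesis by (auto intro!: bigO_sum bigO_mon_ge simp: degs_def)
qed

text \<open>The product of the truncations differs from the truncation of the product only in monomials of
  degree at least \<open>N\<close>.\<close>

lemma bigO_tp_mult: "bigO N (\<lambda>h. tpoly N P h * tpoly N Q h - tpoly N (P * Q) h)"
proof -
  define g where "g = (\<lambda>x h. (cf P (fst (fst x)) (snd (fst x)) * cf Q (fst (snd x)) (snd (snd x))) *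
     mono2 (fst (fst x) + fst (snd x), snd (fst x) + snd (snd x)) h)"
  define T where "T = {x \<in> degs N \<times> degs N. fst (fst x) + fst (snd x) + (snd (fst x) + snd (snd x)) < N}"
  have "tpoly N P h * tpoly N Q h - tpoly N (P * Q) h = (\<Sum>x\<in>degs N \<times> degs N - T. g x h)" for h
  proof -
    have "tpoly N P h * tpoly N Q h = (\<Sum>x\<in>degs N \<times> degs N. g x h)"
      unfolding tpoly_def sum_product sum.cartesian_product g_def mono2_add
      by (intro sum.cong refl) (simp add: case_prod_unfold mult_ac)
    moreover have "tpoly N (P * Q) h = (\<Sum>x\<in>T. g x h)"
    proof -
      have "tpoly N (P * Q) h = (\<Sum>p\<in>degs N. \<Sum>x\<in>{..fst p} \<times> {..snd p}.
          cf P (fst x) (snd x) * cf Q (fst p - fst x) (snd p - snd x) * mono2 p h)"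
        unfolding tpoly_def cf_mult sum_distrib_right sum.cartesian_product
        by (simp add: case_prod_unfold)
      also have "\<dots> = (\<Sum>(p, x)\<in>(SIGMA p:degs N. {..fst p} \<times> {..snd p}).
          cf P (fst x) (snd x) * cf Q (fst p - fst x) (snd p - snd x) * mono2 p h)"
        by (rule sum.Sigma) auto
      also have "\<dots> = (\<Sum>x\<in>T. g x h)"
        by (rule sum.reindex_bij_witness[where
            j = "\<lambda>(p, x). (x, (fst p - fst x, snd p - snd x))" and
            i = "\<lambda>(a, b). ((fst a + fst b, snd a + snd b), a)"])
           (auto simp: T_def g_def degs_def)
      finally show ?thesis .
    qed
    moreover have "T \<subseteq> degs N \<times> degs N" by (auto simp: T_def)
    ultimately show ?thesis by (simp add: sum_diff)
  qed
  moreover have "bigO N (\<lambda>h. \<Sum>x\<in>degs N \<times> degs N - T. g x h)"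
    unfolding g_def by (intro bigO_sum bigO_mon_ge) (auto simp: T_def)
  ultimately show ?thesis by simp
qed

lemma bigO_tp: "bigO 0 (\<lambda>h. tpoly N P h)"
  unfolding tpoly_def by (intro bigO_sum bigO_mon_ge) auto

lemma jet_bigO_0: assumes "jet N f q P" shows "bigO 0 (\<lambda>h. f (q + h))"
  using bigO_add[OF bigO_mono[OF assms[unfolded jet_def], of 0] bigO_tp[of N P]] by simp

lemma jet_add: "jet N f q P \<Longrightarrow> jet N g q Q \<Longrightarrow> jet N (\<lambda>w. f w + g w) q (P + Q)"
  unfolding jet_def tpoly_add using bigO_add by (fastforce simp: algebra_simps)

lemma jet_diff: "jet N f q P \<Longrightarrow> jet N g q Q \<Longrightarrow> jet N (\<lambda>w. f w - g w) q (P - Q)"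
  unfolding jet_def tpoly_diff using bigO_diff by (fastforce simp: algebra_simps)

lemma jet_mult:
  assumes "jet N f q P" "jet N g q Q" shows "jet N (\<lambda>w. f w * g w) q (P * Q)"
proof -
  have 1: "bigO N (\<lambda>h. (f (q + h) - tpoly N P h) * g (q + h))"
    using bigO_mult[OF assms(1)[unfolded jet_def] jet_bigO_0[OF assms(2)]] by simp
  have 2: "bigO N (\<lambda>h. tpoly N P h * (g (q + h) - tpoly N Q h))"
    using bigO_mult[OF bigO_tp[of N P] assms(2)[unfolded jet_def]] by simp
  have "bigO N (\<lambda>h. (f (q + h) - tpoly N P h) * g (q + h) + tpoly N P h * (g (q + h) - tpoly N Q h) +
     (tpoly N P h * tpoly N Q h - tpoly N (P * Q) h))"
    by (intro bigO_add 1 2 bigO_tp_mult)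
  then show ?thesis unfolding jet_def by (simp add: algebra_simps)
qed

lemma jet_mono: "jet N f q P \<Longrightarrow> M \<le> N \<Longrightarrow> jet M f q P"
  unfolding jet_def using bigO_add[OF bigO_mono[of N "\<lambda>h. f (q + h) - tpoly N P h" M] bigO_tp_diff[of M N P]]
  by simp

lemma jet_ord_ge_cong: "jet N f q P \<Longrightarrow> ord_ge N (P - Q) \<Longrightarrow> jet N f q Q"
  unfolding jet_def using tpoly_diff[of N P Q] tpoly_ord_ge[of N "P - Q"] by simp

lemma jet_bigO_cong: "jet N g q P \<Longrightarrow> bigO N (\<lambda>h. f (q + h) - g (q + h)) \<Longrightarrow> jet N f q P"
  unfolding jet_def using bigO_add by fastforce

text \<open>The lowest homogeneous part \<open>H\<close> of degree \<open>d\<close> satisfies \<open>H(t a, t) = t\<^sup>d H(a, 1)\<close>, which is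
  \<open>O(t\<^bsup>d+1\<^esup>)\<close> only if \<open>H(a, 1) = 0\<close>. So \<open>H(\<cdot>, 1)\<close> is a polynomial with infinitely many roots.\<close>

lemma polynomial_bigO:
  assumes "bigO N (tpoly N P)" shows "ord_ge N P"
proof -
  have "d \<le> N \<Longrightarrow> ord_ge d P" for d
  proof (induction d)
    case (Suc d)
    then have d: "d < N" and od: "ord_ge d P" by auto
    define H where "H = (\<lambda>h. \<Sum>i\<le>d. cf P i (d - i) * mono2 (i, d - i) h)"
    have tpd: "tpoly (Suc d) P h = H h" for h
    proof -
      have "tpoly (Suc d) P h = (\<Sum>p\<in>(\<lambda>i. (i, d - i)) ` {..d}. cf P (fst p) (snd p) * mono2 p h)"
        unfolding tpoly_def
      proof (rule sum.mono_neutral_right)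
        show "(\<lambda>i. (i, d - i)) ` {..d} \<subseteq> degs (Suc d)" by (auto simp: degs_def)
        show "\<forall>p\<in>degs (Suc d) - (\<lambda>i. (i, d - i)) ` {..d}. cf P (fst p) (snd p) * mono2 p h = 0"
        proof
          fix p assume p: "p \<in> degs (Suc d) - (\<lambda>i. (i, d - i)) ` {..d}"
          have "fst p + snd p \<noteq> d"
          proof
            assume "fst p + snd p = d"
            then have "p = (\<lambda>i. (i, d - i)) (fst p)" "fst p \<in> {..d}" by (auto simp: prod_eq_iff)
            then show False using p by blast
          qed
          then have "fst p + snd p < d" using p by (auto simp: degs_def)
          then show "cf P (fst p) (snd p) * mono2 p h = 0" using od by (simp add: ord_ge_def)
        qed
      qed simp
      also have "\<dots> = H h" unfolding H_def by (subst sum.reindex) (auto simp: inj_on_def)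
      finally show ?thesis .
    qed
    have "bigO (Suc d) (\<lambda>h. tpoly N P h - (tpoly N P h - tpoly (Suc d) P h))"
      using d by (intro bigO_diff bigO_mono[OF assms] bigO_tp_diff) auto
    then have "bigO (Suc d) H" by (simp add: tpd)
    then obtain C where C: "C > 0" "\<forall>\<^sub>F h in nhds 0. norm (H h) \<le> C * norm h ^ Suc d"
      using bigO_E by blast
    have root: "(\<Sum>i\<le>d. cf P i (d - i) * complex_of_real a ^ i) = 0" for a
    proof -
      define z where "z = (\<Sum>i\<le>d. cf P i (d - i) * complex_of_real a ^ i)"
      define n where "n = norm (a, 1::real)"
      have Ht: "H (t * a, t) = of_real t ^ d * z" for t
        unfolding H_def z_def sum_distrib_left
      proof (intro sum.cong refl)
        fix i assume "i \<in> {..d}"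
        then have "complex_of_real t ^ d = of_real t ^ i * of_real t ^ (d - i)"
          by (simp add: power_add[symmetric])
        then show "cf P i (d - i) * mono2 (i, d - i) (t * a, t) =
           complex_of_real t ^ d * (cf P i (d - i) * complex_of_real a ^ i)"
          by (simp add: mono2_def power_mult_distrib mult_ac)
      qed
      have "((\<lambda>t::real. (t * a, t)) \<longlongrightarrow> (0 * a, 0)) (at_right 0)"
        by (intro tendsto_Pair tendsto_mult tendsto_const tendsto_ident_at)
      then have "filterlim (\<lambda>t::real. (t * a, t)) (nhds 0) (at_right 0)" by (simp add: zero_prod_def)
      then have "\<forall>\<^sub>F t in at_right 0. norm (H (t * a, t)) \<le> C * norm (t * a, t) ^ Suc d"
        using C(2) by (auto simp: filterlim_iff)
      moreover have "\<forall>\<^sub>F t::real in at_right 0. t > 0"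
        by (rule eventually_at_right_less)
      ultimately have ev: "\<forall>\<^sub>F t::real in at_right 0. norm z \<le> t * (C * n ^ Suc d)"
      proof eventually_elim
        case (elim t)
        have "(t * a, t) = t *\<^sub>R (a, 1)" by simp
        then have "norm (t * a, t) = norm (t *\<^sub>R (a, 1::real))" by (rule arg_cong)
        then have "norm (t * a, t) = t * n" using elim(2) unfolding n_def norm_scaleR by simp
        then have "t ^ d * norm z \<le> C * (t * n) ^ Suc d"
          using elim by (simp add: Ht norm_mult norm_power)
        also have "\<dots> = t ^ d * (t * (C * n ^ Suc d))" by (simp add: power_mult_distrib)
        finally show ?case using elim(2) by (simp add: mult_le_cancel_left)
      qed
      have lim: "((\<lambda>t::real. t * (C * n ^ Suc d)) \<longlongrightarrow> 0 * (C * n ^ Suc d)) (at_right 0)"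
        by (intro tendsto_intros)
      have "norm z \<le> 0 * (C * n ^ Suc d)"
        using tendsto_lowerbound[OF lim ev] by simp
      then show ?thesis by (simp add: z_def)
    qed
    have "infinite {x. (\<Sum>i\<le>d. cf P i (d - i) * x ^ i) = 0}"
    proof (rule infinite_super)
      show "complex_of_real ` UNIV \<subseteq> {x. (\<Sum>i\<le>d. cf P i (d - i) * x ^ i) = 0}" using root by auto
      show "infinite (range complex_of_real)"
        by (simp add: finite_image_iff inj_on_def infinite_UNIV_char_0)
    qed
    then have "\<forall>i\<le>d. cf P i (d - i) = 0"
      using polyfun_finite_roots[of "\<lambda>i. cf P i (d - i)" d] by auto
    then show ?case using od unfolding ord_ge_def
      by (metis add_diff_cancel_left' le_add1 less_Suc_eq)
  qed simp
  then show ?thesis by blast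
qed

lemma jet_bigO_iff: "jet N f q P \<Longrightarrow> bigO N (\<lambda>h. f (q + h)) \<longleftrightarrow> ord_ge N P"
proof
  assume *: "jet N f q P" "bigO N (\<lambda>h. f (q + h))"
  then have "bigO N (tpoly N P)" using bigO_diff[OF *(2) *(1)[unfolded jet_def]] by simp
  then show "ord_ge N P" by (rule polynomial_bigO)
next
  assume *: "jet N f q P" "ord_ge N P"
  then show "bigO N (\<lambda>h. f (q + h))" by (simp add: jet_def tpoly_ord_ge)
qed

definition taylor :: "(real \<times> real \<Rightarrow> complex) \<Rightarrow> real \<times> real \<Rightarrow> ps2 \<Rightarrow> bool" where
  "taylor f q P \<longleftrightarrow> (\<forall>N. jet N f q P)"

lemma taylor_add: "taylor f q P \<Longrightarrow> taylor g q Q \<Longrightarrow> taylor (\<lambda>w. f w + g w) q (P + Q)"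
  and taylor_diff: "taylor f q P \<Longrightarrow> taylor g q Q \<Longrightarrow> taylor (\<lambda>w. f w - g w) q (P - Q)"
  and taylor_mult: "taylor f q P \<Longrightarrow> taylor g q Q \<Longrightarrow> taylor (\<lambda>w. f w * g w) q (P * Q)"
  by (simp_all add: taylor_def jet_add jet_diff jet_mult)

lemma taylor_bigO: "taylor f q P \<Longrightarrow> bigO N (\<lambda>h. f (q + h)) \<longleftrightarrow> ord_ge N P"
  using jet_bigO_iff taylor_def by blast

lemma jet_unique: "jet N f q P \<Longrightarrow> jet N f q Q \<Longrightarrow> ord_ge N (P - Q)"
  using jet_diff[of N f q P f Q] jet_bigO_iff[of N "\<lambda>w. f w - f w" q "P - Q"] by (simp add: bigO_0)

lemma taylor_unique:
  assumes "taylor f q P" "taylor f q Q" shows "P = Q"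
proof (rule ps2_eqI)
  fix i j
  have "ord_ge (Suc (i + j)) (P - Q)" using assms jet_unique unfolding taylor_def by blast
  then have "cf (P - Q) i j = 0" unfolding ord_ge_def by blast
  then show "cf P i j = cf Q i j" by simp
qed

lemma jet_cong:
  assumes "\<forall>\<^sub>F w in nhds q. f w = g w" "jet N f q P" shows "jet N g q P"
proof -
  have "filterlim (\<lambda>h. q + h) (nhds (q + 0)) (nhds 0)"
    using isCont_def by (intro tendsto_intros filterlim_ident)
  then have "\<forall>\<^sub>F h in nhds 0. f (q + h) = g (q + h)" using assms(1) by (auto simp: filterlim_iff)
  then have "\<forall>\<^sub>F h in nhds 0. f (q + h) - tpoly N P h = g (q + h) - tpoly N P h" by eventually_elim simp
  from bigO_cong[OF this] show ?thesis using assms(2) by (simp add: jet_def)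
qed

lemma taylor_cong: "\<forall>\<^sub>F w in nhds q. f w = g w \<Longrightarrow> taylor f q P \<Longrightarrow> taylor g q P"
  unfolding taylor_def using jet_cong by blast

lemma jets_imp_taylor:
  assumes "\<And>N. \<exists>P. jet N f q P"
  obtains P where "taylor f q P"
proof -
  obtain P where P: "\<And>N. jet N f q (P N)" using assms by metis
  define R where "R = mk2 (\<lambda>i j. cf (P (Suc (i + j))) i j)"
  have "jet N f q R" for N
  proof (rule jet_ord_ge_cong[OF P[of N]], unfold ord_ge_def, intro allI impI)
    fix i j assume ij: "i + j < N"
    have "ord_ge (Suc (i + j)) (P N - P (Suc (i + j)))"
      using ij by (intro jet_unique[OF jet_mono[OF P] P]) auto
    then have "cf (P N - P (Suc (i + j))) i j = 0" unfolding ord_ge_def by blast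
    then show "cf (P N - R) i j = 0" by (simp add: R_def)
  qed
  then show ?thesis using that by (auto simp: taylor_def)
qed

lemma taylor_finite:
  assumes "\<And>h. f (q + h) = tpoly M P h" "\<And>i j. i + j \<ge> M \<Longrightarrow> cf P i j = 0"
  shows "taylor f q P"
  unfolding taylor_def jet_def
proof
  fix N
  have "tpoly N P h = tpoly M P h" if "N \<ge> M" for h
    unfolding tpoly_def by (rule sum.mono_neutral_right[OF finite_tri]) (use that assms(2) in \<open>auto simp: degs_def\<close>)
  then show "bigO N (\<lambda>h. f (q + h) - tpoly N P h)"
    using bigO_tp_diff[of N M P] by (cases "N \<ge> M") (auto simp: assms(1) bigO_0)
qed

lemma degs_2: "degs 2 = {(0, 0), (1, 0), (0, 1)}" "degs 1 = {(0, 0)}" "degs (Suc 0) = {(0, 0)}"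
  by (auto simp: degs_def)

lemma taylor_const: "taylor (\<lambda>w. c) q (cst c)"
  by (rule taylor_finite[of _ _ 1]) (auto simp: tpoly_def degs_2 mono2_def cf_cst)

lemma taylor_fst: "taylor (\<lambda>w. complex_of_real (fst w)) q (cst (fst q) + X2)"
  by (rule taylor_finite[of _ _ 2]) (auto simp: tpoly_def degs_2 mono2_def cf_cst)

lemma taylor_snd: "taylor (\<lambda>w. complex_of_real (snd w)) q (cst (snd q) + Y2)"
  by (rule taylor_finite[of _ _ 2]) (auto simp: tpoly_def degs_2 mono2_def cf_cst cf_Y2)

definition has_taylor :: "(real \<times> real \<Rightarrow> complex) \<Rightarrow> real \<times> real \<Rightarrow> bool" where
  "has_taylor f q \<longleftrightarrow> (\<exists>P. taylor f q P)"

lemma has_taylor_const [intro]: "has_taylor (\<lambda>w. c) q"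
  and has_taylor_fst [intro]: "has_taylor (\<lambda>w. complex_of_real (fst w)) q"
  and has_taylor_snd [intro]: "has_taylor (\<lambda>w. complex_of_real (snd w)) q"
  unfolding has_taylor_def using taylor_const taylor_fst taylor_snd by blast+

lemma has_taylor_add [intro]: "has_taylor f q \<Longrightarrow> has_taylor g q \<Longrightarrow> has_taylor (\<lambda>w. f w + g w) q"
  and has_taylor_diff [intro]: "has_taylor f q \<Longrightarrow> has_taylor g q \<Longrightarrow> has_taylor (\<lambda>w. f w - g w) q"
  and has_taylor_mult [intro]: "has_taylor f q \<Longrightarrow> has_taylor g q \<Longrightarrow> has_taylor (\<lambda>w. f w * g w) q"
  unfolding has_taylor_def using taylor_add taylor_diff taylor_mult by blast+

lemma has_taylor_power [intro]: "has_taylor f q \<Longrightarrow> has_taylor (\<lambda>w. f w ^ n) q"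
  by (induction n) auto

lemma has_taylor_sum [intro]: "(\<And>x. x \<in> S \<Longrightarrow> has_taylor (f x) q) \<Longrightarrow> has_taylor (\<lambda>w. \<Sum>x\<in>S. f x w) q"
  by (induction S rule: infinite_finite_induct) auto

section \<open>Composition with smooth maps\<close>

text \<open>The only consequence of smoothness that the transport of intersection numbers uses.\<close>

definition taylor_map :: "(real \<times> real \<Rightarrow> real \<times> real) \<Rightarrow> real \<times> real \<Rightarrow> bool" where
  "taylor_map \<phi> p \<longleftrightarrow> has_taylor (\<lambda>w. of_real (fst (\<phi> w))) p \<and> has_taylor (\<lambda>w. of_real (snd (\<phi> w))) p"

lemma taylor_bigO_1:
  assumes "has_taylor f p" shows "bigO 1 (\<lambda>h. f (p + h) - f p)"
proof -
  obtain P where "jet 1 f p P" using assms by (auto simp: has_taylor_def taylor_def)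
  then have 1: "bigO 1 (\<lambda>h. f (p + h) - cf P 0 0)"
    by (simp add: jet_def tpoly_def degs_2 mono2_def)
  then have "f p = cf P 0 0" using bigO_at_0[of 0 "\<lambda>h. f (p + h) - cf P 0 0"] by simp
  then show ?thesis using 1 by simp
qed

lemma taylor_map_bigO:
  assumes "taylor_map \<phi> p" shows "bigO 1 (\<lambda>h. \<phi> (p + h) - \<phi> p)"
proof -
  obtain C where C: "\<forall>\<^sub>F h in nhds 0. norm (complex_of_real (fst (\<phi> (p + h))) - of_real (fst (\<phi> p))) \<le> C * norm h ^ 1"
    using taylor_bigO_1[of "\<lambda>w. of_real (fst (\<phi> w))" p] assms by (auto simp: taylor_map_def bigO_def)
  obtain D where D: "\<forall>\<^sub>F h in nhds 0. norm (complex_of_real (snd (\<phi> (p + h))) - of_real (snd (\<phi> p))) \<le> D * norm h ^ 1"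
    using taylor_bigO_1[of "\<lambda>w. of_real (snd (\<phi> w))" p] assms by (auto simp: taylor_map_def bigO_def)
  have "\<forall>\<^sub>F h in nhds 0. norm (\<phi> (p + h) - \<phi> p) \<le> (C + D) * norm h ^ 1"
    using C D
  proof eventually_elim
    case (elim h)
    have "norm (\<phi> (p + h) - \<phi> p) \<le> \<bar>fst (\<phi> (p + h) - \<phi> p)\<bar> + \<bar>snd (\<phi> (p + h) - \<phi> p)\<bar>"
      unfolding norm_prod_def real_norm_def power2_abs by (rule sqrt_sum_squares_le_sum_abs)
    then show ?case using elim by (simp add: distrib_right flip: of_real_diff)
  qed
  then show ?thesis by (auto simp: bigO_def)
qed

lemma bigO_compose:
  assumes "bigO N e" "taylor_map \<phi> p" shows "bigO N (\<lambda>h. e (\<phi> (p + h) - \<phi> p))"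
proof -
  obtain C where C: "C > 0" "\<forall>\<^sub>F h in nhds 0. norm (e h) \<le> C * norm h ^ N" using bigO_E assms(1) by blast
  obtain D where D: "D > 0" "\<forall>\<^sub>F h in nhds 0. norm (\<phi> (p + h) - \<phi> p) \<le> D * norm h ^ 1"
    using bigO_E[OF taylor_map_bigO[OF assms(2)]] by blast
  have "((\<lambda>h::real \<times> real. D * norm h ^ 1) \<longlongrightarrow> D * norm (0 :: real \<times> real) ^ 1) (nhds 0)"
    by (intro tendsto_mult tendsto_const tendsto_power tendsto_norm filterlim_ident)
  then have lim: "((\<lambda>h::real \<times> real. D * norm h ^ 1) \<longlongrightarrow> 0) (nhds 0)" by simp
  have "((\<lambda>h. \<phi> (p + h) - \<phi> p) \<longlongrightarrow> 0) (nhds 0)"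
    by (rule Lim_null_comparison[OF D(2) lim])
  then have "\<forall>\<^sub>F h in nhds 0. norm (e (\<phi> (p + h) - \<phi> p)) \<le> C * norm (\<phi> (p + h) - \<phi> p) ^ N"
    using C(2) by (auto simp: filterlim_iff)
  with D(2) have "\<forall>\<^sub>F h in nhds 0. norm (e (\<phi> (p + h) - \<phi> p)) \<le> (C * D ^ N) * norm h ^ N"
  proof eventually_elim
    case (elim h)
    have "norm (\<phi> (p + h) - \<phi> p) ^ N \<le> (D * norm h) ^ N" using elim(1) by (intro power_mono) auto
    then have "C * norm (\<phi> (p + h) - \<phi> p) ^ N \<le> C * (D * norm h) ^ N" using C(1) by (intro mult_left_mono) auto
    then show ?case using elim(2) by (simp add: power_mult_distrib mult_ac)
  qed
  then show ?thesis by (auto simp: bigO_def)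
qed

text \<open>For each \<open>N\<close> the Taylor polynomial of \<open>f\<close> composed with \<open>\<phi>\<close> is a polynomial in functions that have Taylor
  series, and the remainder stays \<open>O(|h|\<^sup>N)\<close>. The jets of different orders are compatible because jets are unique.\<close>

lemma has_taylor_compose:
  assumes f: "has_taylor f (\<phi> p)" and \<phi>: "taylor_map \<phi> p"
  shows "has_taylor (\<lambda>w. f (\<phi> w)) p"
proof -
  obtain P where P: "taylor f (\<phi> p) P" using f by (auto simp: has_taylor_def)
  have "\<exists>R. jet N (\<lambda>w. f (\<phi> w)) p R" for N
  proof -
    have "has_taylor (\<lambda>w. tpoly N P (\<phi> w - \<phi> p)) p"
      unfolding tpoly_def mono2_def fst_diff snd_diff of_real_diff
      by (intro has_taylor_sum has_taylor_mult has_taylor_power has_taylor_diff has_taylor_const)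
         (use \<phi> in \<open>auto simp: taylor_map_def\<close>)
    then obtain R where "taylor (\<lambda>w. tpoly N P (\<phi> w - \<phi> p)) p R" by (auto simp: has_taylor_def)
    then have R: "jet N (\<lambda>w. tpoly N P (\<phi> w - \<phi> p)) p R" by (simp add: taylor_def)
    have "bigO N (\<lambda>h. f (\<phi> p + h) - tpoly N P h)" using P by (simp add: taylor_def jet_def)
    from bigO_compose[OF this \<phi>] have "jet N (\<lambda>w. f (\<phi> w)) p R"
      by (intro jet_bigO_cong[OF R]) simp
    then show ?thesis ..
  qed
  then show ?thesis using jets_imp_taylor[of "\<lambda>w. f (\<phi> w)" p] unfolding has_taylor_def by blast
qed

text \<open>Contact expressed by functions instead of series. The multiplier may be any function with a Taylor series,
  which makes the condition stable under composition.\<close>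

lemma contact_iff_bigO:
  assumes "taylor f q F" "taylor g q G"
  shows "contact F G n \<longleftrightarrow> (\<exists>a. has_taylor a q \<and> bigO n (\<lambda>h. g (q + h) - a (q + h) * f (q + h)))"
proof
  assume "contact F G n"
  then obtain A where A: "ord_ge n (G - A * F)" by (auto simp: contact_def)
  define a where "a = (\<lambda>w. tpoly n A (w - q))"
  have "has_taylor a q" unfolding a_def tpoly_def mono2_def fst_diff snd_diff of_real_diff
    by (intro has_taylor_sum has_taylor_mult has_taylor_power has_taylor_diff) auto
  moreover have "jet n a q A" unfolding jet_def a_def by (simp add: bigO_0)
  then have "jet n (\<lambda>w. g w - a w * f w) q (G - A * F)"
    using assms by (intro jet_diff jet_mult) (auto simp: taylor_def)
  from jet_bigO_iff[OF this] have "bigO n (\<lambda>h. g (q + h) - a (q + h) * f (q + h))" using A by simp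
  ultimately show "\<exists>a. has_taylor a q \<and> bigO n (\<lambda>h. g (q + h) - a (q + h) * f (q + h))" by blast
next
  assume "\<exists>a. has_taylor a q \<and> bigO n (\<lambda>h. g (q + h) - a (q + h) * f (q + h))"
  then obtain a A where a: "taylor a q A" "bigO n (\<lambda>h. g (q + h) - a (q + h) * f (q + h))"
    by (auto simp: has_taylor_def)
  have "taylor (\<lambda>w. g w - a w * f w) q (G - A * F)" using assms a(1) by (intro taylor_diff taylor_mult)
  from taylor_bigO[OF this, of n] have "ord_ge n (G - A * F)" using a(2) by simp
  then show "contact F G n" by (auto simp: contact_def)
qed

lemma contact_compose:
  assumes \<phi>: "taylor_map \<phi> p"
    and "taylor f (\<phi> p) F" "taylor g (\<phi> p) G"
    and "taylor (\<lambda>w. f (\<phi> w)) p F'" "taylor (\<lambda>w. g (\<phi> w)) p G'"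
    and "contact F G n"
  shows "contact F' G' n"
proof -
  obtain a where a: "has_taylor a (\<phi> p)" "bigO n (\<lambda>h. g (\<phi> p + h) - a (\<phi> p + h) * f (\<phi> p + h))"
    using contact_iff_bigO[OF assms(2,3), of n] assms(6) by auto
  have "has_taylor (\<lambda>w. a (\<phi> w)) p" by (rule has_taylor_compose[OF a(1) \<phi>])
  moreover from bigO_compose[OF a(2) \<phi>]
  have "bigO n (\<lambda>h. g (\<phi> (p + h)) - a (\<phi> (p + h)) * f (\<phi> (p + h)))" by simp
  ultimately show ?thesis unfolding contact_iff_bigO[OF assms(4,5)]
    by (intro exI[of _ "\<lambda>w. a (\<phi> w)"] conjI)
qed

lemma ord_ge_compose:
  assumes \<phi>: "taylor_map \<phi> p" and "taylor f (\<phi> p) F" "taylor (\<lambda>w. f (\<phi> w)) p F'" "ord_ge n F"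
  shows "ord_ge n F'"
  using bigO_compose[of n "\<lambda>h. f (\<phi> p + h)", OF _ \<phi>] taylor_bigO[OF assms(2)] taylor_bigO[OF assms(3)] assms(4)
  by simp

lemma taylor_00: "taylor f q F \<Longrightarrow> cf F 0 0 = f q"
proof -
  assume "taylor f q F"
  then have "bigO (Suc 0) (\<lambda>h. f (q + h) - tpoly 1 F h)" by (simp add: taylor_def jet_def)
  from bigO_at_0[OF this] show ?thesis by (simp add: tpoly_def degs_2 mono2_def)
qed

text \<open>Contact of order \<open>n\<close> passes from \<open>F'\<close>, \<open>G'\<close> to \<open>F\<close>, \<open>G\<close> by composition with \<open>\<psi>\<close>, and contact of order
  \<open>n + 1\<close> would pass back by composition with \<open>\<phi>\<close>.\<close>

lemma isect_num_transport:
  assumes \<phi>: "taylor_map \<phi> p" "\<phi> p = q" and \<psi>: "taylor_map \<psi> q" "\<psi> q = p"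
    and inv: "\<forall>\<^sub>F w in nhds q. \<phi> (\<psi> w) = w"
    and f: "taylor f q F" and g: "taylor g q G"
    and f': "taylor (\<lambda>w. f (\<phi> w)) p F'" and g': "taylor (\<lambda>w. g (\<phi> w)) p G'"
    and n: "isect_num F' G' n"
  shows "isect_num F G n"
proof -
  have f'': "taylor (\<lambda>w. f (\<phi> (\<psi> w))) q F"
    using inv by (intro taylor_cong[OF _ f]) (auto elim!: eventually_mono)
  have g'': "taylor (\<lambda>w. g (\<phi> (\<psi> w))) q G"
    using inv by (intro taylor_cong[OF _ g]) (auto elim!: eventually_mono)
  have "contact F G n"
    using contact_compose[OF \<psi>(1), of "\<lambda>w. f (\<phi> w)" F' "\<lambda>w. g (\<phi> w)" G' F G n] \<psi>(2) f' g' f'' g'' n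
    by (simp add: isect_num_def)
  moreover have "\<not> contact F G (Suc n)"
    using contact_compose[OF \<phi>(1), of f F g G F' G' "Suc n"] \<phi>(2) f g f' g' n by (auto simp: isect_num_def)
  moreover have "\<not> ord_ge 2 F"
    using ord_ge_compose[OF \<phi>(1), of f F F' 2] \<phi>(2) f f' n by (auto simp: isect_num_def)
  moreover have "cf F 0 0 = 0"
    using taylor_00[OF f] taylor_00[OF f'] \<phi>(2) n by (simp add: isect_num_def)
  ultimately show ?thesis by (simp add: isect_num_def)
qed

section \<open>Taylor expansion of smooth maps\<close>

text \<open>Taylor's theorem by induction along rays: the jets of the partial derivatives, integrated over
  \<open>t\<close> in \<open>f(q + t h)\<close>, give a polynomial \<open>G\<close> whose derivative along the ray matches that of \<open>f\<close> up to
  \<open>O(|h|\<^bsup>n+1\<^esup>)\<close>. The bounded linear map \<open>L\<close> extracts the components of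
  \<open>f\<close>; keeping it outside the derivatives lets the induction run over \<open>f\<close> alone.\<close>

lemma Cn_on_jet:
  fixes f :: "real \<times> real \<Rightarrow> 'a::real_normed_vector"
  assumes S: "open S" "q \<in> S" and L: "bounded_linear (L :: 'a \<Rightarrow> complex)" and "Cn_on n S f"
  shows "\<exists>P. jet n (\<lambda>w. L (f w)) q P"
  using assms(4)
proof (induction n arbitrary: f)
  case 0
  then have "continuous_on S (\<lambda>w. L (f w))"
    using bounded_linear.continuous_on[OF L] by auto
  then have "isCont (\<lambda>w. L (f w)) q" using S continuous_on_eq_continuous_at by blast
  then have "(\<lambda>w. L (f w)) \<midarrow>q\<rightarrow> L (f q)" by (simp add: isCont_def)
  then have "filterlim (\<lambda>w. L (f w)) (nhds (L (f q))) (nhds q)"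
    by (rule tendsto_at_iff_tendsto_nhds[of "\<lambda>w. L (f w)" q, THEN iffD1])
  moreover have "filterlim (\<lambda>h. q + h) (nhds (q + 0)) (nhds 0)" by (intro tendsto_intros filterlim_ident)
  ultimately have "((\<lambda>h. L (f (q + h))) \<longlongrightarrow> L (f q)) (nhds 0)"
    using filterlim_compose[of "\<lambda>w. L (f w)" "nhds (L (f q))" "nhds q" "\<lambda>h. q + h" "nhds 0"] by simp
  then have "((\<lambda>h. norm (L (f (q + h)))) \<longlongrightarrow> norm (L (f q))) (nhds 0)" by (rule tendsto_norm)
  then have "\<forall>\<^sub>F h in nhds 0. norm (L (f (q + h))) < norm (L (f q)) + 1"
    by (rule order_tendstoD) simp
  then have "\<forall>\<^sub>F h in nhds 0. norm (L (f (q + h)) - tpoly 0 0 h) \<le> (norm (L (f q)) + 1) * norm h ^ 0"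
    by eventually_elim (simp add: tpoly_def degs_def)
  then show ?case unfolding jet_def bigO_def by blast
next
  case (Suc n)
  have Cn: "f differentiable_on S" "Cn_on n S (pdu f)" "Cn_on n S (pdv f)"
    using Suc.prems by simp_all
  obtain A where A: "jet n (\<lambda>w. L (pdu f w)) q A" using Suc.IH[OF Cn(2)] by blast
  obtain B where B: "jet n (\<lambda>w. L (pdv f w)) q B" using Suc.IH[OF Cn(3)] by blast
  have df: "f differentiable (at w)" if "w \<in> S" for w
    using Cn(1) that S(1) unfolding differentiable_on_def by (metis at_within_open)
  define c where "c = (\<lambda>p. complex_of_real (1 / real (fst p + snd p + 1)))"
  \<comment> \<open>\<open>G\<close> is the integral over the ray of the Taylor polynomials of the derivative of \<open>L \<circ> f\<close> in direction \<open>h\<close>.\<close>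
  define a where "a = (\<lambda>p h. (cf A (fst p) (snd p) * complex_of_real (fst h) +
      cf B (fst p) (snd p) * complex_of_real (snd h)) * mono2 p h)"
  define G where "G = (\<lambda>h. L (f q) + (\<Sum>p\<in>degs n. c p * a p h))"
  have "has_taylor (\<lambda>w. G (w - q)) q"
    unfolding G_def a_def mono2_def fst_diff snd_diff of_real_diff
    by (intro has_taylor_sum has_taylor_add has_taylor_mult has_taylor_power has_taylor_diff) auto
  then obtain P where P: "taylor (\<lambda>w. G (w - q)) q P" by (auto simp: has_taylor_def)
  obtain CA where CA: "CA > 0" "\<forall>\<^sub>F h in nhds 0. norm (L (pdu f (q + h)) - tpoly n A h) \<le> CA * norm h ^ n"
    using bigO_E[OF A[unfolded jet_def]] by blast
  obtain CB where CB: "CB > 0" "\<forall>\<^sub>F h in nhds 0. norm (L (pdv f (q + h)) - tpoly n B h) \<le> CB * norm h ^ n"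
    using bigO_E[OF B[unfolded jet_def]] by blast
  have "filterlim (\<lambda>h. q + h) (nhds (q + 0)) (nhds 0)" by (intro tendsto_intros filterlim_ident)
  moreover have "\<forall>\<^sub>F w in nhds (q + 0). w \<in> S" using S by (simp add: eventually_nhds_in_open)
  ultimately have "\<forall>\<^sub>F h in nhds 0. q + h \<in> S" by (auto simp: filterlim_iff)
  with CA(2) CB(2) have "\<forall>\<^sub>F h in nhds 0. norm (L (pdu f (q + h)) - tpoly n A h) \<le> CA * norm h ^ n \<and>
      norm (L (pdv f (q + h)) - tpoly n B h) \<le> CB * norm h ^ n \<and> q + h \<in> S"
    by eventually_elim simp
  then obtain d where d: "d > 0" "\<And>h. norm h < d \<Longrightarrow> norm (L (pdu f (q + h)) - tpoly n A h) \<le> CA * norm h ^ n"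
     "\<And>h. norm h < d \<Longrightarrow> norm (L (pdv f (q + h)) - tpoly n B h) \<le> CB * norm h ^ n"
     "\<And>h. norm h < d \<Longrightarrow> q + h \<in> S"
    unfolding eventually_nhds_metric by (auto simp: dist_norm)
  have main: "norm (L (f (q + h)) - G h) \<le> (CA + CB) * norm h ^ Suc n" if h: "norm h < d" for h
  proof -
    define D where "D = (\<lambda>t::real. of_real (fst h) * (L (pdu f (q + t *\<^sub>R h)) - tpoly n A (t *\<^sub>R h)) +
        of_real (snd h) * (L (pdv f (q + t *\<^sub>R h)) - tpoly n B (t *\<^sub>R h)))"
    define r where "r = (\<lambda>t::real. L (f (q + t *\<^sub>R h)) - G (t *\<^sub>R h))"
    have nth: "norm (t *\<^sub>R h) \<le> norm h" if "t \<in> {0..1}" for t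
      using that by (simp add: mult_left_le_one_le)
    have der: "(r has_vector_derivative D t) (at t)" if t: "t \<in> {0..1}" for t
    proof -
      define w where "w = q + t *\<^sub>R h"
      have "w \<in> S" using d(4) nth[OF t] h by (auto simp: w_def)
      then obtain T where T: "(f has_derivative T) (at w)" using df unfolding differentiable_def by blast
      have lin: "bounded_linear T" using T by (rule has_derivative_bounded_linear)
      have pu: "pdu f w = T (1, 0)"
      proof -
        have d: "((\<lambda>s. (s, snd w)) has_derivative (\<lambda>s. (s, 0))) (at (fst w))"
          by (intro has_derivative_Pair has_derivative_ident has_derivative_const)
        have "((\<lambda>s. f (s, snd w)) has_derivative (\<lambda>s. T (s, 0))) (at (fst w))"
          by (rule has_derivative_compose[OF d]) (simp add: T)
        then have "((\<lambda>s. f (s, snd w)) has_vector_derivative T (1, 0)) (at (fst w))"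
        proof -
          have "T (s, 0) = s *\<^sub>R T (1, 0)" for s
            using linear_simps(5)[OF lin, of s "(1, 0)"] unfolding scaleR_Pair by simp
          then have "(\<lambda>s. T (s, 0)) = (\<lambda>s. s *\<^sub>R T (1, 0))" by blast
          then show "((\<lambda>s. f (s, snd w)) has_derivative (\<lambda>s. T (s, 0))) (at (fst w)) \<Longrightarrow> ?thesis"
            unfolding has_vector_derivative_def by (simp only:)
        qed
        then show ?thesis by (simp add: pdu_def case_prod_unfold vector_derivative_at)
      qed
      have pv: "pdv f w = T (0, 1)"
      proof -
        have d: "((\<lambda>s. (fst w, s)) has_derivative (\<lambda>s. (0, s))) (at (snd w))"
          by (intro has_derivative_Pair has_derivative_ident has_derivative_const)
        have "((\<lambda>s. f (fst w, s)) has_derivative (\<lambda>s. T (0, s))) (at (snd w))"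
          by (rule has_derivative_compose[OF d]) (simp add: T)
        then have "((\<lambda>s. f (fst w, s)) has_vector_derivative T (0, 1)) (at (snd w))"
        proof -
          have "T (0, s) = s *\<^sub>R T (0, 1)" for s
            using linear_simps(5)[OF lin, of s "(0, 1)"] unfolding scaleR_Pair by simp
          then have "(\<lambda>s. T (0, s)) = (\<lambda>s. s *\<^sub>R T (0, 1))" by blast
          then show "((\<lambda>s. f (fst w, s)) has_derivative (\<lambda>s. T (0, s))) (at (snd w)) \<Longrightarrow> ?thesis"
            unfolding has_vector_derivative_def by (simp only:)
        qed
        then show ?thesis by (simp add: pdv_def case_prod_unfold vector_derivative_at)
      qed
      have "h = fst h *\<^sub>R (1, 0) + snd h *\<^sub>R (0, 1)" by (simp add: prod_eq_iff)
      then have Th: "T h = fst h *\<^sub>R pdu f w + snd h *\<^sub>R pdv f w"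
        unfolding pu pv using linear_simps(1,5)[OF lin] by metis
      have d: "((\<lambda>t. q + t *\<^sub>R h) has_derivative (\<lambda>s. s *\<^sub>R h)) (at t)"
        by (auto intro!: derivative_eq_intros)
      have "((\<lambda>t. f (q + t *\<^sub>R h)) has_derivative (\<lambda>s. T (s *\<^sub>R h))) (at t)"
        by (rule has_derivative_compose[OF d]) (rule T[unfolded w_def])
      from bounded_linear.has_derivative[OF L this]
      have "((\<lambda>t. L (f (q + t *\<^sub>R h))) has_vector_derivative L (T h)) (at t)"
        unfolding has_vector_derivative_def linear_simps(5)[OF lin] linear_simps(5)[OF L] .
      also have "L (T h) = of_real (fst h) * L (pdu f w) + of_real (snd h) * L (pdv f w)"
        unfolding Th using linear_simps(1,5)[OF L] by (simp add: scaleR_conv_of_real)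
      finally have 1: "((\<lambda>t. L (f (q + t *\<^sub>R h))) has_vector_derivative
         of_real (fst h) * L (pdu f w) + of_real (snd h) * L (pdv f w)) (at t)" .
      have as: "c p * a p (t *\<^sub>R h) = of_real (t ^ (fst p + snd p + 1) / real (fst p + snd p + 1)) * a p h" for p t
        by (simp add: c_def a_def mono2_def power_mult_distrib power_add algebra_simps)
      have Gt: "G (t *\<^sub>R h) = L (f q) + (\<Sum>p\<in>degs n. of_real (t ^ (fst p + snd p + 1) / real (fst p + snd p + 1)) * a p h)" for t
        unfolding G_def as ..
      have "((\<lambda>t. G (t *\<^sub>R h)) has_vector_derivative (\<Sum>p\<in>degs n. of_real (t ^ (fst p + snd p)) * a p h)) (at t)"
      proof -
        have "((\<lambda>t. of_real (t ^ (fst p + snd p + 1) / real (fst p + snd p + 1)) * a p h) has_vector_derivative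
           of_real (t ^ (fst p + snd p)) * a p h) (at t)" for p :: "nat \<times> nat"
        proof -
          have "((\<lambda>t. t ^ (fst p + snd p + 1) / real (fst p + snd p + 1)) has_real_derivative t ^ (fst p + snd p)) (at t)"
            by (rule DERIV_cong[OF DERIV_cdivide[OF DERIV_pow]]) simp
          then have "((\<lambda>t. complex_of_real (t ^ (fst p + snd p + 1) / real (fst p + snd p + 1))) has_vector_derivative
              of_real (t ^ (fst p + snd p))) (at t)"
            by (rule has_vector_derivative_of_real[unfolded has_real_derivative_iff_has_vector_derivative[symmetric]])
          then show ?thesis by (rule has_vector_derivative_mult_left)
        qed
        then have "((\<lambda>t. L (f q) + (\<Sum>p\<in>degs n. of_real (t ^ (fst p + snd p + 1) / real (fst p + snd p + 1)) * a p h))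
            has_vector_derivative 0 + (\<Sum>p\<in>degs n. of_real (t ^ (fst p + snd p)) * a p h)) (at t)"
          by (intro has_vector_derivative_add has_vector_derivative_const has_vector_derivative_sum)
        then show ?thesis unfolding Gt by simp
      qed
      from has_vector_derivative_diff[OF 1 this]
      have "(r has_vector_derivative of_real (fst h) * L (pdu f w) + of_real (snd h) * L (pdv f w) -
         (\<Sum>p\<in>degs n. of_real (t ^ (fst p + snd p)) * a p h)) (at t)" unfolding r_def .
      moreover have "(\<Sum>p\<in>degs n. of_real (t ^ (fst p + snd p)) * a p h) =
          of_real (fst h) * tpoly n A (t *\<^sub>R h) + of_real (snd h) * tpoly n B (t *\<^sub>R h)"
        unfolding tpoly_def sum_distrib_left sum.distrib[symmetric]
        by (intro sum.cong refl) (simp add: a_def mono2_def power_mult_distrib power_add algebra_simps)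
      ultimately show ?thesis unfolding D_def w_def by (simp add: algebra_simps)
    qed
    have "\<exists>t\<in>{0<..<1}. norm (r 1 - r 0) \<le> norm ((1 - 0) *\<^sub>R D t)"
    proof (rule mvt_general)
      show "continuous_on {0..1} r"
        using der by (intro continuous_at_imp_continuous_on ballI has_vector_derivative_continuous)
      fix t :: real assume "0 < t" "t < 1"
      then show "(r has_derivative (\<lambda>x. x *\<^sub>R D t)) (at t)"
        using der[of t] by (simp add: has_vector_derivative_def)
    qed simp
    then obtain t where t: "t \<in> {0<..<1}" "norm (r 1 - r 0) \<le> norm (D t)" by auto
    have "G 0 = L (f q)" by (simp add: G_def a_def)
    then have "norm (L (f (q + h)) - G h) \<le> norm (D t)" using t(2) by (simp add: r_def)
    also have "\<dots> \<le> norm h * (CA * norm h ^ n) + norm h * (CB * norm h ^ n)"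
    proof -
      have th: "norm (t *\<^sub>R h) \<le> norm h" using nth[of t] t(1) by auto
      then have pw: "norm (t *\<^sub>R h) ^ n \<le> norm h ^ n" by (intro power_mono) auto
      have "norm (L (pdu f (q + t *\<^sub>R h)) - tpoly n A (t *\<^sub>R h)) \<le> CA * norm h ^ n"
        using d(2)[of "t *\<^sub>R h"] th h mult_left_mono[OF pw, of CA] CA(1) by linarith
      moreover have "norm (L (pdv f (q + t *\<^sub>R h)) - tpoly n B (t *\<^sub>R h)) \<le> CB * norm h ^ n"
        using d(3)[of "t *\<^sub>R h"] th h mult_left_mono[OF pw, of CB] CB(1) by linarith
      moreover have "\<bar>fst h\<bar> \<le> norm h" "\<bar>snd h\<bar> \<le> norm h"
        using norm_fst_le[of "fst h" "snd h"] norm_snd_le[of "snd h" "fst h"] by auto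
      ultimately show ?thesis unfolding D_def
        by (intro order.trans[OF norm_triangle_ineq] add_mono) (auto simp only: norm_mult norm_of_real intro!: mult_mono norm_ge_zero)
    qed
    finally show ?thesis by (simp add: algebra_simps)
  qed
  have "\<forall>\<^sub>F h in nhds 0. norm (L (f (q + h)) - G h) \<le> (CA + CB) * norm h ^ Suc n"
    unfolding eventually_nhds_metric using main d(1) by (intro exI[of _ d]) (auto simp: dist_norm)
  then have bo: "bigO (Suc n) (\<lambda>h. L (f (q + h)) - G (q + h - q))"
    unfolding bigO_def add_diff_cancel_left' by blast
  have "jet (Suc n) (\<lambda>w. G (w - q)) q P" using P unfolding taylor_def by blast
  from jet_bigO_cong[OF this bo] show ?case ..
qed

lemma smooth_taylor_map:
  assumes "open S" "q \<in> S" "smooth2_on S \<phi>" shows "taylor_map \<phi> q"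
proof -
  have "has_taylor (\<lambda>w. L (\<phi> w)) q" if "bounded_linear L" for L :: "real \<times> real \<Rightarrow> complex"
  proof -
    have "\<exists>P. jet N (\<lambda>w. L (\<phi> w)) q P" for N
      by (rule Cn_on_jet[OF assms(1,2) that]) (use assms(3) in \<open>simp add: smooth2_on_def\<close>)
    then obtain P where "taylor (\<lambda>w. L (\<phi> w)) q P" by (rule jets_imp_taylor)
    then show ?thesis unfolding has_taylor_def by (rule exI)
  qed
  from this[of "\<lambda>p. of_real (fst p)"] this[of "\<lambda>p. of_real (snd p)"] show ?thesis
    unfolding taylor_map_def
    by (simp add: bounded_linear_compose[OF bounded_linear_of_real bounded_linear_fst]
        bounded_linear_compose[OF bounded_linear_of_real bounded_linear_snd])
qed

section \<open>Sums of convergent series\<close>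

definition pterm :: "ps2 \<Rightarrow> complex \<times> complex \<Rightarrow> nat \<times> nat \<Rightarrow> complex" where
  "pterm P h p = cf P (fst p) (snd p) * fst h ^ fst p * snd h ^ snd p"

definition psum :: "ps2 \<Rightarrow> complex \<times> complex \<Rightarrow> complex" where
  "psum P h = infsum (pterm P h) UNIV"

lemma pterm_case: "pterm P h = (\<lambda>(i, j). cf P i j * fst h ^ i * snd h ^ j)"
  by (auto simp: pterm_def)

lemma conv_abs_summable:
  assumes "conv P"
  obtains \<rho> where "\<rho> > 0" "(\<lambda>p. norm (cf P (fst p) (snd p)) * \<rho> ^ (fst p + snd p)) summable_on UNIV"
proof -
  obtain \<sigma> C where \<sigma>: "\<sigma> > 0" and C: "C > 0" and b: "\<And>i j. norm (cf P i j) * \<sigma> ^ (i + j) \<le> C"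
    using conv_coeffE[OF assms] by metis
  define G where "G = (\<lambda>(i, j). (1/2 :: complex) ^ i * (1/2) ^ j)"
  have "((\<lambda>n. (1/2 :: complex) ^ n) has_sum (1 / (1 - 1/2))) UNIV"
  proof (rule norm_summable_imp_has_sum)
    show "(\<lambda>n. (1/2 :: complex) ^ n) sums (1 / (1 - 1/2))"
      by (rule geometric_sums) (simp add: norm_divide)
  qed (simp add: norm_power norm_divide summable_geometric)
  from has_sum_product[OF this this] have "G summable_on UNIV"
    unfolding G_def by (auto simp: summable_on_def)
  then have "(\<lambda>p. complex_of_real C * G p) summable_on UNIV" by (rule summable_on_cmult_right)
  then have "(\<lambda>p. norm (complex_of_real C * G p)) summable_on UNIV"
    by (simp add: summable_on_iff_abs_summable_on_complex)
  then have "(\<lambda>p. norm (norm (cf P (fst p) (snd p)) * (\<sigma> / 2) ^ (fst p + snd p))) summable_on UNIV"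
  proof (rule Infinite_Sum.abs_summable_on_comparison_test)
    fix p :: "nat \<times> nat"
    have "norm (norm (cf P (fst p) (snd p)) * (\<sigma> / 2) ^ (fst p + snd p)) =
        (norm (cf P (fst p) (snd p)) * \<sigma> ^ (fst p + snd p)) * (1/2) ^ (fst p + snd p)"
      using \<sigma> by (simp add: power_divide norm_mult norm_power)
    also have "\<dots> \<le> C * (1/2) ^ (fst p + snd p)" by (intro mult_right_mono b) auto
    also have "\<dots> = norm (complex_of_real C * G p)"
      using C by (simp add: G_def case_prod_unfold norm_mult norm_power norm_divide power_add power_divide)
    finally show "norm (norm (cf P (fst p) (snd p)) * (\<sigma> / 2) ^ (fst p + snd p)) \<le> norm (complex_of_real C * G p)" .
  qed
  then have "(\<lambda>p. norm (cf P (fst p) (snd p)) * (\<sigma> / 2) ^ (fst p + snd p)) summable_on UNIV"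
    using \<sigma> by simp
  then show ?thesis using that[of "\<sigma> / 2"] \<sigma> by simp
qed

lemma pterm_le:
  assumes "norm (fst h) \<le> \<rho>" "norm (snd h) \<le> \<rho>"
  shows "norm (pterm P h p) \<le> norm (cf P (fst p) (snd p)) * \<rho> ^ (fst p + snd p)"
proof -
  have "\<rho> \<ge> 0" using assms norm_ge_zero order_trans by blast
  then show ?thesis unfolding pterm_def norm_mult norm_power power_add mult.assoc
    by (intro mult_left_mono mult_mono power_mono assms) auto
qed

lemma psum_has_sum:
  assumes \<rho>: "(\<lambda>p. norm (cf P (fst p) (snd p)) * \<rho> ^ (fst p + snd p)) summable_on UNIV"
    and h: "norm (fst h) \<le> \<rho>" "norm (snd h) \<le> \<rho>"
  shows "(pterm P h has_sum psum P h) UNIV"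
proof -
  have "(\<lambda>p. norm (norm (cf P (fst p) (snd p)) * \<rho> ^ (fst p + snd p))) summable_on UNIV"
    using summable_on_iff_abs_summable_on_real[THEN iffD1, OF \<rho>] .
  then have "(\<lambda>p. norm (pterm P h p)) summable_on UNIV"
  proof (rule Infinite_Sum.abs_summable_on_comparison_test)
    fix p
    show "norm (pterm P h p) \<le> norm (norm (cf P (fst p) (snd p)) * \<rho> ^ (fst p + snd p))"
      unfolding real_norm_def by (rule order_trans[OF pterm_le[OF h] abs_ge_self])
  qed
  then have "pterm P h summable_on UNIV" by (rule abs_summable_summable)
  then show ?thesis unfolding psum_def by (rule has_sum_infsum)
qed

lemma small_prod:
  assumes "\<rho> > 0" shows "\<forall>\<^sub>F h :: complex \<times> complex in nhds 0. norm (fst h) \<le> \<rho> \<and> norm (snd h) \<le> \<rho>"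
  unfolding eventually_nhds_metric
proof (intro exI[of _ \<rho>] conjI assms allI impI)
  fix h :: "complex \<times> complex" assume "dist h 0 < \<rho>"
  then show "norm (fst h) \<le> \<rho>" "norm (snd h) \<le> \<rho>"
    using norm_fst_le[of "fst h" "snd h"] norm_snd_le[of "snd h" "fst h"] by (simp_all add: dist_norm)
qed

lemma eventually_val_has_sum:
  assumes "conv P" shows "\<forall>\<^sub>F h in nhds 0. (pterm P h has_sum psum P h) UNIV"
proof -
  obtain \<rho> where \<rho>: "\<rho> > 0" "(\<lambda>p. norm (cf P (fst p) (snd p)) * \<rho> ^ (fst p + snd p)) summable_on UNIV"
    using conv_abs_summable[OF assms] .
  from small_prod[OF \<rho>(1)] show ?thesis
  proof eventually_elim
    case (elim h)
    show ?case by (rule psum_has_sum[OF \<rho>(2) conjunct1[OF elim] conjunct2[OF elim]])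
  qed
qed

lemma has_power_series2_val:
  assumes "conv P" "\<forall>\<^sub>F h in nhds 0. F (z + h) = psum P h"
  shows "has_power_series2 (cf P) F z"
  unfolding has_power_series2_def pterm_case[symmetric] using eventually_val_has_sum[OF assms(1)] assms(2)
  by eventually_elim simp

lemma analytic2_at_val: "conv P \<Longrightarrow> analytic2_at (\<lambda>w. psum P (w - z)) z"
  unfolding analytic2_at_def by (rule exI, rule has_power_series2_val[of P]) auto

text \<open>Absolute convergence at one point \<open>(r, r)\<close> with \<open>r > 0\<close> bounds the coefficients geometrically.\<close>

lemma power_series2_conv:
  assumes "has_power_series2 c F z"
  shows "conv (mk2 c)" "\<forall>\<^sub>F h in nhds 0. F (z + h) = psum (mk2 c) h"
proof -
  have ev: "\<forall>\<^sub>F h in nhds 0. (pterm (mk2 c) h has_sum F (z + h)) UNIV"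
    using assms by (simp add: has_power_series2_def pterm_case)
  then show "\<forall>\<^sub>F h in nhds 0. F (z + h) = psum (mk2 c) h"
    by eventually_elim (simp add: psum_def infsumI)
  obtain e where e: "e > 0" "\<And>h. dist h 0 < e \<Longrightarrow> (pterm (mk2 c) h has_sum F (z + h)) UNIV"
    using ev unfolding eventually_nhds_metric by blast
  define r where "r = e / 4"
  define h where "h = (complex_of_real r, complex_of_real r)"
  have r: "r > 0" using e by (simp add: r_def)
  have "dist h 0 \<le> norm (complex_of_real r) + norm (complex_of_real r)"
    unfolding h_def dist_norm diff_0_right norm_prod_def fst_conv snd_conv
    by (rule sqrt_sum_squares_le_sum) auto
  also have "\<dots> < e" using e by (simp add: r_def)
  finally have "(pterm (mk2 c) h has_sum F (z + h)) UNIV" by (rule e(2))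
  then have "pterm (mk2 c) h summable_on UNIV" by (rule has_sum_imp_summable)
  then have s: "(\<lambda>p. norm (pterm (mk2 c) h p)) summable_on UNIV"
    by (simp add: summable_on_iff_abs_summable_on_complex)
  have "norm (cf (mk2 c) i j) * r ^ (i + j) \<le> infsum (\<lambda>p. norm (pterm (mk2 c) h p)) UNIV" for i j
  proof -
    have "norm (cf (mk2 c) i j) * r ^ (i + j) = (\<Sum>p\<in>{(i, j)}. norm (pterm (mk2 c) h p))"
      using r by (simp add: pterm_def h_def norm_mult norm_power power_add)
    also have "\<dots> \<le> infsum (\<lambda>p. norm (pterm (mk2 c) h p)) UNIV"
      by (rule finite_sum_le_infsum[OF s]) auto
    finally show ?thesis .
  qed
  then show "conv (mk2 c)" using r conv_coeffI by blast
qed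

lemma conv_taylor:
  assumes "conv P" shows "taylor (\<lambda>w. psum P (cpoint (w - q))) q P"
  unfolding taylor_def
proof
  fix N
  obtain \<rho> where \<rho>: "\<rho> > 0" "(\<lambda>p. norm (cf P (fst p) (snd p)) * \<rho> ^ (fst p + snd p)) summable_on UNIV"
    using conv_abs_summable[OF assms] .
  define g where "g = (\<lambda>p. norm (cf P (fst p) (snd p)) * \<rho> ^ (fst p + snd p))"
  have g: "g summable_on (UNIV - degs N)"
    using \<rho>(2) unfolding g_def by (rule summable_on_subset_banach) auto
  define K where "K = infsum g (UNIV - degs N) / \<rho> ^ N"
  have "norm (psum P (cpoint h) - tpoly N P h) \<le> K * norm h ^ N" if h: "norm h < \<rho>" for h :: "real \<times> real"
  proof -
    define c where "c = cpoint h"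
    have c: "norm (fst c) \<le> norm h" "norm (snd c) \<le> norm h"
      using norm_fst_le[of "fst h" "snd h"] norm_snd_le[of "snd h" "fst h"] by (simp_all add: c_def cpoint_def)
    have "(pterm P c has_sum psum P c) UNIV" using c h by (intro psum_has_sum[OF \<rho>(2)]) auto
    moreover have "(pterm P c has_sum (tpoly N P h)) (degs N)"
    proof -
      have "tpoly N P h = sum (pterm P c) (degs N)"
        unfolding tpoly_def by (intro sum.cong refl) (simp add: pterm_def mono2_def c_def cpoint_def)
      then show ?thesis by (simp add: has_sum_finite)
    qed
    ultimately have d: "(pterm P c has_sum (psum P c - tpoly N P h)) (UNIV - degs N)"
      by (rule has_sum_Diff) auto
    then have "pterm P c summable_on (UNIV - degs N)" by (rule has_sum_imp_summable)
    then have "(\<lambda>p. norm (pterm P c p)) summable_on (UNIV - degs N)"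
      by (simp add: summable_on_iff_abs_summable_on_complex)
    then have n: "((\<lambda>p. norm (pterm P c p)) has_sum infsum (\<lambda>p. norm (pterm P c p)) (UNIV - degs N)) (UNIV - degs N)"
      by (rule has_sum_infsum)
    have "norm (psum P c - tpoly N P h) \<le> infsum (\<lambda>p. norm (pterm P c p)) (UNIV - degs N)"
      by (rule norm_has_sum_bound[OF n d])
    also have "\<dots> \<le> (norm h / \<rho>) ^ N * infsum g (UNIV - degs N)"
    proof (rule has_sum_mono[OF n has_sum_cmult_right[OF has_sum_infsum[OF g]]])
      fix p assume "p \<in> UNIV - degs N"
      then have N: "N \<le> fst p + snd p" by (auto simp: degs_def)
      have "norm (pterm P c p) \<le> norm (cf P (fst p) (snd p)) * norm h ^ (fst p + snd p)"
        by (rule pterm_le[OF c])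
      also have "\<dots> = (norm h / \<rho>) ^ (fst p + snd p) * g p" using \<rho>(1) by (simp add: g_def power_divide)
      also have "\<dots> \<le> (norm h / \<rho>) ^ N * g p"
        using N h \<rho>(1) by (intro mult_right_mono power_decreasing) (auto simp: g_def)
      finally show "norm (pterm P c p) \<le> (norm h / \<rho>) ^ N * g p" .
    qed
    also have "\<dots> = K * norm h ^ N" by (simp add: K_def power_divide)
    finally show ?thesis by (simp add: c_def)
  qed
  then have "\<forall>\<^sub>F h in nhds 0. norm (psum P (cpoint h) - tpoly N P h) \<le> K * norm h ^ N"
    unfolding eventually_nhds_metric using \<rho>(1) by (intro exI[of _ \<rho>]) (simp add: dist_norm)
  then have "bigO N (\<lambda>h. psum P (cpoint (q + h - q)) - tpoly N P h)"
    unfolding bigO_def add_diff_cancel_left' by blast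
  then show "jet N (\<lambda>w. psum P (cpoint (w - q))) q P" unfolding jet_def .
qed

lemma filterlim_cpoint: "filterlim cpoint (nhds 0) (nhds 0)"
proof -
  have "(cpoint \<longlongrightarrow> cpoint 0) (nhds 0)"
    unfolding cpoint_def
    by (intro tendsto_Pair tendsto_of_real tendsto_fst tendsto_snd filterlim_ident)
  then show ?thesis by (simp add: cpoint_def zero_prod_def)
qed

lemma eventually_cpoint: "\<forall>\<^sub>F h in nhds 0. Q h \<Longrightarrow> \<forall>\<^sub>F h in nhds 0. Q (cpoint h)"
  using filterlim_cpoint by (auto simp: filterlim_iff)

lemma taylor_cong_0: "\<forall>\<^sub>F h in nhds 0. f (q + h) = g (q + h) \<Longrightarrow> taylor f q P \<Longrightarrow> taylor g q P"
  unfolding taylor_def jet_def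
proof
  fix N
  assume "\<forall>\<^sub>F h in nhds 0. f (q + h) = g (q + h)" and b: "\<forall>N. bigO N (\<lambda>h. f (q + h) - tpoly N P h)"
  then have "\<forall>\<^sub>F h in nhds 0. f (q + h) - tpoly N P h = g (q + h) - tpoly N P h" by (elim eventually_mono) simp
  from bigO_cong[OF this] show "bigO N (\<lambda>h. g (q + h) - tpoly N P h)" using b by blast
qed

lemma taylor_of_expansion:
  assumes "conv P" "\<forall>\<^sub>F h in nhds 0. F h = psum P h"
  shows "taylor (\<lambda>w. F (cpoint w)) 0 P"
proof (rule taylor_cong_0[OF _ conv_taylor[OF assms(1), of 0]])
  show "\<forall>\<^sub>F h in nhds 0. psum P (cpoint (0 + h - 0)) = F (cpoint (0 + h))"
    using eventually_cpoint[OF assms(2)] by (simp add: eq_commute)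
qed

lemma psum_unique:
  assumes "conv P" "conv Q" "\<forall>\<^sub>F h in nhds 0. psum P h = psum Q h" shows "P = Q"
  using taylor_unique[OF taylor_of_expansion[OF assms(1), of "psum P"] taylor_of_expansion[OF assms(2,3)]]
  by simp

text \<open>The product of the sums is analytic, hence the sum of some convergent series; this series is the product by
  uniqueness of Taylor series.\<close>

lemma psum_mult:
  assumes "conv P" "conv Q" shows "\<forall>\<^sub>F h in nhds 0. psum (P * Q) h = psum P h * psum Q h"
proof -
  have "analytic2_at (\<lambda>w. psum P (w - 0) * psum Q (w - 0)) 0"
    by (intro analytic2_at_mult analytic2_at_val assms)
  then obtain c where "has_power_series2 c (\<lambda>w. psum P w * psum Q w) 0" by (auto simp: analytic2_at_def)
  note c = power_series2_conv[OF this]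
  have "taylor (\<lambda>w. psum P (cpoint w) * psum Q (cpoint w)) 0 (P * Q)"
    using taylor_mult[OF conv_taylor[OF assms(1), of 0] conv_taylor[OF assms(2), of 0]] by simp
  moreover have "taylor (\<lambda>w. psum P (cpoint w) * psum Q (cpoint w)) 0 (mk2 c)"
    using taylor_of_expansion[OF c(1), of "\<lambda>h. psum P h * psum Q h"] c(2) by simp
  ultimately have "mk2 c = P * Q" using taylor_unique by blast
  then show ?thesis using c(2) by (simp add: eq_commute)
qed

lemma psum_add:
  assumes "conv P" "conv Q" shows "\<forall>\<^sub>F h in nhds 0. psum (P + Q) h = psum P h + psum Q h"
  using eventually_val_has_sum[OF assms(1)] eventually_val_has_sum[OF assms(2)]
proof eventually_elim
  case (elim h)
  have "(pterm (P + Q) h has_sum (psum P h + psum Q h)) UNIV"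
    using has_sum_add[OF elim] by (simp add: pterm_def[abs_def] distrib_right)
  then show ?case by (simp add: psum_def infsumI)
qed

lemma psum_cst: "psum (cst c) h = c"
proof -
  have "infsum (pterm (cst c) h) UNIV = infsum (pterm (cst c) h) {(0, 0)}"
    by (rule infsum_cong_neutral) (auto simp: pterm_def cf_cst)
  then show ?thesis by (simp add: psum_def pterm_def cf_cst)
qed

lemma psum_cj: "psum (conj2 P) (cpoint h) = cnj (psum P (cpoint h))"
proof -
  have "pterm (conj2 P) (cpoint h) = (\<lambda>p. cnj (pterm P (cpoint h) p))"
    by (auto simp: pterm_def cpoint_def)
  then show ?thesis by (simp only: psum_def infsum_cnj)
qed

section \<open>Termwise differentiation\<close>

text \<open>Summing first over \<open>y\<close> exhibits the double series as a power series in \<open>x\<close>, to which the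
  one-variable theorem on termwise differentiation applies.\<close>

lemma psum_iterated:
  assumes "conv P"
  obtains \<sigma> where "\<sigma> > 0" "\<And>x y. norm x \<le> \<sigma> \<Longrightarrow> norm y \<le> \<sigma> \<Longrightarrow>
     (\<lambda>i. infsum (\<lambda>j. cf P i j * y ^ j) UNIV * x ^ i) sums psum P (x, y)"
proof -
  obtain \<rho> where \<rho>: "\<rho> > 0" "(\<lambda>p. norm (cf P (fst p) (snd p)) * \<rho> ^ (fst p + snd p)) summable_on UNIV"
    using conv_abs_summable[OF assms] .
  obtain s C where s: "s > 0" "C > 0" "\<And>i j. norm (cf P i j) * s ^ (i + j) \<le> C"
    using conv_coeffE[OF assms] by metis
  define \<sigma> where "\<sigma> = min \<rho> (s / 2)"
  have \<sigma>: "\<sigma> > 0" "\<sigma> \<le> \<rho>" "\<sigma> \<le> s / 2" using \<rho>(1) s(1) by (auto simp: \<sigma>_def)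
  have "(\<lambda>i. infsum (\<lambda>j. cf P i j * y ^ j) UNIV * x ^ i) sums psum P (x, y)"
    if x: "norm x \<le> \<sigma>" and y: "norm y \<le> \<sigma>" for x y
  proof (rule has_sum_imp_sums, rule has_sum_SigmaD)
    have "(pterm P (x, y) has_sum psum P (x, y)) UNIV" using x y \<sigma> by (intro psum_has_sum[OF \<rho>(2)]) auto
    then show "(pterm P (x, y) has_sum psum P (x, y)) (UNIV \<times> UNIV)" by simp
    fix i :: nat
    have "summable (\<lambda>j. norm (cf P i j * y ^ j))"
    proof (rule summable_comparison_test)
      have "norm (norm (cf P i j * y ^ j)) \<le> C / s ^ i * (1/2) ^ j" for j
      proof -
        have "norm (cf P i j * y ^ j) \<le> norm (cf P i j) * (s / 2) ^ j"
          unfolding norm_mult norm_power using y \<sigma> by (intro mult_left_mono power_mono) auto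
        also have "\<dots> = (norm (cf P i j) * s ^ (i + j)) / s ^ i * (1/2) ^ j"
          using s(1) by (simp add: power_add power_divide)
        also have "\<dots> \<le> C / s ^ i * (1/2) ^ j"
          using s(1) by (intro mult_right_mono divide_right_mono s(3)) auto
        finally show ?thesis by simp
      qed
      then show "\<exists>N. \<forall>j\<ge>N. norm (norm (cf P i j * y ^ j)) \<le> C / s ^ i * (1/2) ^ j" by blast
      show "summable (\<lambda>j. C / s ^ i * (1/2) ^ j)" by (intro summable_mult summable_geometric) simp
    qed
    then have "(\<lambda>j. cf P i j * y ^ j) summable_on UNIV" by (rule norm_summable_imp_summable_on)
    then have "((\<lambda>j. x ^ i * (cf P i j * y ^ j)) has_sum x ^ i * infsum (\<lambda>j. cf P i j * y ^ j) UNIV) UNIV"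
      by (intro has_sum_cmult_right has_sum_infsum)
    then show "((\<lambda>j. pterm P (x, y) (i, j)) has_sum infsum (\<lambda>j. cf P i j * y ^ j) UNIV * x ^ i) UNIV"
      by (simp add: pterm_def mult_ac)
  qed
  then show ?thesis using that \<sigma>(1) by blast
qed

lemma cf_deriv: "cf (fps_deriv P) i j = of_nat (Suc i) * cf P (Suc i) j" for P :: ps2
proof -
  have "fps_nth (fps_deriv P) i = fps_const (of_nat (Suc i)) * fps_nth P (Suc i)"
    unfolding fps_deriv_nth fps_of_nat by simp
  then show ?thesis by (simp only: fps_mult_left_const_nth)
qed

lemma conv_deriv: assumes "conv P" shows "conv (fps_deriv P)"
proof -
  obtain s C where s: "s > 0" "C > 0" "\<And>i j. norm (cf P i j) * s ^ (i + j) \<le> C"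
    using conv_coeffE[OF assms] by metis
  have "norm (cf (fps_deriv P) i j) * (s / 2) ^ (i + j) \<le> C / s" for i j
  proof -
    have "real (Suc i) \<le> 2 ^ i" by (metis Suc_leI less_exp of_nat_le_iff of_nat_numeral of_nat_power)
    also have "(2::real) ^ i \<le> 2 ^ (i + j)" by (rule power_increasing) auto
    finally have 2: "real (Suc i) \<le> 2 ^ (i + j)" .
    have "norm (cf (fps_deriv P) i j) * (s / 2) ^ (i + j) =
        (real (Suc i) / 2 ^ (i + j)) * (norm (cf P (Suc i) j) * s ^ (i + j))"
      unfolding cf_deriv norm_mult norm_of_nat power_divide by (simp only: times_divide_eq_left times_divide_eq_right mult_ac)
    also have "\<dots> \<le> 1 * (norm (cf P (Suc i) j) * s ^ (i + j))"
      using 2 s(1) by (intro mult_right_mono) (auto simp: divide_le_eq)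
    also have "\<dots> \<le> C / s" using s(3)[of "Suc i" j] s(1) by (simp add: field_simps)
    finally show ?thesis .
  qed
  then show ?thesis using s(1) by (intro conv_coeffI[of "s / 2" _ "C / s"]) (simp only: half_gt_zero, blast)
qed

lemma psum_deriv:
  assumes "conv P"
  obtains d where "d > 0" "\<And>x y. norm x < d \<Longrightarrow> norm y < d \<Longrightarrow>
    ((\<lambda>x. psum P (x, y)) has_field_derivative psum (fps_deriv P) (x, y)) (at x)"
proof -
  obtain s where s: "s > 0" "\<And>x y. norm x \<le> s \<Longrightarrow> norm y \<le> s \<Longrightarrow>
     (\<lambda>i. infsum (\<lambda>j. cf P i j * y ^ j) UNIV * x ^ i) sums psum P (x, y)"
    using psum_iterated[OF assms] by blast
  obtain s' where s': "s' > 0" "\<And>x y. norm x \<le> s' \<Longrightarrow> norm y \<le> s' \<Longrightarrow>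
     (\<lambda>i. infsum (\<lambda>j. cf (fps_deriv P) i j * y ^ j) UNIV * x ^ i) sums psum (fps_deriv P) (x, y)"
    using psum_iterated[OF conv_deriv[OF assms]] by blast
  define d where "d = min s s'"
  have d: "d > 0" "d \<le> s" "d \<le> s'" using s(1) s'(1) by (auto simp: d_def)
  have "((\<lambda>x. psum P (x, y)) has_field_derivative psum (fps_deriv P) (x, y)) (at x)"
    if x: "norm x < d" and y: "norm y < d" for x y
  proof -
    define a where "a = (\<lambda>i. infsum (\<lambda>j. cf P i j * y ^ j) UNIV)"
    have a: "(\<lambda>i. a i * x ^ i) sums psum P (x, y)" if "norm x \<le> s" for x
      using s(2)[OF that] y d by (simp add: a_def)
    have diffs: "diffs a = (\<lambda>i. infsum (\<lambda>j. cf (fps_deriv P) i j * y ^ j) UNIV)"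
      by (rule ext) (simp only: diffs_def a_def cf_deriv mult.assoc infsum_cmult_right')
    have "summable (\<lambda>i. a i * complex_of_real d ^ i)"
      using a[of "complex_of_real d"] d by (auto dest: sums_summable)
    then have "((\<lambda>x. \<Sum>i. a i * x ^ i) has_field_derivative (\<Sum>i. diffs a i * x ^ i)) (at x)"
      by (rule termdiffs_strong) (use x d in auto)
    moreover have "(\<Sum>i. diffs a i * x ^ i) = psum (fps_deriv P) (x, y)"
      unfolding diffs using s'(2)[of x y] x y d by (auto dest: sums_unique)
    moreover have "(\<Sum>i. a i * z ^ i) = psum P (z, y)" if "z \<in> ball 0 d" for z
      using a[of z] that d by (auto dest: sums_unique)
    ultimately show ?thesis
      using x by (auto intro: has_field_derivative_transform_within_open[where S = "ball 0 d"])
  qed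
  then show ?thesis using that d(1) by blast
qed

section \<open>Convergent expansions of real functions\<close>

text \<open>\<open>f\<close> is the sum of a convergent series with real coefficients. The series itself is complex, so that it is
  at the same time the series of the complexification.\<close>

definition expands :: "(real \<times> real \<Rightarrow> real) \<Rightarrow> real \<times> real \<Rightarrow> ps2 \<Rightarrow> bool" where
  "expands f q P \<longleftrightarrow> conv P \<and> conj2 P = P \<and> (\<forall>\<^sub>F h in nhds 0. complex_of_real (f (q + h)) = psum P (cpoint h))"

lemma expands_taylor: "expands f q P \<Longrightarrow> taylor (\<lambda>w. complex_of_real (f w)) q P"
  by (rule taylor_cong_0[OF _ conv_taylor]) (auto simp: expands_def elim!: eventually_mono)

lemma expands_unique: "expands f q P \<Longrightarrow> expands f q Q \<Longrightarrow> P = Q"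
  using expands_taylor taylor_unique by blast

lemma expands_mult:
  assumes "expands f q P" "expands g q Q" shows "expands (\<lambda>w. f w * g w) q (P * Q)"
proof -
  have c: "conv P" "conv Q" using assms by (auto simp: expands_def)
  have "\<forall>\<^sub>F h in nhds 0. complex_of_real (f (q + h)) = psum P (cpoint h)"
    "\<forall>\<^sub>F h in nhds 0. complex_of_real (g (q + h)) = psum Q (cpoint h)" using assms by (auto simp: expands_def)
  with eventually_cpoint[OF psum_mult[OF c]]
  have "\<forall>\<^sub>F h in nhds 0. complex_of_real (f (q + h) * g (q + h)) = psum (P * Q) (cpoint h)"
    by eventually_elim simp
  then show ?thesis using assms by (auto simp: expands_def)
qed

lemma expands_add:
  assumes "expands f q P" "expands g q Q" shows "expands (\<lambda>w. f w + g w) q (P + Q)"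
proof -
  have c: "conv P" "conv Q" using assms by (auto simp: expands_def)
  have "\<forall>\<^sub>F h in nhds 0. complex_of_real (f (q + h)) = psum P (cpoint h)"
    "\<forall>\<^sub>F h in nhds 0. complex_of_real (g (q + h)) = psum Q (cpoint h)" using assms by (auto simp: expands_def)
  with eventually_cpoint[OF psum_add[OF c]]
  have "\<forall>\<^sub>F h in nhds 0. complex_of_real (f (q + h) + g (q + h)) = psum (P + Q) (cpoint h)"
    by eventually_elim simp
  then show ?thesis using assms by (auto simp: expands_def)
qed

lemma expands_const: "expands (\<lambda>w. c) q (cst (complex_of_real c))"
  by (simp add: expands_def psum_cst)

lemma expands_diff:
  assumes "expands f q P" "expands g q Q" shows "expands (\<lambda>w. f w - g w) q (P - Q)"
  using expands_add[OF assms(1) expands_mult[OF expands_const[of "-1"] assms(2)]]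
  by (simp add: cst_simps)

lemma expands_00: "expands f q P \<Longrightarrow> cf P 0 0 = complex_of_real (f q)"
  using taylor_00[OF expands_taylor] .

lemma real_power_series2_val:
  assumes "has_power_series2 c f q"
  shows "\<forall>\<^sub>F h in nhds 0. complex_of_real (f (q + h)) = psum (mk2 (\<lambda>i j. complex_of_real (c i j))) (cpoint h)"
  using assms unfolding has_power_series2_def
proof eventually_elim
  case (elim h)
  then have "((\<lambda>p. complex_of_real (case p of (i, j) \<Rightarrow> c i j * fst h ^ i * snd h ^ j)) has_sum complex_of_real (f (q + h))) UNIV"
    by (rule has_sum_of_real)
  moreover have "(\<lambda>p. complex_of_real (case p of (i, j) \<Rightarrow> c i j * fst h ^ i * snd h ^ j)) =
      pterm (mk2 (\<lambda>i j. complex_of_real (c i j))) (cpoint h)"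
    by (auto simp: pterm_def cpoint_def)
  ultimately show ?case by (simp add: psum_def infsumI)
qed

lemma analytic2_at_complexify_expands:
  assumes "analytic2_at f q"
  obtains P where "expands f q P" "\<forall>\<^sub>F h in nhds 0. complexify f q (cpoint q + h) = psum P h"
proof -
  obtain c where c: "has_power_series2 c f q"
    "has_power_series2 (\<lambda>i j. complex_of_real (c i j)) (complexify f q) (cpoint q)"
    using complexify_power_series[OF assms] by blast
  define P where "P = mk2 (\<lambda>i j. complex_of_real (c i j))"
  note P = power_series2_conv[OF c(2), folded P_def]
  have "conj2 P = P" by (rule ps2_eqI) (simp add: P_def)
  then have "expands f q P" unfolding expands_def
    using P(1) real_power_series2_val[OF c(1), folded P_def] by blast
  then show ?thesis using that P(2) by blast
qed

text \<open>The complexification is chosen as the sum of some series of \<open>f\<close>, and \<open>f\<close> has only one.\<close>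

lemma expands_complexify:
  assumes "expands f q P"
  shows "\<forall>\<^sub>F h in nhds 0. complexify f q (cpoint q + h) = psum P h"
proof -
  define r where "r = (\<lambda>i j. Re (cf P i j))"
  have P: "P = mk2 (\<lambda>i j. complex_of_real (r i j))"
  proof (rule ps2_eqI)
    fix i j
    have "cnj (cf P i j) = cf P i j" using assms conj2_simps(6) unfolding expands_def by metis
    then show "cf P i j = cf (mk2 (\<lambda>i j. complex_of_real (r i j))) i j"
      by (simp add: r_def complex_eq_iff)
  qed
  have cP: "conv P" using assms by (simp add: expands_def)
  have "\<forall>\<^sub>F h in nhds 0. ((\<lambda>(i, j). r i j * fst h ^ i * snd h ^ j) has_sum f (q + h)) UNIV"
    using eventually_cpoint[OF eventually_val_has_sum[OF cP]] assms[unfolded expands_def, THEN conjunct2, THEN conjunct2]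
  proof eventually_elim
    case (elim h)
    have "pterm P (cpoint h) = (\<lambda>p. complex_of_real (case p of (i, j) \<Rightarrow> r i j * fst h ^ i * snd h ^ j))"
      by (subst P) (auto simp: pterm_def cpoint_def)
    then have "((\<lambda>p. complex_of_real (case p of (i, j) \<Rightarrow> r i j * fst h ^ i * snd h ^ j)) has_sum complex_of_real (f (q + h))) UNIV"
      using elim by simp
    then show ?case by (simp only: has_sum_of_real_iff)
  qed
  then have "analytic2_at f q" unfolding analytic2_at_def has_power_series2_def by blast
  from analytic2_at_complexify_expands[OF this] obtain Q where Q: "expands f q Q"
    "\<forall>\<^sub>F h in nhds 0. complexify f q (cpoint q + h) = psum Q h" .
  then show ?thesis using assms expands_unique by blast
qed

lemma expands_pdu_nearby:
  assumes "expands f q P"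
  shows "\<forall>\<^sub>F h in nhds 0. ((\<lambda>s. f (s, snd (q + h))) has_vector_derivative Re (psum (fps_deriv P) (cpoint h))) (at (fst (q + h)))"
proof -
  have cP: "conv P" and ev: "\<forall>\<^sub>F h in nhds 0. complex_of_real (f (q + h)) = psum P (cpoint h)"
    using assms by (auto simp: expands_def)
  obtain d where d: "d > 0" "\<And>x y. norm x < d \<Longrightarrow> norm y < d \<Longrightarrow>
    ((\<lambda>x. psum P (x, y)) has_field_derivative psum (fps_deriv P) (x, y)) (at x)"
    using psum_deriv[OF cP] by blast
  obtain e where e: "e > 0" "\<And>h. dist h 0 < e \<Longrightarrow> complex_of_real (f (q + h)) = psum P (cpoint h)"
    using ev unfolding eventually_nhds_metric by blast
  define r where "r = min d (e / 2)"
  have r: "r > 0" "r \<le> d" "r \<le> e / 2" using d(1) e(1) by (auto simp: r_def)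
  have "((\<lambda>s. f (s, snd (q + h))) has_vector_derivative Re (psum (fps_deriv P) (cpoint h))) (at (fst (q + h)))"
    if h: "norm h < r" for h
  proof -
    have hh: "\<bar>fst h\<bar> < r" "\<bar>snd h\<bar> < r"
      using norm_fst_le[of "fst h" "snd h"] norm_snd_le[of "snd h" "fst h"] h by simp_all
    have "((\<lambda>x. psum P (x, complex_of_real (snd h))) has_field_derivative psum (fps_deriv P) (cpoint h)) (at (complex_of_real (fst h)))"
      unfolding cpoint_def using hh r by (intro d(2)) auto
    then have "((\<lambda>t. psum P (complex_of_real t, complex_of_real (snd h))) has_vector_derivative psum (fps_deriv P) (cpoint h)) (at (fst h))"
      by (rule has_vector_derivative_real_field)
    then have 1: "((\<lambda>t. Re (psum P (complex_of_real t, complex_of_real (snd h)))) has_vector_derivative Re (psum (fps_deriv P) (cpoint h))) (at (fst h))"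
      by (rule bounded_linear.has_vector_derivative[OF bounded_linear_Re])
    have 2: "((\<lambda>t. f (fst q + t, snd q + snd h)) has_vector_derivative Re (psum (fps_deriv P) (cpoint h))) (at (fst h))"
    proof (rule has_vector_derivative_transform_within_open[OF 1, of "ball 0 r"])
      fix t :: real assume "t \<in> ball 0 r"
      then have "norm (t, snd h) < e"
        using hh r real_sqrt_sum_squares_triangle_ineq[of t 0 0 "snd h"] by (simp add: norm_prod_def)
      then have "complex_of_real (f (q + (t, snd h))) = psum P (cpoint (t, snd h))" by (intro e(2)) (simp add: dist_norm)
      moreover have "q + (t, snd h) = (fst q + t, snd q + snd h)" by (simp add: prod_eq_iff)
      ultimately show "Re (psum P (complex_of_real t, complex_of_real (snd h))) = f (fst q + t, snd q + snd h)"
        unfolding cpoint_def by (metis Re_complex_of_real fst_conv snd_conv)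
    qed (use hh in auto)
    have 3: "((\<lambda>s. s - fst q) has_vector_derivative 1) (at (fst q + fst h))"
      by (auto intro!: derivative_eq_intros)
    have "((\<lambda>t. f (fst q + t, snd q + snd h)) has_vector_derivative Re (psum (fps_deriv P) (cpoint h))) (at (fst q + fst h - fst q))"
      using 2 by simp
    from vector_diff_chain_at[OF 3 this] show ?thesis by (simp add: o_def)
  qed
  then show ?thesis unfolding eventually_nhds_metric using r(1) by (intro exI[of _ r]) (simp add: dist_norm)
qed

section \<open>Coefficients of the fundamental forms\<close>

definition vexpands :: "(real \<times> real \<Rightarrow> real^3) \<Rightarrow> real \<times> real \<Rightarrow> bool" where
  "vexpands X q \<longleftrightarrow> (\<forall>i. \<exists>P. expands (\<lambda>w. X w $ i) q P)"

lemma conj2_deriv: "conj2 P = P \<Longrightarrow> conj2 (fps_deriv P) = fps_deriv P"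
proof (rule ps2_eqI)
  fix i j assume "conj2 P = P"
  then have "cnj (cf P (Suc i) j) = cf P (Suc i) j" using conj2_simps(6) by metis
  then show "cf (conj2 (fps_deriv P)) i j = cf (fps_deriv P) i j"
    unfolding conj2_simps cf_deriv complex_cnj_mult by (simp del: of_nat_Suc)
qed

lemma vector_derivative_components:
  fixes f :: "real \<Rightarrow> real^3"
  assumes "\<And>i. ((\<lambda>s. f s $ i) has_vector_derivative D i) (at t)"
  shows "vector_derivative f (at t) = (\<chi> i. D i)"
proof (rule vector_derivative_at)
  show "(f has_vector_derivative (\<chi> i. D i)) (at t)"
    unfolding has_vector_derivative_def
  proof (subst has_derivative_componentwise_within, rule ballI)
    fix b :: "real^3" assume "b \<in> Basis"
    then obtain i where b: "b = axis i 1" by (auto simp: Basis_vec_def)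
    show "((\<lambda>x. f x \<bullet> b) has_derivative (\<lambda>x. x *\<^sub>R (\<chi> i. D i) \<bullet> b)) (at t)"
      using assms[of i] unfolding has_vector_derivative_def b by (simp add: inner_axis)
  qed
qed

lemma vexpands_pdu:
  assumes "vexpands X q" shows "vexpands (pdu X) q"
proof -
  obtain P where P: "\<And>i. expands (\<lambda>w. X w $ i) q (P i)" using assms unfolding vexpands_def by metis
  define D where "D = (\<lambda>h i. Re (psum (fps_deriv (P i)) (cpoint h)))"
  have "\<forall>\<^sub>F h in nhds 0. \<forall>i\<in>UNIV. ((\<lambda>s. X (s, snd (q + h)) $ i) has_vector_derivative D h i) (at (fst (q + h)))"
    by (rule eventually_ball_finite, simp, unfold D_def, intro ballI) (rule expands_pdu_nearby[OF P])
  then have ev: "\<forall>\<^sub>F h in nhds 0. pdu X (q + h) = (\<chi> i. D h i)"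
  proof eventually_elim
    case (elim h)
    then have "vector_derivative (\<lambda>s. X (s, snd (q + h))) (at (fst (q + h))) = (\<chi> i. D h i)"
      by (intro vector_derivative_components) blast
    then show ?case unfolding pdu_def by (simp add: case_prod_unfold)
  qed
  have "expands (\<lambda>w. pdu X w $ i) q (fps_deriv (P i))" for i
  proof -
    have c: "conv (P i)" "conj2 (P i) = P i" using P[of i] by (auto simp: expands_def)
    from ev have "\<forall>\<^sub>F h in nhds 0. complex_of_real (pdu X (q + h) $ i) = psum (fps_deriv (P i)) (cpoint h)"
    proof eventually_elim
      case (elim h)
      have "cnj (psum (fps_deriv (P i)) (cpoint h)) = psum (fps_deriv (P i)) (cpoint h)"
        using psum_cj[of "fps_deriv (P i)" h] conj2_deriv[OF c(2)] by simp
      then have "Im (psum (fps_deriv (P i)) (cpoint h)) = 0" by (simp add: complex_eq_iff)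
      then show ?case using elim by (simp add: D_def complex_eq_iff)
    qed
    then show ?thesis using c conv_deriv conj2_deriv by (auto simp: expands_def)
  qed
  then show ?thesis unfolding vexpands_def by blast
qed

lemma psum_sw: "psum (swap2 P) (prod.swap h) = psum P h"
proof -
  have "infsum (pterm (swap2 P) (prod.swap h)) UNIV = infsum (pterm (swap2 P) (prod.swap h) \<circ> prod.swap) UNIV"
    by (subst infsum_reindex[symmetric]) (auto simp: inj_on_def)
  also have "pterm (swap2 P) (prod.swap h) \<circ> prod.swap = pterm P h"
    by (auto simp: pterm_def)
  finally show ?thesis by (simp add: psum_def)
qed

lemma expands_swap:
  assumes "expands f q P" shows "expands (f \<circ> prod.swap) (prod.swap q) (swap2 P)"
proof -
  have c: "conv P" "conj2 P = P" and ev: "\<forall>\<^sub>F h in nhds 0. complex_of_real (f (q + h)) = psum P (cpoint h)"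
    using assms by (auto simp: expands_def)
  have "((\<lambda>h. (snd h, fst h)) \<longlongrightarrow> (snd (0 :: real \<times> real), fst (0 :: real \<times> real))) (nhds (0 :: real \<times> real))"
    by (rule tendsto_Pair[OF tendsto_snd[OF filterlim_ident] tendsto_fst[OF filterlim_ident]])
  moreover have "(\<lambda>h::real \<times> real. (snd h, fst h)) = prod.swap" by (auto simp: fun_eq_iff)
  ultimately have "filterlim prod.swap (nhds 0) (nhds (0 :: real \<times> real))"
    by (simp add: zero_prod_def)
  then have "\<forall>\<^sub>F h in nhds 0. complex_of_real (f (q + prod.swap h)) = psum P (cpoint (prod.swap h))"
    using ev by (auto simp: filterlim_iff)
  then have "\<forall>\<^sub>F h in nhds 0. complex_of_real ((f \<circ> prod.swap) (prod.swap q + h)) = psum (swap2 P) (cpoint h)"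
  proof eventually_elim
    case (elim h)
    have "prod.swap (prod.swap q + h) = q + prod.swap h" by (simp add: prod_eq_iff)
    moreover have "psum (swap2 P) (prod.swap (cpoint (prod.swap h))) = psum P (cpoint (prod.swap h))" by (rule psum_sw)
    moreover have "prod.swap (cpoint (prod.swap h)) = cpoint h" by (simp add: cpoint_def)
    ultimately show ?case using elim by simp
  qed
  moreover have "conj2 (swap2 P) = swap2 P"
  proof (rule ps2_eqI)
    fix i j
    have "cnj (cf P j i) = cf P j i" using c(2) conj2_simps(6) by metis
    then show "cf (conj2 (swap2 P)) i j = cf (swap2 P) i j" by simp
  qed
  ultimately show ?thesis using c(1) by (simp add: expands_def)
qed

lemma vexpands_swap: "vexpands X q \<Longrightarrow> vexpands (X \<circ> prod.swap) (prod.swap q)"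
  unfolding vexpands_def
proof
  fix i assume "\<forall>i. \<exists>P. expands (\<lambda>w. X w $ i) q P"
  then obtain P where "expands (\<lambda>w. X w $ i) q P" by blast
  from expands_swap[OF this] show "\<exists>P. expands (\<lambda>w. (X \<circ> prod.swap) w $ i) (prod.swap q) P"
    by (auto simp: o_def)
qed

lemma pdv_swap: "pdv X = pdu (X \<circ> prod.swap) \<circ> prod.swap"
  by (auto simp: pdv_def pdu_def)

lemma vexpands_pdv: "vexpands X q \<Longrightarrow> vexpands (pdv X) q"
  unfolding pdv_swap using vexpands_swap[OF vexpands_pdu[OF vexpands_swap]] by simp

definition analytic_at :: "(real \<times> real \<Rightarrow> real) \<Rightarrow> real \<times> real \<Rightarrow> bool" where
  "analytic_at f q \<longleftrightarrow> (\<exists>P. expands f q P)"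

lemma analytic_at_intros:
  "analytic_at f q \<Longrightarrow> analytic_at g q \<Longrightarrow> analytic_at (\<lambda>w. f w + g w) q"
  "analytic_at f q \<Longrightarrow> analytic_at g q \<Longrightarrow> analytic_at (\<lambda>w. f w - g w) q"
  "analytic_at f q \<Longrightarrow> analytic_at g q \<Longrightarrow> analytic_at (\<lambda>w. f w * g w) q"
  "analytic_at f q \<Longrightarrow> analytic_at (\<lambda>w. - f w) q"
proof -
  show *: "analytic_at f q \<Longrightarrow> analytic_at g q \<Longrightarrow> analytic_at (\<lambda>w. f w - g w) q" for f g
    unfolding analytic_at_def using expands_diff by blast
  have "analytic_at (\<lambda>w. 0) q" unfolding analytic_at_def using expands_const by blast
  from *[OF this, of f] show "analytic_at f q \<Longrightarrow> analytic_at (\<lambda>w. - f w) q" by simp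
  show "analytic_at f q \<Longrightarrow> analytic_at g q \<Longrightarrow> analytic_at (\<lambda>w. f w + g w) q"
    unfolding analytic_at_def using expands_add by blast
  show "analytic_at f q \<Longrightarrow> analytic_at g q \<Longrightarrow> analytic_at (\<lambda>w. f w * g w) q"
    unfolding analytic_at_def using expands_mult by blast
qed

lemma analytic_mink: "vexpands A q \<Longrightarrow> vexpands B q \<Longrightarrow> analytic_at (\<lambda>w. mink (A w) (B w)) q"
  unfolding mink_def vexpands_def
  by (intro analytic_at_intros) (simp_all add: analytic_at_def)

lemma vexpands_cross: "vexpands A q \<Longrightarrow> vexpands B q \<Longrightarrow> vexpands (\<lambda>w. mink_cross (A w) (B w)) q"
  unfolding vexpands_def analytic_at_def[symmetric] mink_cross_def
  by (simp add: forall_3 analytic_at_intros)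

lemma fundamental_forms_expand:
  assumes "vexpands X q"
  obtains E F G l m n where "expands (coeff_E X) q E" "expands (coeff_F X) q F" "expands (coeff_G X) q G"
    "expands (coeff_l X) q l" "expands (coeff_m X) q m" "expands (coeff_n X) q n"
proof -
  have u: "vexpands (pdu X) q" and v: "vexpands (pdv X) q"
    using assms vexpands_pdu vexpands_pdv by blast+
  have "analytic_at (coeff_E X) q" "analytic_at (coeff_F X) q" "analytic_at (coeff_G X) q"
    "analytic_at (coeff_l X) q" "analytic_at (coeff_m X) q" "analytic_at (coeff_n X) q"
    unfolding coeff_E_def[abs_def] coeff_F_def[abs_def] coeff_G_def[abs_def]
      coeff_l_def[abs_def] coeff_m_def[abs_def] coeff_n_def[abs_def]
    by (intro analytic_mink vexpands_cross u v vexpands_pdu vexpands_pdv)+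
  then show ?thesis using that unfolding analytic_at_def by blast
qed

section \<open>The ring of germs and the ring of convergent series\<close>

text \<open>The germ of the sum of a series: a ring isomorphism from the convergent series onto the ring of germs.\<close>

definition sgerm :: "complex \<times> complex \<Rightarrow> ps2 \<Rightarrow> (complex \<times> complex \<Rightarrow> complex) set" where
  "sgerm z P = germ z (\<lambda>w. psum P (w - z))"

lemma eventually_translate:
  fixes z :: "complex \<times> complex"
  shows "(\<forall>\<^sub>F h in nhds 0. Q (z + h)) \<longleftrightarrow> (\<forall>\<^sub>F w in nhds z. Q w)"
proof
  assume "\<forall>\<^sub>F h in nhds 0. Q (z + h)"
  moreover have "((\<lambda>w. w - z) \<longlongrightarrow> z - z) (nhds z)" by (intro tendsto_diff tendsto_const filterlim_ident)
  ultimately have "\<forall>\<^sub>F w in nhds z. Q (z + (w - z))"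
    unfolding filterlim_iff by (auto dest: spec[of _ "\<lambda>h. Q (z + h)"])
  then show "\<forall>\<^sub>F w in nhds z. Q w" by simp
next
  assume "\<forall>\<^sub>F w in nhds z. Q w"
  moreover have "((\<lambda>h. z + h) \<longlongrightarrow> z + 0) (nhds 0)" by (intro tendsto_add tendsto_const filterlim_ident)
  ultimately show "\<forall>\<^sub>F h in nhds 0. Q (z + h)"
    unfolding filterlim_iff by (auto dest: spec[of _ Q])
qed

lemma sgerm_eqI:
  assumes "\<forall>\<^sub>F h in nhds 0. f (z + h) = psum P h" shows "germ z f = sgerm z P"
  unfolding sgerm_def using assms by (intro germ_cong, subst eventually_translate[symmetric]) simp

lemma sgerm_carrier: "conv P \<Longrightarrow> sgerm z P \<in> carrier (O2 z)"
  unfolding sgerm_def O2_carrier using analytic2_at_val by blast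

lemma sgerm_surj:
  assumes "x \<in> carrier (O2 z)" obtains P where "conv P" "x = sgerm z P"
proof -
  obtain f where f: "analytic2_at f z" "x = germ z f" using assms by (auto simp: O2_carrier)
  then obtain c where "has_power_series2 c f z" by (auto simp: analytic2_at_def)
  from power_series2_conv[OF this] show ?thesis using that sgerm_eqI f(2) by blast
qed

lemma sgerm_inject:
  assumes "conv P" "conv Q" "sgerm z P = sgerm z Q" shows "P = Q"
proof -
  have "(\<lambda>w. psum P (w - z)) \<in> sgerm z Q" using germ_self[OF analytic2_at_val[OF assms(1), of z]] assms(3) by (simp add: sgerm_def)
  then have "\<forall>\<^sub>F w in nhds z. psum P (w - z) = psum Q (w - z)" by (simp add: sgerm_def germ_def)
  then have "\<forall>\<^sub>F h in nhds 0. psum P h = psum Q h" by (subst (asm) eventually_translate[symmetric]) simp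
  then show ?thesis using assms psum_unique by blast
qed

lemma sgerm_add: "conv P \<Longrightarrow> conv Q \<Longrightarrow> sgerm z P \<oplus>\<^bsub>O2 z\<^esub> sgerm z Q = sgerm z (P + Q)"
proof -
  assume c: "conv P" "conv Q"
  have "sgerm z P \<oplus>\<^bsub>O2 z\<^esub> sgerm z Q = germ z (\<lambda>w. psum P (w - z) + psum Q (w - z))"
    unfolding sgerm_def by (rule O2_add[OF analytic2_at_val[OF c(1)] analytic2_at_val[OF c(2)]])
  also have "\<dots> = sgerm z (P + Q)" by (rule sgerm_eqI) (use psum_add[OF c] in \<open>simp add: eq_commute\<close>)
  finally show ?thesis .
qed

lemma sgerm_mult: "conv P \<Longrightarrow> conv Q \<Longrightarrow> sgerm z P \<otimes>\<^bsub>O2 z\<^esub> sgerm z Q = sgerm z (P * Q)"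
proof -
  assume c: "conv P" "conv Q"
  have "sgerm z P \<otimes>\<^bsub>O2 z\<^esub> sgerm z Q = germ z (\<lambda>w. psum P (w - z) * psum Q (w - z))"
    unfolding sgerm_def by (rule O2_mult[OF analytic2_at_val[OF c(1)] analytic2_at_val[OF c(2)]])
  also have "\<dots> = sgerm z (P * Q)" by (rule sgerm_eqI) (use psum_mult[OF c] in \<open>simp add: eq_commute\<close>)
  finally show ?thesis .
qed

lemma sgerm_cst: "germ z (\<lambda>_. c) = sgerm z (cst c)"
  by (rule sgerm_eqI) (simp add: psum_cst)

lemma sgerm_0: "\<zero>\<^bsub>O2 z\<^esub> = sgerm z 0"
  unfolding O2_zero sgerm_cst by (simp add: cst_simps)

lemma sgerm_minus:
  assumes "conv P" shows "\<ominus>\<^bsub>O2 z\<^esub> sgerm z P = sgerm z (- P)"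
proof -
  interpret cring "O2 z" by (rule cring_O2)
  have "sgerm z (- P) \<oplus>\<^bsub>O2 z\<^esub> sgerm z P = \<zero>\<^bsub>O2 z\<^esub>"
    using assms by (simp add: sgerm_add sgerm_0)
  then show ?thesis using minus_equality[of "sgerm z (- P)" "sgerm z P"] sgerm_carrier[of P z] sgerm_carrier[of "- P" z] assms by simp
qed

definition conv_ideal :: "ps2 \<Rightarrow> ps2 \<Rightarrow> ps2 set" where
  "conv_ideal H K = {A * H + B * K | A B. conv A \<and> conv B}"

lemma conv_idealI: "conv A \<Longrightarrow> conv B \<Longrightarrow> A * H + B * K \<in> conv_ideal H K"
  by (auto simp: conv_ideal_def)

lemma conv_ideal_conv: "conv H \<Longrightarrow> conv K \<Longrightarrow> P \<in> conv_ideal H K \<Longrightarrow> conv P"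
  by (auto simp: conv_ideal_def)

lemma conv_ideal_gens: "H \<in> conv_ideal H K" "K \<in> conv_ideal H K"
  using conv_idealI[of 1 0 H K] conv_idealI[of 0 1 H K] by auto

lemma conv_ideal_add: "P \<in> conv_ideal H K \<Longrightarrow> Q \<in> conv_ideal H K \<Longrightarrow> P + Q \<in> conv_ideal H K"
proof -
  assume "P \<in> conv_ideal H K" "Q \<in> conv_ideal H K"
  then obtain A B A' B' where *: "conv A" "conv B" "conv A'" "conv B'" "P = A * H + B * K" "Q = A' * H + B' * K"
    by (auto simp: conv_ideal_def)
  have "P + Q = (A + A') * H + (B + B') * K" using *(5,6) by (simp add: algebra_simps)
  then show ?thesis using * conv_idealI[of "A + A'" "B + B'" H K] by simp
qed

lemma conv_ideal_mult: "conv C \<Longrightarrow> P \<in> conv_ideal H K \<Longrightarrow> C * P \<in> conv_ideal H K"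
proof -
  assume C: "conv C" "P \<in> conv_ideal H K"
  then obtain A B where *: "conv A" "conv B" "P = A * H + B * K" by (auto simp: conv_ideal_def)
  have "C * P = (C * A) * H + (C * B) * K" using *(3) by (simp add: algebra_simps)
  then show ?thesis using * C(1) conv_idealI[of "C * A" "C * B" H K] by simp
qed

lemma conv_ideal_subset:
  assumes "H \<in> conv_ideal H' K'" "K \<in> conv_ideal H' K'" shows "conv_ideal H K \<subseteq> conv_ideal H' K'"
proof
  fix P assume "P \<in> conv_ideal H K"
  then obtain A B where *: "conv A" "conv B" "P = A * H + B * K" by (auto simp: conv_ideal_def)
  then show "P \<in> conv_ideal H' K'" using assms conv_ideal_add conv_ideal_mult by metis
qed

lemma genideal_gs:
  assumes "conv H" "conv K"
  shows "genideal (O2 z) {sgerm z H, sgerm z K} = sgerm z ` conv_ideal H K"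
proof -
  interpret cring "O2 z" by (rule cring_O2)
  define J where "J = sgerm z ` conv_ideal H K"
  have cI: "conv P" if "P \<in> conv_ideal H K" for P using conv_ideal_conv[OF assms that] .
  have idJ: "ideal J (O2 z)"
  proof (rule idealI)
    show "subgroup J (add_monoid (O2 z))"
    proof (rule group.subgroupI[OF a_group])
      show "J \<subseteq> carrier (add_monoid (O2 z))" using sgerm_carrier[of _ z] cI by (auto simp: J_def)
      show "J \<noteq> {}" using conv_ideal_gens(1)[of H K] unfolding J_def by blast
      fix a assume "a \<in> J"
      then obtain P where P: "P \<in> conv_ideal H K" "a = sgerm z P" by (auto simp: J_def)
      have "inv\<^bsub>add_monoid (O2 z)\<^esub> a = sgerm z (- P)"
        using sgerm_minus[OF cI[OF P(1)], of z] P(2) by (simp add: a_inv_def)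
      moreover have "- P \<in> conv_ideal H K" using conv_ideal_mult[of "- 1" P H K] P(1) by simp
      ultimately show "inv\<^bsub>add_monoid (O2 z)\<^esub> a \<in> J" by (auto simp: J_def)
    next
      fix a b assume "a \<in> J" "b \<in> J"
      then obtain P Q where P: "P \<in> conv_ideal H K" "a = sgerm z P" "Q \<in> conv_ideal H K" "b = sgerm z Q" by (auto simp: J_def)
      then have "a \<oplus>\<^bsub>O2 z\<^esub> b = sgerm z (P + Q)" using sgerm_add cI by simp
      then show "a \<otimes>\<^bsub>add_monoid (O2 z)\<^esub> b \<in> J" using conv_ideal_add P by (auto simp: J_def)
    qed
    fix a x assume a: "a \<in> J" and x: "x \<in> carrier (O2 z)"
    obtain P where P: "P \<in> conv_ideal H K" "a = sgerm z P" using a by (auto simp: J_def)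
    obtain C where C: "conv C" "x = sgerm z C" using sgerm_surj[OF x] .
    have "x \<otimes>\<^bsub>O2 z\<^esub> a = sgerm z (C * P)" using sgerm_mult cI C P by simp
    then show xa: "x \<otimes>\<^bsub>O2 z\<^esub> a \<in> J" using conv_ideal_mult C P by (auto simp: J_def)
    have "a \<in> carrier (O2 z)" using sgerm_carrier cI P by simp
    then show "a \<otimes>\<^bsub>O2 z\<^esub> x \<in> J" using xa x by (simp add: m_comm)
  qed (rule ring_axioms)
  have gens: "{sgerm z H, sgerm z K} \<subseteq> carrier (O2 z)" using sgerm_carrier assms by auto
  show ?thesis unfolding J_def[symmetric]
  proof
    show "genideal (O2 z) {sgerm z H, sgerm z K} \<subseteq> J"
      by (rule genideal_minimal[OF idJ]) (use conv_ideal_gens in \<open>auto simp: J_def\<close>)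
    interpret I: ideal "genideal (O2 z) {sgerm z H, sgerm z K}" "O2 z" by (rule genideal_ideal[OF gens])
    have g: "sgerm z H \<in> genideal (O2 z) {sgerm z H, sgerm z K}" "sgerm z K \<in> genideal (O2 z) {sgerm z H, sgerm z K}"
      using genideal_self[OF gens] by auto
    show "J \<subseteq> genideal (O2 z) {sgerm z H, sgerm z K}"
    proof
      fix x assume "x \<in> J"
      then obtain A B where AB: "conv A" "conv B" "x = sgerm z (A * H + B * K)" by (auto simp: J_def conv_ideal_def)
      have "x = (sgerm z A \<otimes>\<^bsub>O2 z\<^esub> sgerm z H) \<oplus>\<^bsub>O2 z\<^esub> (sgerm z B \<otimes>\<^bsub>O2 z\<^esub> sgerm z K)"
        using AB assms by (simp add: sgerm_add sgerm_mult conv_mult)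
      then show "x \<in> genideal (O2 z) {sgerm z H, sgerm z K}"
        using I.I_l_closed[OF g(1) sgerm_carrier[OF AB(1)]] I.I_l_closed[OF g(2) sgerm_carrier[OF AB(2)]] I.a_closed by simp
    qed
  qed
qed

text \<open>The inductive definition of dimension adjoins one vector at a time; here the vectors are the images of
  \<open>1, \<eta>, \<eta>\<^sup>2, ...\<close>, and independence says that each is new.\<close>

lemma dimension_from_basis:
  fixes S (structure)
  assumes "ring S"
    and add: "\<And>P Q. conv P \<Longrightarrow> conv Q \<Longrightarrow> \<theta> (P + Q) = \<theta> P \<oplus>\<^bsub>S\<^esub> \<theta> Q"
    and mult: "\<And>P Q. conv P \<Longrightarrow> conv Q \<Longrightarrow> \<theta> (P * Q) = \<theta> P \<otimes>\<^bsub>S\<^esub> \<theta> Q"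
    and carrier: "carrier S = \<theta> ` Collect conv" and zero: "\<theta> 0 = \<zero>\<^bsub>S\<^esub>"
    and ker: "\<And>P Q. conv P \<Longrightarrow> conv Q \<Longrightarrow> \<theta> P = \<theta> Q \<longleftrightarrow> P - Q \<in> conv_ideal f g"
    and basis: "quotient_basis f g n \<eta>"
  shows "ring.dimension S n (range (\<lambda>c. \<theta> (cst c))) (carrier S)"
proof -
  interpret ring S by fact
  define p where "p = (\<lambda>(c :: nat \<Rightarrow> complex) k. \<Sum>i<k. cst (c i) * \<eta> ^ i)"
  define W where "W = (\<lambda>k. \<theta> ` range (\<lambda>c. p c k))"
  have c\<eta>: "conv \<eta>" using basis by (simp add: quotient_basis_def)
  have cp: "conv (p c k)" for c k unfolding p_def using c\<eta> by blast
  have span: "\<exists>A B c. conv A \<and> conv B \<and> h = A * f + B * g + p c n" if "conv h" for h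
    using basis that unfolding quotient_basis_def p_def by blast
  have ind: "c i = 0" if "p c n = A * f + B * g" "i < n" for A B c i
    using basis that unfolding quotient_basis_def p_def by blast
  have "k \<le> n \<Longrightarrow> dimension k (range (\<lambda>c. \<theta> (cst c))) (W k)" for k
  proof (induction k)
    case 0
    have "W 0 = {\<zero>\<^bsub>S\<^esub>}" by (auto simp: W_def p_def zero)
    then show ?case by auto
  next
    case (Suc k)
    have "\<theta> (\<eta> ^ k) \<notin> W k"
    proof
      assume "\<theta> (\<eta> ^ k) \<in> W k"
      then obtain c where "\<theta> (\<eta> ^ k) = \<theta> (p c k)" by (auto simp: W_def)
      then have "\<eta> ^ k - p c k \<in> conv_ideal f g" using ker[of "\<eta> ^ k" "p c k"] c\<eta> cp by auto
      then obtain A B where AB: "\<eta> ^ k - p c k = A * f + B * g" by (auto simp: conv_ideal_def)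
      \<comment> \<open>The relation padded with zeros, so that independence of all \<open>n\<close> powers applies.\<close>
      define d where "d = (\<lambda>i. if i < k then - c i else if i = k then 1 else 0)"
      have "p d n = (\<Sum>i<Suc k. cst (d i) * \<eta> ^ i)" unfolding p_def
        by (rule sum.mono_neutral_right) (use Suc.prems in \<open>auto simp: d_def cst_simps\<close>)
      also have "\<dots> = \<eta> ^ k - p c k"
        by (simp add: d_def p_def cst_simps sum_negf)
      finally have "d k = 0" using ind[of d A B k] AB Suc.prems by simp
      then show False by (simp add: d_def)
    qed
    moreover have "\<theta> (\<eta> ^ k) \<in> carrier S" using c\<eta> by (auto simp: carrier)
    moreover have "W (Suc k) = line_extension (range (\<lambda>c. \<theta> (cst c))) (\<theta> (\<eta> ^ k)) (W k)"
    proof (rule Set.set_eqI)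
      fix x
      have eq: "\<theta> (p c (Suc k)) = \<theta> (cst (c k)) \<otimes>\<^bsub>S\<^esub> \<theta> (\<eta> ^ k) \<oplus>\<^bsub>S\<^esub> \<theta> (p c k)" for c
      proof -
        have "p c (Suc k) = cst (c k) * \<eta> ^ k + p c k" by (simp add: p_def)
        then show ?thesis using add[of "cst (c k) * \<eta> ^ k" "p c k"] mult[of "cst (c k)" "\<eta> ^ k"] c\<eta> cp by auto
      qed
      show "x \<in> W (Suc k) \<longleftrightarrow> x \<in> line_extension (range (\<lambda>c. \<theta> (cst c))) (\<theta> (\<eta> ^ k)) (W k)"
        unfolding line_extension_mem_iff
      proof
        assume "x \<in> W (Suc k)"
        then obtain c where "x = \<theta> (p c (Suc k))" by (auto simp: W_def)
        then show "\<exists>b\<in>range (\<lambda>c. \<theta> (cst c)). \<exists>v\<in>W k. x = b \<otimes>\<^bsub>S\<^esub> \<theta> (\<eta> ^ k) \<oplus>\<^bsub>S\<^esub> v"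
          using eq by (auto simp: W_def)
      next
        assume "\<exists>b\<in>range (\<lambda>c. \<theta> (cst c)). \<exists>v\<in>W k. x = b \<otimes>\<^bsub>S\<^esub> \<theta> (\<eta> ^ k) \<oplus>\<^bsub>S\<^esub> v"
        then obtain b c where x: "x = \<theta> (cst b) \<otimes>\<^bsub>S\<^esub> \<theta> (\<eta> ^ k) \<oplus>\<^bsub>S\<^esub> \<theta> (p c k)" by (auto simp: W_def)
        have "p (c(k := b)) k = p c k" unfolding p_def by (intro sum.cong) auto
        then have "x = \<theta> (p (c(k := b)) (Suc k))" using x eq[of "c(k := b)"] by simp
        then show "x \<in> W (Suc k)" by (auto simp: W_def)
      qed
    qed
    ultimately show ?case using Suc by (auto intro: Suc_dim)
  qed
  moreover have "W n = carrier S"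
  proof
    show "W n \<subseteq> carrier S" using cp by (auto simp: W_def carrier)
    show "carrier S \<subseteq> W n"
    proof
      fix x assume "x \<in> carrier S"
      then obtain h where h: "conv h" "x = \<theta> h" by (auto simp: carrier)
      obtain A B c where *: "conv A" "conv B" "h = A * f + B * g + p c n" using span[OF h(1)] by blast
      then have "h - p c n \<in> conv_ideal f g" using conv_idealI by simp
      then have "x = \<theta> (p c n)" using ker[OF h(1) cp] h(2) by simp
      then show "x \<in> W n" by (auto simp: W_def)
    qed
  qed
  ultimately show ?thesis by (metis order_refl)
qed

theorem has_mult_from_basis:
  assumes h: "expands h q H" and k: "expands k q K"
    and ideal: "conv_ideal H K = conv_ideal f g" and basis: "quotient_basis f g n \<eta>"
  shows "has_mult h k q n"
proof -
  define z where "z = cpoint q"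
  have c: "conv H" "conv K" using h k by (auto simp: expands_def)
  define I where "I = germ_ideal h k q"
  have "germ z (complexify h q) = sgerm z H" "germ z (complexify k q) = sgerm z K"
    using sgerm_eqI expands_complexify[OF h] expands_complexify[OF k] unfolding z_def by blast+
  then have I: "I = sgerm z ` conv_ideal H K"
    unfolding I_def germ_ideal_def z_def[symmetric] using genideal_gs[OF c] by simp
  interpret R: cring "O2 z" by (rule cring_O2)
  have gens: "{sgerm z H, sgerm z K} \<subseteq> carrier (O2 z)" using sgerm_carrier c by auto
  have idI: "ideal I (O2 z)" using R.genideal_ideal[OF gens] genideal_gs[OF c] I by simp
  interpret I: ideal I "O2 z" by (rule idI)
  define S where "S = O2 z Quot I"
  define \<theta> where "\<theta> = (\<lambda>P. I +>\<^bsub>O2 z\<^esub> sgerm z P)"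
  have "ring.dimension S n (range (\<lambda>c. \<theta> (cst c))) (carrier S)"
  proof (rule dimension_from_basis[OF _ _ _ _ _ _ basis])
    show "ring S" unfolding S_def by (rule I.quotient_is_ring)
    show "carrier S = \<theta> ` Collect conv"
    proof -
      have "carrier (O2 z) = sgerm z ` Collect conv" using sgerm_carrier sgerm_surj by blast
      then show ?thesis unfolding S_def FactRing_def A_RCOSETS_def' \<theta>_def by auto
    qed
    show "\<theta> 0 = \<zero>\<^bsub>S\<^esub>"
      unfolding \<theta>_def S_def FactRing_def sgerm_0[symmetric] using I.a_rcos_const[OF additive_subgroup.zero_closed[OF ideal.axioms(1)[OF idI]]] by simp
    fix P Q assume PQ: "conv P" "conv Q"
    note car = sgerm_carrier[OF PQ(1), of z] sgerm_carrier[OF PQ(2), of z]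
    show "\<theta> (P + Q) = \<theta> P \<oplus>\<^bsub>S\<^esub> \<theta> Q"
      unfolding \<theta>_def S_def FactRing_def using I.a_rcos_sum[OF car] sgerm_add[OF PQ, of z] by simp
    show "\<theta> (P * Q) = \<theta> P \<otimes>\<^bsub>S\<^esub> \<theta> Q"
      unfolding \<theta>_def S_def FactRing_def using I.rcoset_mult_add[OF car] sgerm_mult[OF PQ, of z] by simp
    have "sgerm z P \<ominus>\<^bsub>O2 z\<^esub> sgerm z Q = sgerm z (P - Q)"
      unfolding a_minus_def using sgerm_minus[OF PQ(2)] sgerm_add[of P "- Q" z] PQ by auto
    then have "\<theta> P = \<theta> Q \<longleftrightarrow> sgerm z (P - Q) \<in> I"
      using R.quotient_eq_iff_same_a_r_cos[OF idI car] unfolding \<theta>_def by simp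
    also have "\<dots> \<longleftrightarrow> P - Q \<in> conv_ideal H K"
    proof
      assume "sgerm z (P - Q) \<in> I"
      then obtain T where T: "T \<in> conv_ideal H K" "sgerm z (P - Q) = sgerm z T" by (auto simp: I)
      have "P - Q = T" by (rule sgerm_inject[OF _ _ T(2)]) (use PQ conv_ideal_conv[OF c T(1)] in auto)
      then show "P - Q \<in> conv_ideal H K" using T(1) by simp
    qed (auto simp: I)
    finally show "\<theta> P = \<theta> Q \<longleftrightarrow> P - Q \<in> conv_ideal f g" unfolding ideal .
  qed
  moreover have "range (\<lambda>c. \<theta> (cst c)) = range (\<lambda>c. I +>\<^bsub>O2 z\<^esub> germ z (\<lambda>_. c))"
    unfolding \<theta>_def sgerm_cst ..
  ultimately show ?thesis unfolding has_mult_def Let_def S_def I_def z_def by simp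
qed

section \<open>Factoring the discriminant\<close>

text \<open>With \<open>t\<^sup>2 = B\<^sup>2 - A C\<close> and \<open>w = B + t\<close> one has \<open>A C = (B - t) w\<close>, so
  \<open>A U\<^sup>2 + 2 B U V + C V\<^sup>2 = (A U + w V) (U + (C / w) V)\<close>. The sign of \<open>t\<close> is
  chosen so that \<open>w\<close> is a unit. The linear
  map from \<open>(U, V)\<close> to the factors has determinant \<open>-2 t\<close>, a unit, so the ideals agree.\<close>

lemma binary_form_factors:
  assumes c: "conv U" "conv V" "conv A" "conv B" "conv C" "conv s"
    and disc: "B\<^sup>2 - A * C = s\<^sup>2" and s0: "cf s 0 0 \<noteq> 0"
    and 0: "cf U 0 0 = 0" "cf V 0 0 = 0"
  obtains f g where "conv f" "conv g" "cf f 0 0 = 0" "cf g 0 0 = 0"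
    "f * g = A * U\<^sup>2 + 2 * B * U * V + C * V\<^sup>2" "conv_ideal f g = conv_ideal U V"
    "\<lbrakk>conj2 U = U; conj2 V = V; conj2 A = A; conj2 B = B; conj2 C = C; conj2 s = s\<rbrakk> \<Longrightarrow> conj2 f = f \<and> conj2 g = g"
proof -
  \<comment> \<open>Since \<open>s\<close> is a unit, \<open>B + s\<close> and \<open>B - s\<close> cannot both vanish at the point.\<close>
  define t where "t = (if cf (B + s) 0 0 = 0 then - s else s)"
  have t2: "t * t = s\<^sup>2" by (simp add: t_def power2_eq_square)
  have t0: "cf t 0 0 \<noteq> 0" using s0 by (simp add: t_def)
  have ct: "conv t" using c(6) by (auto simp: t_def)
  define w where "w = B + t"
  have w0: "cf w 0 0 \<noteq> 0"
  proof (cases "cf (B + s) 0 0 = 0")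
    case True
    then have "cf B 0 0 = - cf s 0 0" by (simp add: add_eq_0_iff)
    then show ?thesis using True s0 by (simp add: w_def t_def)
  qed (simp add: w_def t_def)
  have cw: "conv w" using c ct by (auto simp: w_def)
  obtain w' where w': "w * w' = 1" "conv w'" using unit_inverse[OF w0] cw by metis
  have "cf (2 * t) 0 0 \<noteq> 0" using t0 by (simp add: numeral_cst cf_cst_mult cf_cst)
  then obtain t' where t': "(2 * t) * t' = 1" "conv t'" using unit_inverse[of "2 * t"] ct by (metis conv_mult conv_numeral)
  have AC: "A * C = (B - t) * w"
    using disc t2 by (simp add: w_def algebra_simps power2_eq_square)
  have ACw: "A * C * w' = B - t"
  proof -
    have "A * C * w' = (B - t) * (w * w')" unfolding AC by (simp only: mult_ac)
    then show ?thesis by (simp add: w')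
  qed
  define f where "f = A * U + w * V"
  define g where "g = U + (C * w') * V"
  have "f * g = A * U\<^sup>2 + (A * C * w' + w) * U * V + (w * w') * C * V\<^sup>2"
    by (simp add: f_def g_def power2_eq_square algebra_simps)
  also have "A * C * w' + w = 2 * B" unfolding ACw by (simp add: w_def)
  finally have fg: "f * g = A * U\<^sup>2 + 2 * B * U * V + C * V\<^sup>2" by (simp add: w')
  have cf: "conv f" "conv g" using c cw w' by (auto simp: f_def g_def)
  have f_in: "f \<in> conv_ideal U V" "g \<in> conv_ideal U V"
    using conv_idealI[of A w U V] conv_idealI[of 1 "C * w'" U V] c cw w' by (auto simp: f_def g_def)
  have "f + (- A) * g = (w - A * C * w') * V" by (simp add: f_def g_def algebra_simps)
  also have "\<dots> = (2 * t) * V" unfolding ACw by (simp add: w_def)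
  finally have ft: "f + (- A) * g = (2 * t) * V" .
  have "V = (2 * t * t') * V" unfolding t'(1) by simp
  also have "\<dots> = t' * ((2 * t) * V)" by (simp only: mult_ac)
  also have "\<dots> = t' * (1 * f + (- A) * g)" by (simp flip: ft)
  finally have V: "V \<in> conv_ideal f g"
    using conv_ideal_mult[OF t'(2) conv_idealI[of 1 "- A" f g]] c by simp
  have "U = g + (- (C * w')) * V" by (simp add: g_def)
  then have U: "U \<in> conv_ideal f g"
    using conv_ideal_add[OF conv_ideal_gens(2) conv_ideal_mult[OF _ V, of "- (C * w')"]] c w' by auto
  have ideal: "conv_ideal f g = conv_ideal U V"
    using conv_ideal_subset f_in U V by blast
  have real: "conj2 f = f \<and> conj2 g = g" if "conj2 U = U" "conj2 V = V" "conj2 A = A" "conj2 B = B" "conj2 C = C" "conj2 s = s"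
  proof -
    have "conj2 w = w" using that by (simp add: w_def t_def)
    moreover from conj2_inverse[OF w'(1) this] have "conj2 w' = w'" .
    ultimately show ?thesis using that by (simp add: f_def g_def)
  qed
  have f0: "cf f 0 0 = 0" "cf g 0 0 = 0" using 0 by (simp_all add: f_def g_def)
  show ?thesis by (rule that[OF cf f0 fg ideal]) (rule real)
qed

lemma conv_ideal_commute: "conv_ideal H K = conv_ideal K H"
  using conv_ideal_subset[of H K H] conv_ideal_subset[of K H K] conv_ideal_gens by blast

text \<open>If \<open>E\<close> is a unit, \<open>a = (F b - G c) / E\<close> turns \<open>b\<^sup>2 - 4 a c\<close> into
  \<open>b\<^sup>2 - 4 (F / E) b c + 4 (G / E) c\<^sup>2\<close>, and \<open>B\<^sup>2 - A C\<close> is \<open>(2 s / E)\<^sup>2\<close>.\<close>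

lemma discriminant_factors_unit:
  assumes c: "conv E" "conv F" "conv G" "conv b" "conv c" "conv s"
    and rel: "E * a - F * b + G * c = 0" and s: "F\<^sup>2 - E * G = s\<^sup>2" and s0: "cf s 0 0 \<noteq> 0"
    and 0: "cf b 0 0 = 0" "cf c 0 0 = 0" and E: "cf E 0 0 \<noteq> 0"
  shows "\<exists>f g. conv f \<and> conv g \<and> cf f 0 0 = 0 \<and> cf g 0 0 = 0 \<and> f * g = b\<^sup>2 - 4 * a * c \<and>
     conv_ideal f g = conv_ideal b c \<and>
     (conj2 E = E \<and> conj2 F = F \<and> conj2 G = G \<and> conj2 b = b \<and> conj2 c = c \<and> conj2 s = s \<longrightarrow> conj2 f = f \<and> conj2 g = g)"
proof -
  obtain E' where E': "E * E' = 1" "conv E'" using unit_inverse[OF E] c(1) by metis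
  have E'0: "cf E' 0 0 \<noteq> 0" using unit_cf[OF E'(1)] by auto
  have disc: "(- 2 * (E' * F))\<^sup>2 - 1 * (4 * (E' * G)) = (2 * (E' * s))\<^sup>2"
  proof -
    have "(- 2 * (E' * F))\<^sup>2 - 1 * (4 * (E' * G)) = (2 * (E' * s))\<^sup>2 + 4 * (E' * E') * (F\<^sup>2 - E * G - s\<^sup>2) + 4 * (E' * G) * (E * E' - 1)"
      by (simp add: algebra_simps power2_eq_square)
    then show ?thesis unfolding E'(1) s by simp
  qed
  have prod: "1 * b\<^sup>2 + 2 * (- 2 * (E' * F)) * b * c + 4 * (E' * G) * c\<^sup>2 = b\<^sup>2 - 4 * a * c"
  proof -
    have "1 * b\<^sup>2 + 2 * (- 2 * (E' * F)) * b * c + 4 * (E' * G) * c\<^sup>2 = b\<^sup>2 - 4 * a * c + 4 * (E' * c) * (E * a - F * b + G * c) + 4 * (a * c) * (1 - E * E')"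
      by (simp add: algebra_simps power2_eq_square)
    then show ?thesis unfolding E'(1) rel by simp
  qed
  have cv: "conv 1" "conv (- 2 * (E' * F))" "conv (4 * (E' * G))" "conv (2 * (E' * s))"
    using c E' by auto
  have n0: "cf (2 * (E' * s)) 0 0 \<noteq> 0" using E'0 s0 by (simp add: numeral_cst cf_cst_mult cf_cst)
  obtain f g where fg: "conv f" "conv g" "cf f 0 0 = 0" "cf g 0 0 = 0"
    "f * g = 1 * b\<^sup>2 + 2 * (- 2 * (E' * F)) * b * c + 4 * (E' * G) * c\<^sup>2" "conv_ideal f g = conv_ideal b c"
    "\<lbrakk>conj2 b = b; conj2 c = c; conj2 1 = 1; conj2 (- 2 * (E' * F)) = - 2 * (E' * F);
      conj2 (4 * (E' * G)) = 4 * (E' * G); conj2 (2 * (E' * s)) = 2 * (E' * s)\<rbrakk> \<Longrightarrow> conj2 f = f \<and> conj2 g = g"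
    using binary_form_factors[OF c(4,5) cv disc n0 0] by blast
  have real: "conj2 f = f \<and> conj2 g = g" if r: "conj2 E = E \<and> conj2 F = F \<and> conj2 G = G \<and> conj2 b = b \<and> conj2 c = c \<and> conj2 s = s"
  proof -
    have "conj2 E' = E'" using conj2_inverse[OF E'(1)] r by blast
    then show ?thesis using r by (intro fg(7)) simp_all
  qed
  have "f * g = b\<^sup>2 - 4 * a * c" unfolding fg(5) by (rule prod)
  then show ?thesis using fg(1-4,6) real by blast
qed

text \<open>The cases \<open>E\<close> and \<open>G\<close> are exchanged by the symmetry \<open>a \<leftrightarrow> c\<close>, \<open>E \<leftrightarrow> G\<close> of the relation. If \<open>F\<close> is a unit,
  eliminating \<open>b\<close> gives a form in \<open>a\<close>, \<open>c\<close> whose outer coefficients may vanish at the point. The factors depend on the case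
  chosen, but the ideal \<open>(a, b, c)\<close> they generate does not, so one pair \<open>f\<close>, \<open>g\<close> serves all the equalities.\<close>

lemma principal_discriminant_factors:
  assumes c: "conv E" "conv F" "conv G" "conv a" "conv b" "conv c" "conv s"
    and rel: "E * a - F * b + G * c = 0" and s: "F\<^sup>2 - E * G = s\<^sup>2" and s0: "cf s 0 0 \<noteq> 0"
    and 0: "cf a 0 0 = 0" "cf b 0 0 = 0" "cf c 0 0 = 0"
  obtains f g where "conv f" "conv g" "cf f 0 0 = 0" "cf g 0 0 = 0" "f * g = b\<^sup>2 - 4 * a * c"
    "cf E 0 0 \<noteq> 0 \<Longrightarrow> conv_ideal b c = conv_ideal f g"
    "cf F 0 0 \<noteq> 0 \<Longrightarrow> conv_ideal a c = conv_ideal f g"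
    "cf G 0 0 \<noteq> 0 \<Longrightarrow> conv_ideal a b = conv_ideal f g"
    "\<lbrakk>conj2 E = E; conj2 F = F; conj2 G = G; conj2 a = a; conj2 b = b; conj2 c = c; conj2 s = s\<rbrakk> \<Longrightarrow> conj2 f = f \<and> conj2 g = g"
proof -
  have a_in: "a \<in> conv_ideal b c" if E: "E * E' = 1" "conv E'" for E'
  proof -
    have "a = E' * (E * a - F * b + G * c) + (E' * F) * b + (- (E' * G)) * c + (1 - E * E') * a"
      by (simp add: algebra_simps)
    then have "a = (E' * F) * b + (- (E' * G)) * c" unfolding rel E(1) by simp
    then show ?thesis using conv_idealI[of "E' * F" "- (E' * G)" b c] c E by auto
  qed
  have b_in: "b \<in> conv_ideal a c" if F: "F * F' = 1" "conv F'" for F'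
  proof -
    have "b = - F' * (E * a - F * b + G * c) + (F' * E) * a + (F' * G) * c + (1 - F * F') * b"
      by (simp add: algebra_simps)
    then have "b = (F' * E) * a + (F' * G) * c" unfolding rel F(1) by simp
    then show ?thesis using conv_idealI[of "F' * E" "F' * G" a c] c F by auto
  qed
  have c_in: "c \<in> conv_ideal a b" if G: "G * G' = 1" "conv G'" for G'
  proof -
    have "c = G' * (E * a - F * b + G * c) + (- (G' * E)) * a + (G' * F) * b + (1 - G * G') * c"
      by (simp add: algebra_simps)
    then have "c = (- (G' * E)) * a + (G' * F) * b" unfolding rel G(1) by simp
    then show ?thesis using conv_idealI[of "- (G' * E)" "G' * F" a b] c G by auto
  qed
  have E_sub: "conv_ideal a c \<subseteq> conv_ideal b c" "conv_ideal a b \<subseteq> conv_ideal b c" if "cf E 0 0 \<noteq> 0"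
    using unit_inverse[OF that] c(1) a_in conv_ideal_gens by (metis conv_ideal_subset)+
  have F_sub: "conv_ideal b c \<subseteq> conv_ideal a c" "conv_ideal a b \<subseteq> conv_ideal a c" if "cf F 0 0 \<noteq> 0"
    using unit_inverse[OF that] c(2) b_in conv_ideal_gens by (metis conv_ideal_subset)+
  have G_sub: "conv_ideal b c \<subseteq> conv_ideal a b" "conv_ideal a c \<subseteq> conv_ideal a b" if "cf G 0 0 \<noteq> 0"
    using unit_inverse[OF that] c(3) c_in conv_ideal_gens by (metis conv_ideal_subset)+
  have "\<exists>f g. conv f \<and> conv g \<and> cf f 0 0 = 0 \<and> cf g 0 0 = 0 \<and> f * g = b\<^sup>2 - 4 * a * c \<and>
     (cf E 0 0 \<noteq> 0 \<longrightarrow> conv_ideal b c = conv_ideal f g) \<and>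
     (cf F 0 0 \<noteq> 0 \<longrightarrow> conv_ideal a c = conv_ideal f g) \<and>
     (cf G 0 0 \<noteq> 0 \<longrightarrow> conv_ideal a b = conv_ideal f g) \<and>
     (conj2 E = E \<and> conj2 F = F \<and> conj2 G = G \<and> conj2 a = a \<and> conj2 b = b \<and> conj2 c = c \<and> conj2 s = s \<longrightarrow> conj2 f = f \<and> conj2 g = g)"
  proof -
    have "cf (F\<^sup>2 - E * G) 0 0 \<noteq> 0" unfolding s using s0 by (simp add: power2_eq_square)
    then have "\<not> (cf E 0 0 = 0 \<and> cf F 0 0 = 0 \<and> cf G 0 0 = 0)"
      by (auto simp: power2_eq_square)
    then consider (E) "cf E 0 0 \<noteq> 0" | (F) "cf F 0 0 \<noteq> 0" | (G) "cf G 0 0 \<noteq> 0"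
      by blast
    then show ?thesis
    proof cases
      case E
      obtain f g where fg: "conv f" "conv g" "cf f 0 0 = 0" "cf g 0 0 = 0" "f * g = b\<^sup>2 - 4 * a * c"
        "conv_ideal f g = conv_ideal b c"
        "conj2 E = E \<and> conj2 F = F \<and> conj2 G = G \<and> conj2 b = b \<and> conj2 c = c \<and> conj2 s = s \<longrightarrow> conj2 f = f \<and> conj2 g = g"
        using discriminant_factors_unit[OF c(1-3,5-7) rel s s0 0(2,3) E] by blast
      moreover have "cf F 0 0 \<noteq> 0 \<Longrightarrow> conv_ideal a c = conv_ideal f g"
        "cf G 0 0 \<noteq> 0 \<Longrightarrow> conv_ideal a b = conv_ideal f g"
        unfolding fg(6) using E_sub[OF E] F_sub G_sub by blast+
      ultimately show ?thesis by blast
    next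
      case F
      obtain F' where F': "F * F' = 1" "conv F'" using unit_inverse[OF F] c(2) by metis
      have F'0: "cf F' 0 0 \<noteq> 0" using unit_cf[OF F'(1)] by auto
      have disc: "(F' * F' * E * G - 2)\<^sup>2 - (F' * F' * E * E) * (F' * F' * G * G) = (2 * (F' * s))\<^sup>2"
      proof -
        have "(F' * F' * E * G - 2)\<^sup>2 - (F' * F' * E * E) * (F' * F' * G * G) = (2 * (F' * s))\<^sup>2 + 4 * (F' * F') * (F\<^sup>2 - E * G - s\<^sup>2) + 4 * (1 - F * F') * (1 + F * F')"
          by (simp add: algebra_simps power2_eq_square)
        then show ?thesis unfolding F'(1) s by simp
      qed
      have prod: "(F' * F' * E * E) * a\<^sup>2 + 2 * (F' * F' * E * G - 2) * a * c + (F' * F' * G * G) * c\<^sup>2 = b\<^sup>2 - 4 * a * c"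
      proof -
        have "(F' * F' * E * E) * a\<^sup>2 + 2 * (F' * F' * E * G - 2) * a * c + (F' * F' * G * G) * c\<^sup>2 = b\<^sup>2 - 4 * a * c + (F' * F') * ((E * a - F * b + G * c) * (E * a + G * c + F * b)) + b\<^sup>2 * ((F * F' - 1) * (F * F' + 1))"
          by (simp add: algebra_simps power2_eq_square)
        then show ?thesis unfolding F'(1) rel by simp
      qed
      have cv: "conv (F' * F' * E * E)" "conv (F' * F' * E * G - 2)" "conv (F' * F' * G * G)" "conv (2 * (F' * s))"
        using c F' by auto
      have n0: "cf (2 * (F' * s)) 0 0 \<noteq> 0" using F'0 s0 by (simp add: numeral_cst cf_cst_mult cf_cst)
      obtain f g where fg: "conv f" "conv g" "cf f 0 0 = 0" "cf g 0 0 = 0"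
        "f * g = (F' * F' * E * E) * a\<^sup>2 + 2 * (F' * F' * E * G - 2) * a * c + (F' * F' * G * G) * c\<^sup>2"
        "conv_ideal f g = conv_ideal a c"
        "\<lbrakk>conj2 a = a; conj2 c = c; conj2 (F' * F' * E * E) = F' * F' * E * E; conj2 (F' * F' * E * G - 2) = F' * F' * E * G - 2;
          conj2 (F' * F' * G * G) = F' * F' * G * G; conj2 (2 * (F' * s)) = 2 * (F' * s)\<rbrakk> \<Longrightarrow> conj2 f = f \<and> conj2 g = g"
        using binary_form_factors[OF c(4,6) cv disc n0 0(1,3)] by blast
      have real: "conj2 f = f \<and> conj2 g = g" if r: "conj2 E = E \<and> conj2 F = F \<and> conj2 G = G \<and> conj2 a = a \<and> conj2 b = b \<and> conj2 c = c \<and> conj2 s = s"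
      proof -
        have "conj2 F' = F'" using conj2_inverse[OF F'(1)] r by blast
        then show ?thesis using r by (intro fg(7)) simp_all
      qed
      have "f * g = b\<^sup>2 - 4 * a * c" unfolding fg(5) by (rule prod)
      moreover have "cf E 0 0 \<noteq> 0 \<Longrightarrow> conv_ideal b c = conv_ideal f g"
        "cf F 0 0 \<noteq> 0 \<Longrightarrow> conv_ideal a c = conv_ideal f g"
        "cf G 0 0 \<noteq> 0 \<Longrightarrow> conv_ideal a b = conv_ideal f g"
        unfolding fg(6) using F_sub[OF F] E_sub F_sub G_sub by blast+
      ultimately show ?thesis using fg(1-4) real by blast
    next
      case G
      have rel': "G * c - F * b + E * a = 0" using rel by (simp add: algebra_simps)
      have s': "F\<^sup>2 - G * E = s\<^sup>2" using s by (simp add: mult.commute)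
      obtain f g where fg: "conv f" "conv g" "cf f 0 0 = 0" "cf g 0 0 = 0" "f * g = b\<^sup>2 - 4 * c * a"
        "conv_ideal f g = conv_ideal b a"
        "conj2 G = G \<and> conj2 F = F \<and> conj2 E = E \<and> conj2 b = b \<and> conj2 a = a \<and> conj2 s = s \<longrightarrow> conj2 f = f \<and> conj2 g = g"
        using discriminant_factors_unit[OF c(3,2,1,5,4,7) rel' s' s0 0(2,1) G] by blast
      have "f * g = b\<^sup>2 - 4 * a * c" using fg(5) by (simp add: mult_ac)
      moreover have "conv_ideal a b = conv_ideal f g" using fg(6) conv_ideal_commute by metis
      moreover from this have "cf E 0 0 \<noteq> 0 \<Longrightarrow> conv_ideal b c = conv_ideal f g"
        "cf F 0 0 \<noteq> 0 \<Longrightarrow> conv_ideal a c = conv_ideal f g"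
        using G_sub[OF G] E_sub F_sub by blast+
      ultimately show ?thesis using fg(1-4,7) by blast
    qed
  qed
  then show ?thesis using that by metis
qed

lemma umbilic_multiplicity_setup:
  assumes par: "local_parametrisation M U X" "q \<in> U" and umb: "umbilic X q"
    and nondeg: "(coeff_F X q)\<^sup>2 - coeff_E X q * coeff_G X q \<noteq> 0"
  obtains f g where "conv f" "conv g" "cf f 0 0 = 0" "cf g 0 0 = 0" "expands (lpc_delta X) q (f * g)"
    "timelike_at X q \<longrightarrow> conj2 f = f \<and> conj2 g = g"
    "\<forall>n. isect_num f g n \<or> isect_num g f n \<longrightarrow> umbilic_mult X q n"
proof -
  have "\<exists>P. expands (\<lambda>w. X w $ i) q P" for i
  proof -
    have "analytic2_at (\<lambda>w. X w $ i) q" using par unfolding local_parametrisation_def by blast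
    from analytic2_at_complexify_expands[OF this] show ?thesis by metis
  qed
  then have "vexpands X q" by (simp add: vexpands_def)
  from fundamental_forms_expand[OF this] obtain E F G l m n where e:
    "expands (coeff_E X) q E" "expands (coeff_F X) q F" "expands (coeff_G X) q G"
    "expands (coeff_l X) q l" "expands (coeff_m X) q m" "expands (coeff_n X) q n" .
  define a where "a = F * n - G * m"
  define b where "b = E * n - G * l"
  define c where "c = E * m - F * l"
  have ea: "expands (lpc_a X) q a" unfolding lpc_a_def[abs_def] a_def by (intro expands_diff expands_mult e)
  have eb: "expands (lpc_b X) q b" unfolding lpc_b_def[abs_def] b_def by (intro expands_diff expands_mult e)
  have ec: "expands (lpc_c X) q c" unfolding lpc_c_def[abs_def] c_def by (intro expands_diff expands_mult e)
  have ed: "expands (lpc_delta X) q (b\<^sup>2 - 4 * a * c)"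
  proof -
    have "expands (\<lambda>w. lpc_b X w * lpc_b X w - 4 * lpc_a X w * lpc_c X w) q (b * b - cst (complex_of_real 4) * a * c)"
      by (intro expands_diff expands_mult expands_const ea eb ec)
    then show ?thesis by (simp add: lpc_delta_def[abs_def] power2_eq_square numeral_cst)
  qed
  define D where "D = F\<^sup>2 - E * G"
  have cv: "conv E" "conv F" "conv G" "conv a" "conv b" "conv c" and
    cjs: "conj2 E = E" "conj2 F = F" "conj2 G = G" "conj2 a = a" "conj2 b = b" "conj2 c = c"
    using e ea eb ec by (auto simp: expands_def)
  have D0: "cf D 0 0 = complex_of_real ((coeff_F X q)\<^sup>2 - coeff_E X q * coeff_G X q)"
    using expands_00[OF e(1)] expands_00[OF e(2)] expands_00[OF e(3)] by (simp add: D_def power2_eq_square)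
  define d where "d = csqrt (cf D 0 0)"
  have d: "cf D 0 0 = d\<^sup>2" "d \<noteq> 0" using D0 nondeg by (auto simp: d_def simp flip: of_real_power of_real_mult of_real_diff)
  have "conv D" using cv by (auto simp: D_def)
  from unit_sqrt[OF this d] obtain s where s: "conv s" "s\<^sup>2 = D" "cf s 0 0 = d" .
  have rel: "E * a - F * b + G * c = 0" by (simp add: a_def b_def c_def algebra_simps)
  have z: "cf a 0 0 = 0" "cf b 0 0 = 0" "cf c 0 0 = 0"
    using expands_00[OF ea] expands_00[OF eb] expands_00[OF ec] umb by (auto simp: umbilic_def)
  have sD: "F\<^sup>2 - E * G = s\<^sup>2" using s(2) by (simp add: D_def)
  have s0: "cf s 0 0 \<noteq> 0" using s(3) d(2) by simp
  obtain f g where fg: "conv f" "conv g" "cf f 0 0 = 0" "cf g 0 0 = 0" "f * g = b\<^sup>2 - 4 * a * c"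
    "cf E 0 0 \<noteq> 0 \<Longrightarrow> conv_ideal b c = conv_ideal f g"
    "cf F 0 0 \<noteq> 0 \<Longrightarrow> conv_ideal a c = conv_ideal f g"
    "cf G 0 0 \<noteq> 0 \<Longrightarrow> conv_ideal a b = conv_ideal f g"
    "\<lbrakk>conj2 E = E; conj2 F = F; conj2 G = G; conj2 a = a; conj2 b = b; conj2 c = c; conj2 s = s\<rbrakk> \<Longrightarrow> conj2 f = f \<and> conj2 g = g"
    using principal_discriminant_factors[OF cv s(1) rel sD s0 z] by blast
  have real: "conj2 f = f \<and> conj2 g = g" if "timelike_at X q"
  proof -
    have "Im (csqrt (complex_of_real ((coeff_F X q)\<^sup>2 - coeff_E X q * coeff_G X q))) = 0"
      using that by (simp add: timelike_at_def del: of_real_diff)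
    then have "Im (cf s 0 0) = 0" unfolding s(3) d_def D0 .
    moreover have "conj2 D = D" using cjs by (simp add: D_def)
    ultimately have "conj2 s = s" using conj2_sqrt[OF _ s(2)] s0 by blast
    then show ?thesis using fg(9) cjs by blast
  qed
  have mult: "umbilic_mult X q k" if k: "isect_num f g k \<or> isect_num g f k" for k
  proof -
    have "\<exists>H K \<eta>. conv_ideal H K = conv_ideal f g \<and> quotient_basis H K k \<eta>"
      using k isect_num_quotient_basis fg(1,2) conv_ideal_commute by metis
    then obtain H K \<eta> where HK: "conv_ideal f g = conv_ideal H K" "quotient_basis H K k \<eta>" by metis
    have hm: "has_mult h h' q k" if "expands h q P" "expands h' q P'" "conv_ideal P P' = conv_ideal f g" for h h' P P'
      using has_mult_from_basis[OF that(1,2) _ HK(2)] that(3) HK(1) by simp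
    show ?thesis unfolding umbilic_mult_def
    proof (intro conjI impI)
      show "coeff_E X q \<noteq> 0 \<or> coeff_F X q \<noteq> 0 \<or> coeff_G X q \<noteq> 0" using nondeg by auto
      show "has_mult (lpc_b X) (lpc_c X) q k" if "coeff_E X q \<noteq> 0"
        using that expands_00[OF e(1)] by (intro hm[OF eb ec] fg(6)) simp
      show "has_mult (lpc_a X) (lpc_c X) q k" if "coeff_F X q \<noteq> 0"
        using that expands_00[OF e(2)] by (intro hm[OF ea ec] fg(7)) simp
      show "has_mult (lpc_a X) (lpc_b X) q k" if "coeff_G X q \<noteq> 0"
        using that expands_00[OF e(3)] by (intro hm[OF ea eb] fg(8)) simp
    qed
  qed
  have "expands (lpc_delta X) q (f * g)" unfolding fg(5) by (rule ed)
  moreover have "timelike_at X q \<longrightarrow> conj2 f = f \<and> conj2 g = g" using real by blast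
  moreover have "\<forall>n. isect_num f g n \<or> isect_num g f n \<longrightarrow> umbilic_mult X q n" using mult by blast
  ultimately show ?thesis by (rule that[OF fg(1-4)])
qed

section \<open>Pulling the factorisation back along the right-equivalence\<close>

lemma taylor_cnj: assumes "taylor f q P" shows "taylor (\<lambda>w. cnj (f w)) q (conj2 P)"
  unfolding taylor_def jet_def
proof
  fix N
  have tpoly: "tpoly N (conj2 P) h = cnj (tpoly N P h)" for h
    by (simp add: tpoly_def mono2_def)
  have "bigO N (\<lambda>h. f (q + h) - tpoly N P h)" using assms by (simp add: taylor_def jet_def)
  moreover have "norm (cnj (f (q + h)) - tpoly N (conj2 P) h) = norm (f (q + h) - tpoly N P h)" for h
    unfolding tpoly complex_cnj_diff[symmetric] by (rule complex_mod_cnj)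
  ultimately show "bigO N (\<lambda>h. cnj (f (q + h)) - tpoly N (conj2 P) h)" by (simp only: bigO_def)
qed

lemma taylor_power: "taylor f q P \<Longrightarrow> taylor (\<lambda>w. f w ^ n) q (P ^ n)"
proof (induction n)
  case 0 then show ?case using taylor_const[of 1 q] by (simp add: cst_simps)
next
  case (Suc n) then show ?case using taylor_mult[of f q P "\<lambda>w. f w ^ n" "P ^ n"] by simp
qed

lemma isect_num_uminus: "isect_num f g n \<Longrightarrow> isect_num (- f) g n" "isect_num f g n \<Longrightarrow> isect_num f (- g) n"
proof -
  have o: "ord_ge n (- P) \<longleftrightarrow> ord_ge n P" for n P by (simp add: ord_ge_def)
  have 1: "contact (- f) g n \<longleftrightarrow> contact f g n" for n
  proof
    assume "contact (- f) g n"
    then obtain A where "ord_ge n (g - A * (- f))" by (auto simp: contact_def)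
    then show "contact f g n" unfolding contact_def by (intro exI[of _ "- A"]) simp
  next
    assume "contact f g n"
    then obtain A where "ord_ge n (g - A * f)" by (auto simp: contact_def)
    then show "contact (- f) g n" unfolding contact_def by (intro exI[of _ "- A"]) simp
  qed
  have "contact f (- g) n" if "contact f g n" for g n
  proof -
    obtain A where "ord_ge n (g - A * f)" using \<open>contact f g n\<close> by (auto simp: contact_def)
    then have "ord_ge n (- (g - A * f))" by (simp only: o)
    then show ?thesis unfolding contact_def by (intro exI[of _ "- A"]) simp
  qed
  from this[of g] this[of "- g"] have 2: "contact f (- g) n \<longleftrightarrow> contact f g n" for n by auto
  show "isect_num f g n \<Longrightarrow> isect_num (- f) g n" "isect_num f g n \<Longrightarrow> isect_num f (- g) n"
    using 1 2 o by (auto simp: isect_num_def)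
qed

text \<open>The factors composed with \<open>\<phi>\<close> have Taylor series whose product is the normal form; the intersection
  numbers of these series are those of \<open>f\<close> and \<open>g\<close>.\<close>

lemma R_equiv_factors:
  assumes "R_equiv \<delta> q T" and \<delta>: "expands \<delta> q (f * g)" and c: "conv f" "conv g"
    and 0: "cf f 0 0 = 0" "cf g 0 0 = 0" and T: "taylor (\<lambda>w. complex_of_real (T w)) 0 P"
  obtains F G where "F * G = P" "cf F 0 0 = 0" "cf G 0 0 = 0"
    "\<forall>n. isect_num F G n \<longrightarrow> isect_num f g n" "\<forall>n. isect_num G F n \<longrightarrow> isect_num g f n"
    "conj2 f = f \<longrightarrow> conj2 F = F" "conj2 g = g \<longrightarrow> conj2 G = G"
proof -
  obtain V W \<phi> \<psi> where V: "open V" "0 \<in> V" "open W" "\<phi> 0 = q" "homeomorphism V W \<phi> \<psi>"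
    "smooth2_on V \<phi>" "smooth2_on W \<psi>" and eq: "\<forall>\<^sub>F w in nhds 0. \<delta> (\<phi> w) = T w"
    using assms(1) unfolding R_equiv_def by blast
  have qW: "q \<in> W" using V(2,4,5) by (auto simp: homeomorphism_def)
  have \<psi>q: "\<psi> q = 0" using V(2,4,5) by (auto simp: homeomorphism_def)
  have tm: "taylor_map \<phi> 0" "taylor_map \<psi> q"
    using smooth_taylor_map V qW by blast+
  have inv: "\<forall>\<^sub>F w in nhds q. \<phi> (\<psi> w) = w"
  proof (rule eventually_mono[OF eventually_nhds_in_open[OF V(3) qW]])
    show "\<phi> (\<psi> w) = w" if "w \<in> W" for w using V(5) that unfolding homeomorphism_def by blast
  qed
  define ff where "ff = (\<lambda>w. psum f (cpoint (w - q)))"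
  define gg where "gg = (\<lambda>w. psum g (cpoint (w - q)))"
  have tf: "taylor ff q f" and tg: "taylor gg q g" unfolding ff_def gg_def using conv_taylor c by blast+
  have "has_taylor ff (\<phi> 0)" "has_taylor gg (\<phi> 0)" using tf tg V(4) unfolding has_taylor_def by auto
  from has_taylor_compose[OF this(1) tm(1)] has_taylor_compose[OF this(2) tm(1)]
  obtain F G where F: "taylor (\<lambda>w. ff (\<phi> w)) 0 F" and G: "taylor (\<lambda>w. gg (\<phi> w)) 0 G"
    unfolding has_taylor_def by blast
  have "\<forall>\<^sub>F h in nhds 0. complex_of_real (\<delta> (q + h)) = psum (f * g) (cpoint h)"
    using \<delta> by (simp add: expands_def)
  with eventually_cpoint[OF psum_mult[OF c]]
  have "\<forall>\<^sub>F h in nhds 0. complex_of_real (\<delta> (q + h)) = ff (q + h) * gg (q + h)"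
    by eventually_elim (simp add: ff_def gg_def)
  then have ev: "\<forall>\<^sub>F h in nhds 0. complex_of_real (\<delta> (q + h)) - ff (q + h) * gg (q + h) = 0"
    by eventually_elim simp
  have "taylor (\<lambda>w. ff (\<phi> w) * gg (\<phi> w)) 0 P"
  proof (rule taylor_cong_0[OF _ T])
    have "continuous_on V \<phi>" using V(5) by (simp add: homeomorphism_def)
    then have "isCont \<phi> 0" using V(1,2) continuous_on_eq_continuous_at by blast
    then have "\<phi> \<midarrow>0\<rightarrow> \<phi> 0" by (simp add: isCont_def)
    then have "filterlim \<phi> (nhds (\<phi> 0)) (nhds 0)" by (rule tendsto_at_iff_tendsto_nhds[THEN iffD1])
    moreover have "((\<lambda>w. w - q) \<longlongrightarrow> q - q) (nhds q)"
      by (rule tendsto_diff[OF filterlim_ident tendsto_const])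
    ultimately have "filterlim (\<lambda>w. \<phi> w - q) (nhds 0) (nhds 0)"
      using filterlim_compose[of "\<lambda>w. w - q" "nhds 0" "nhds q" \<phi> "nhds 0"] V(4) by simp
    then have "\<forall>\<^sub>F w in nhds 0. complex_of_real (\<delta> (q + (\<phi> w - q))) - ff (q + (\<phi> w - q)) * gg (q + (\<phi> w - q)) = 0"
      using ev unfolding filterlim_iff by blast
    with eq show "\<forall>\<^sub>F h in nhds 0. complex_of_real (T (0 + h)) = ff (\<phi> (0 + h)) * gg (\<phi> (0 + h))"
      by eventually_elim simp
  qed
  from taylor_unique[OF taylor_mult[OF F G] this] have FG: "F * G = P" .
  have F0: "cf F 0 0 = 0" "cf G 0 0 = 0"
    using taylor_00[OF F] taylor_00[OF G] taylor_00[OF tf] taylor_00[OF tg] 0 V(4) by auto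
  have isect_num: "isect_num F G n \<Longrightarrow> isect_num f g n" "isect_num G F n \<Longrightarrow> isect_num g f n" for n
    using isect_num_transport[OF tm(1) V(4) tm(2) \<psi>q inv tf tg F G] isect_num_transport[OF tm(1) V(4) tm(2) \<psi>q inv tg tf G F] by blast+
  have real: "conj2 f = f \<Longrightarrow> conj2 F = F" "conj2 g = g \<Longrightarrow> conj2 G = G"
  proof -
    assume "conj2 f = f"
    then have "(\<lambda>w. cnj (ff (\<phi> w))) = (\<lambda>w. ff (\<phi> w))" unfolding ff_def using psum_cj[of f] by metis
    then show "conj2 F = F" using taylor_unique[OF taylor_cnj[OF F]] F by simp
  next
    assume "conj2 g = g"
    then have "(\<lambda>w. cnj (gg (\<phi> w))) = (\<lambda>w. gg (\<phi> w))" unfolding gg_def using psum_cj[of g] by metis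
    then show "conj2 G = G" using taylor_unique[OF taylor_cnj[OF G]] G by simp
  qed
  show ?thesis
    by (rule that[OF FG F0]) (use isect_num real in blast)+
qed

text \<open>If \<open>-\<delta>\<close> is the germ with the given normal form, the sign is absorbed in \<open>f\<close>.\<close>

lemma has_singularity_factors:
  assumes "has_singularity \<delta> q T" and \<delta>: "expands \<delta> q (f * g)" and c: "conv f" "conv g"
    and 0: "cf f 0 0 = 0" "cf g 0 0 = 0" and T: "taylor (\<lambda>w. complex_of_real (T w)) 0 P"
  obtains F G where "F * G = P" "cf F 0 0 = 0" "cf G 0 0 = 0"
    "\<forall>n. isect_num F G n \<longrightarrow> isect_num f g n" "\<forall>n. isect_num G F n \<longrightarrow> isect_num g f n"
    "conj2 f = f \<longrightarrow> conj2 F = F" "conj2 g = g \<longrightarrow> conj2 G = G"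
  using assms(1) unfolding has_singularity_def
proof
  assume R: "R_equiv \<delta> q T"
  show ?thesis by (rule R_equiv_factors[OF R \<delta> c 0 T]) (rule that)
next
  assume R: "R_equiv (\<lambda>w. - \<delta> w) q T"
  have "expands (\<lambda>w. - \<delta> w) q ((- f) * g)"
    using expands_mult[OF expands_const[of "-1"] \<delta>] by (simp add: cst_simps)
  moreover have "cf (- f) 0 0 = 0" using 0(1) by simp
  ultimately obtain F G where *: "F * G = P" "cf F 0 0 = 0" "cf G 0 0 = 0"
    "\<forall>n. isect_num F G n \<longrightarrow> isect_num (- f) g n" "\<forall>n. isect_num G F n \<longrightarrow> isect_num g (- f) n"
    "conj2 (- f) = - f \<longrightarrow> conj2 F = F" "conj2 g = g \<longrightarrow> conj2 G = G"
    using R_equiv_factors[OF R _ conv_uminus[OF c(1)] c(2) _ 0(2) T] by blast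
  show ?thesis
    by (rule that[OF *(1-3)]) (use *(4-7) isect_num_uminus[of "- f" g] isect_num_uminus[of g "- f"] in auto)
qed

lemma taylor_X: "taylor (\<lambda>w. complex_of_real (fst w)) 0 X2"
  and taylor_Y: "taylor (\<lambda>w. complex_of_real (snd w)) 0 Y2"
  using taylor_fst[of 0] taylor_snd[of 0] by (simp_all add: cst_simps)

lemma taylor_sing_A: "taylor (\<lambda>w. complex_of_real (sing_A s k w)) 0 (X2\<^sup>2 + cst (complex_of_real s) * Y2 ^ (k + 1))"
proof -
  have "taylor (\<lambda>w. complex_of_real (fst w) ^ 2 + complex_of_real s * complex_of_real (snd w) ^ (k + 1)) 0
    (X2\<^sup>2 + cst (complex_of_real s) * Y2 ^ (k + 1))"
    by (intro taylor_add taylor_mult taylor_const taylor_power taylor_X taylor_Y)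
  then show ?thesis by (simp add: sing_A_def case_prod_unfold)
qed

lemma taylor_sing_D:
  "taylor (\<lambda>w. complex_of_real (sing_D s (m + 2) w)) 0 (Y2 * (X2\<^sup>2 + cst (complex_of_real s) * Y2 ^ m))"
proof -
  have "taylor (\<lambda>w. complex_of_real (snd w) * (complex_of_real (fst w) ^ 2 + complex_of_real s * complex_of_real (snd w) ^ m)) 0
    (Y2 * (X2\<^sup>2 + cst (complex_of_real s) * Y2 ^ m))"
    by (intro taylor_add taylor_mult taylor_const taylor_power taylor_X taylor_Y)
  then show ?thesis by (simp add: sing_D_def case_prod_unfold algebra_simps)
qed

lemma taylor_sing_E7: "taylor (\<lambda>w. complex_of_real (sing_E7 w)) 0 (X2 * (X2\<^sup>2 + Y2 ^ 3))"
proof -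
  have "taylor (\<lambda>w. complex_of_real (fst w) * (complex_of_real (fst w) ^ 2 + complex_of_real (snd w) ^ 3)) 0
    (X2 * (X2\<^sup>2 + Y2 ^ 3))"
    by (intro taylor_add taylor_mult taylor_power taylor_X taylor_Y)
  then show ?thesis by (simp add: sing_E7_def case_prod_unfold algebra_simps power2_eq_square power3_eq_cube)
qed

theorem theorem3p16:
  fixes M :: "(real^3) set" and U :: "(real \<times> real) set" and X :: "real \<times> real \<Rightarrow> real^3"
    and p :: "real^3" and q :: "real \<times> real"
  assumes "regular_analytic_surface M"
    and "p \<in> M"
    and "local_parametrisation M U X" and "q \<in> U" and "X q = p"
    and "umbilic X q"
  shows "(spacelike_at X q \<longrightarrow>
            (\<forall>k\<ge>1. has_singularity (lpc_delta X) q (sing_A 1 (2 * k - 1)) \<longrightarrow> umbilic_mult X q k)) \<and>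
         (timelike_at X q \<and> simple_singularity (lpc_delta X) q \<longrightarrow>
            (\<forall>k\<ge>1. has_singularity (lpc_delta X) q (sing_A (-1) (2 * k - 1)) \<longrightarrow>
                umbilic_mult X q k) \<and>
            (\<forall>k\<ge>2. has_singularity (lpc_delta X) q (sing_D 1 (2 * k + 1)) \<longrightarrow>
                umbilic_mult X q 2) \<and>
            (\<forall>k\<ge>2. has_singularity (lpc_delta X) q (sing_D 1 (2 * k)) \<longrightarrow>
                umbilic_mult X q 2) \<and>
            (\<forall>k\<ge>2. has_singularity (lpc_delta X) q (sing_D (-1) (2 * k)) \<longrightarrow>
                umbilic_mult X q 2 \<or> umbilic_mult X q k) \<and>
            (has_singularity (lpc_delta X) q sing_E7 \<longrightarrow> umbilic_mult X q 3))"
proof (cases "(coeff_F X q)\<^sup>2 - coeff_E X q * coeff_G X q = 0")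
  case True
  then show ?thesis by (simp add: spacelike_at_def timelike_at_def)
next
  case False
  obtain f g where c: "conv f" "conv g" and z: "cf f 0 0 = 0" "cf g 0 0 = 0"
    and \<delta>: "expands (lpc_delta X) q (f * g)"
    and real: "timelike_at X q \<longrightarrow> conj2 f = f \<and> conj2 g = g"
    and mult: "\<forall>n. isect_num f g n \<or> isect_num g f n \<longrightarrow> umbilic_mult X q n"
    by (rule umbilic_multiplicity_setup[OF assms(3,4,6) False])
  have A: "umbilic_mult X q k"
    if sing: "has_singularity (lpc_delta X) q (sing_A s (2 * k - 1))" and "s \<noteq> 0" "k \<ge> 1" for s k
  proof -
    obtain F G where *: "F * G = X2\<^sup>2 + cst (complex_of_real s) * Y2 ^ (2 * k - 1 + 1)" "cf F 0 0 = 0" "cf G 0 0 = 0"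
      "\<forall>n. isect_num F G n \<longrightarrow> isect_num f g n" "\<forall>n. isect_num G F n \<longrightarrow> isect_num g f n"
      "conj2 f = f \<longrightarrow> conj2 F = F" "conj2 g = g \<longrightarrow> conj2 G = G"
      by (rule has_singularity_factors[OF sing \<delta> c z taylor_sing_A])
    have "2 * k - 1 + 1 = 2 * k" using that(3) by simp
    then have "isect_num F G k" using isect_num_A[of F G "complex_of_real s" k] * that(2) by simp
    then show ?thesis using *(4) mult by blast
  qed
  have D: "umbilic_mult X q 2 \<or> (even m \<and> umbilic_mult X q (m div 2 + 1) \<and> \<not> (s = 1 \<and> timelike_at X q))"
    if sing: "has_singularity (lpc_delta X) q (sing_D s (m + 2))" and "s \<noteq> 0" "m \<ge> 2" for s m
  proof -
    obtain F G where *: "F * G = Y2 * (X2\<^sup>2 + cst (complex_of_real s) * Y2 ^ m)" "cf F 0 0 = 0" "cf G 0 0 = 0"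
      "\<forall>n. isect_num F G n \<longrightarrow> isect_num f g n" "\<forall>n. isect_num G F n \<longrightarrow> isect_num g f n"
      "conj2 f = f \<longrightarrow> conj2 F = F" "conj2 g = g \<longrightarrow> conj2 G = G"
      by (rule has_singularity_factors[OF sing \<delta> c z taylor_sing_D])
    have "complex_of_real s \<noteq> 0" using that(2) by simp
    from isect_num_D[OF *(1) that(3) this *(2,3)] consider "isect_num F G 2" | "isect_num G F 2"
      | "even m" "isect_num F G (m div 2 + 1) \<or> isect_num G F (m div 2 + 1)"
        "\<not> (complex_of_real s = 1 \<and> conj2 F = F \<and> conj2 G = G)" by blast
    then show ?thesis
    proof cases
      case 3
      have "umbilic_mult X q (m div 2 + 1)" using 3(2) *(4,5) mult by blast
      moreover have "\<not> (s = 1 \<and> timelike_at X q)" using 3(3) *(6,7) real by auto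
      ultimately show ?thesis using 3(1) by blast
    qed (use *(4,5) mult in blast)+
  qed
  have E7: "umbilic_mult X q 3" if sing: "has_singularity (lpc_delta X) q sing_E7"
  proof -
    obtain F G where *: "F * G = X2 * (X2\<^sup>2 + Y2 ^ 3)" "cf F 0 0 = 0" "cf G 0 0 = 0"
      "\<forall>n. isect_num F G n \<longrightarrow> isect_num f g n" "\<forall>n. isect_num G F n \<longrightarrow> isect_num g f n"
      "conj2 f = f \<longrightarrow> conj2 F = F" "conj2 g = g \<longrightarrow> conj2 G = G"
      by (rule has_singularity_factors[OF sing \<delta> c z taylor_sing_E7])
    show ?thesis using isect_num_E7[OF *(1-3)] *(4,5) mult by blast
  qed
  show ?thesis
  proof (intro conjI impI allI)
    show "umbilic_mult X q k" if "1 \<le> k" "has_singularity (lpc_delta X) q (sing_A 1 (2 * k - 1))" for k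
      using A[of 1 k] that by simp
    show "umbilic_mult X q k" if "1 \<le> k" "has_singularity (lpc_delta X) q (sing_A (-1) (2 * k - 1))" for k
      using A[of "-1" k] that by simp
    show "umbilic_mult X q 2" if "2 \<le> k" "has_singularity (lpc_delta X) q (sing_D 1 (2 * k + 1))" for k
    proof -
      \<comment> \<open>The exponent \<open>m\<close> in \<open>y (x\<^sup>2 \<plusminus> y\<^sup>m)\<close> is the index of the \<open>D\<close>-singularity minus 2.\<close>
      have eq: "2 * k + 1 = (2 * k - 1) + 2" using that(1) by simp
      have "odd (2 * k - 1)" using that(1) by simp
      then show ?thesis using D[of 1 "2 * k - 1", folded eq] that by auto
    qed
    show "umbilic_mult X q 2" if "timelike_at X q \<and> simple_singularity (lpc_delta X) q" "2 \<le> k"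
      "has_singularity (lpc_delta X) q (sing_D 1 (2 * k))" for k
    proof -
      have eq: "2 * k = (2 * k - 2) + 2" using that(2) by simp
      show ?thesis using D[of 1 "2 * k - 2", folded eq] that by auto
    qed
    show "umbilic_mult X q 2 \<or> umbilic_mult X q k" if "2 \<le> k"
      "has_singularity (lpc_delta X) q (sing_D (-1) (2 * k))" for k
    proof -
      have eq: "2 * k = (2 * k - 2) + 2" "(2 * k - 2) div 2 + 1 = k" using that(1) by auto
      show ?thesis using D[of "-1" "2 * k - 2", folded eq(1), unfolded eq(2)] that by auto
    qed
    show "umbilic_mult X q 3" if "has_singularity (lpc_delta X) q sing_E7"
      using E7 that .
  qed
qed

end
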